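(* (a) Any whole-line Jacobi matrix $H$ in the Simon Class is either periodic, and so reflectionless on its spectrum, or decomposes into a direct sum of finite (in fact $2\times2$) matrices, and so has pure point spectrum of infinite multiplicity. (b) Similarly, any whole-line CMV matrix $\mathcal{E}$ in the Khrushchev Class that does not belong to the single-coefficient class is either reflectionless on its spectrum or has pure point spectrum. Here the single-coefficient class consists of the whole-line CMV matrices whose Verblunsky coefficients are, for some $j_0\in\mathbb{Z}$ and some $\beta$ with $0<|\beta|<1$, given by $\alpha_{j_0}=\beta$ and $\alpha_n=0$ for all $n\neq j_0$.
   Context: Jacobi side. A whole-line Jacobi matrix $H=H(\{a_n,b_n\}_{n\in\mathbb{Z}})$, $a_n\ge0$, $b_n\in\mathbb{R}$, acts on $\ell^2(\mathbb{Z})$ by $(Hu)(n)=a_nu(n+1)+b_nu(n)+a_{n-1}u(n-1)$ and is assumed self-adjoint. It belongs to the Simon Class if $\mu_n=\mu_m$ for all $n,m\in\mathbb{Z}$, where $\mu_j$ is the spectral measure of $H$ and the standard basis vector $\delta_j$. $H$ is reflectionless on a Borel set $A\subseteq\mathbb{R}$ if for every $n\in\mathbb{Z}$ the Borel transform $\int\frac{d\mu_n(x)}{x-z}$ has boundary values (as $z\to\lambda+i0$) with vanishing real part for Lebesgue a.e. $\lambda\in A$. Periodic means that $\{a_n\},\{b_n\}$ are periodic in $n$. CMV side. Let $\mathbb{D}$ be the open unit disc. Given Verblunsky coefficients $\{\alpha_n\}_{n\in\mathbb{Z}}$ with $|\alpha_n|\le1$, the whole-line CMV matrix is the unitary operator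 $\mathcal{E}=\mathcal{L}\mathcal{M}$ on $\ell^2(\mathbb{Z})$, where $\mathcal{L}$ is the direct sum over $k\in\mathbb{Z}$ of the blocks $\Theta_{2k}$ acting on coordinates $2k,2k+1$, $\mathcal{M}$ is the direct sum of the blocks $\Theta_{2k-1}$ acting on coordinates $2k-1,2k$, and $\Theta_k=\begin{pmatrix}\bar\alpha_k&\rho_k\\ \rho_k&-\alpha_k\end{pmatrix}$, $\rho_k=(1-|\alpha_k|^2)^{1/2}$. It belongs to the Khrushchev Class if $\mu_n=\mu_m$ for all $n,m\in\mathbb{Z}$, where $\mu_j$ is the spectral measure of $\mathcal{E}$ and $\delta_j$. A Schur function is an analytic $f$ on $\mathbb{D}$ with $|f|\le1$; $f(z;\gamma_0,\gamma_1,\dots)$ denotes the Schur function $f=f_0$ with $\gamma_n=f_n(0)$, $zf_{n+1}(z)=\frac{f_n(z)-\gamma_n}{1-\bar\gamma_nf_n(z)}$ (stopping with $f_n\equiv\gamma_n$ if $|\gamma_n|=1$). With $f_+(z,n)=f(z;\alpha_n,\alpha_{n+1},\dots)$ and $f_-(z,n)=f(z;-\overline{\alpha_{n-1}},-\overline{\alpha_{n-2}},\dots)$, $\mathcal{E}$ is reflectionless on a Borel set $A\subseteq\partial\mathbb{D}$ if for all $n\in\mathbb{Z}$ the radial boundary values satisfy $zf_+(z,n)=\overline{f_-(z,n)}$ for Lebesgue a.e. $z\in A$.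
   Formalization: In (b) the formal statement also excludes the boundary case |β|=1 of the single-coefficient class (α_{j0}=β, all other α_n=0): there E is a sum of two bilateral shifts, in the Khrushchev Class, but neither reflectionless on its spectrum nor pure point, so (b) fails as stated. *)

theory Defs
  imports "HOL-Complex_Analysis.Complex_Analysis" "HOL-Library.Function_Algebras"
begin

section \<open>The Hilbert space of square-summable two-sided sequences\<close>

definition ell2 :: "(int \<Rightarrow> complex) set" where
  "ell2 = {u. (\<lambda>n. (cmod (u n))\<^sup>2) summable_on UNIV}"

text \<open>The inner product is antilinear in the first argument.\<close>

definition ell2_inner :: "(int \<Rightarrow> complex) \<Rightarrow> (int \<Rightarrow> complex) \<Rightarrow> complex" where
  "ell2_inner u v = (\<Sum>\<^sub>\<infinity>n. cnj (u n) * v n)"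

definition ell2_norm :: "(int \<Rightarrow> complex) \<Rightarrow> real" where
  "ell2_norm u = sqrt (\<Sum>\<^sub>\<infinity>n. (cmod (u n))\<^sup>2)"

definition delta :: "int \<Rightarrow> int \<Rightarrow> complex" where
  "delta j = (\<lambda>n. if n = j then 1 else 0)"

definition cscale :: "complex \<Rightarrow> (int \<Rightarrow> complex) \<Rightarrow> int \<Rightarrow> complex" where
  "cscale c u = (\<lambda>n. c * u n)"

interpretation cseq: vector_space cscale
  by unfold_locales (auto simp: cscale_def algebra_simps)

definition dense_in_ell2 :: "(int \<Rightarrow> complex) set \<Rightarrow> bool" where
  "dense_in_ell2 S \<longleftrightarrow> (\<forall>u\<in>ell2. \<forall>e>0. \<exists>v\<in>S. ell2_norm (u - v) < e)"

section \<open>Operators\<close>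

text \<open>
  A possibly unbounded operator is given by its domain \<open>D\<close>, a linear subspace of \<^const>\<open>ell2\<close>,
  and a map \<open>T\<close> on sequences that is linear and maps \<open>D\<close> into \<^const>\<open>ell2\<close>; the values of \<open>T\<close>
  outside \<open>D\<close> play no role.
\<close>

text \<open>The second conjunct says that the graph of the adjoint is the graph of the operator.\<close>

definition self_adjoint ::
  "(int \<Rightarrow> complex) set \<Rightarrow> ((int \<Rightarrow> complex) \<Rightarrow> int \<Rightarrow> complex) \<Rightarrow> bool" where
  "self_adjoint D T \<longleftrightarrow> dense_in_ell2 D \<and>
     (\<forall>v\<in>ell2. \<forall>w\<in>ell2.
        (\<forall>u\<in>D. ell2_inner v (T u) = ell2_inner w u) \<longleftrightarrow> v \<in> D \<and> w = T v)"

definition resolvent_set ::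
  "(int \<Rightarrow> complex) set \<Rightarrow> ((int \<Rightarrow> complex) \<Rightarrow> int \<Rightarrow> complex) \<Rightarrow> complex set" where
  "resolvent_set D T = {z. bij_betw (\<lambda>u. T u - cscale z u) D ell2 \<and>
     (\<exists>C. \<forall>u\<in>D. ell2_norm u \<le> C * ell2_norm (T u - cscale z u))}"

definition spectrum ::
  "(int \<Rightarrow> complex) set \<Rightarrow> ((int \<Rightarrow> complex) \<Rightarrow> int \<Rightarrow> complex) \<Rightarrow> complex set" where
  "spectrum D T = - resolvent_set D T"

definition eigenspace ::
  "(int \<Rightarrow> complex) set \<Rightarrow> ((int \<Rightarrow> complex) \<Rightarrow> int \<Rightarrow> complex) \<Rightarrow> complex
     \<Rightarrow> (int \<Rightarrow> complex) set" where
  "eigenspace D T l = {u\<in>D. T u = cscale l u}"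

text \<open>Pure point spectrum: the eigenvectors are complete.\<close>

definition pure_point_spectrum ::
  "(int \<Rightarrow> complex) set \<Rightarrow> ((int \<Rightarrow> complex) \<Rightarrow> int \<Rightarrow> complex) \<Rightarrow> bool" where
  "pure_point_spectrum D T \<longleftrightarrow> dense_in_ell2 (cseq.span (\<Union>l. eigenspace D T l))"

definition eigenvalues_infinite_multiplicity ::
  "(int \<Rightarrow> complex) set \<Rightarrow> ((int \<Rightarrow> complex) \<Rightarrow> int \<Rightarrow> complex) \<Rightarrow> bool" where
  "eigenvalues_infinite_multiplicity D T \<longleftrightarrow>
     (\<forall>l. eigenspace D T l \<noteq> {0} \<longrightarrow>
        \<not> (\<exists>F. finite F \<and> eigenspace D T l \<subseteq> cseq.span F))"

text \<open>
  The spectral measure of a self-adjoint operator and a vector \<open>v\<close> is the finite Borel measure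
  on the line whose Borel transform is \<open>\<langle>v, (T - z)\<^sup>-\<^sup>1 v\<rangle>\<close>. It is determined by this
  property (Stieltjes inversion) and exists by the spectral theorem; in the formula \<open>u\<close> is
  \<open>(T - z)\<^sup>-\<^sup>1 v\<close>.
\<close>

definition self_adjoint_spectral_measure ::
  "(int \<Rightarrow> complex) set \<Rightarrow> ((int \<Rightarrow> complex) \<Rightarrow> int \<Rightarrow> complex) \<Rightarrow> (int \<Rightarrow> complex)
     \<Rightarrow> real measure \<Rightarrow> bool" where
  "self_adjoint_spectral_measure D T v \<mu> \<longleftrightarrow>
     sets \<mu> = sets borel \<and> finite_measure \<mu> \<and>
     (\<forall>z. Im z \<noteq> 0 \<longrightarrow>
        (\<exists>u\<in>D. T u - cscale z u = v \<and>
               ell2_inner v u = (LINT x|\<mu>. 1 / (complex_of_real x - z))))"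

text \<open>
  The spectral measure of a unitary operator on \<^const>\<open>ell2\<close> and a vector \<open>v\<close> is the finite
  Borel measure on the unit circle with moments \<open>\<langle>v, U\<^sup>k v\<rangle>\<close>, here encoded as a measure on the
  plane that does not charge the complement of the circle. The moments with negative index are
  the complex conjugates of those with positive index, so the given ones determine it.
\<close>

definition unitary_spectral_measure ::
  "((int \<Rightarrow> complex) \<Rightarrow> int \<Rightarrow> complex) \<Rightarrow> (int \<Rightarrow> complex) \<Rightarrow> complex measure \<Rightarrow> bool" where
  "unitary_spectral_measure U v \<mu> \<longleftrightarrow>
     sets \<mu> = sets borel \<and> finite_measure \<mu> \<and> emeasure \<mu> (- sphere 0 1) = 0 \<and>
     (\<forall>k::nat. (LINT x|\<mu>. x ^ k) = ell2_inner v ((U ^^ k) v))"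

text \<open>
  The direct sum over all integers \<open>k\<close> of the blocks \<open>B k\<close>, acting on the coordinates
  \<open>s + 2 * k\<close> and \<open>s + 2 * k + 1\<close>.
\<close>

definition direct_sum_2x2 ::
  "int \<Rightarrow> (int \<Rightarrow> complex^2^2) \<Rightarrow> (int \<Rightarrow> complex) \<Rightarrow> int \<Rightarrow> complex" where
  "direct_sum_2x2 s B u n =
     (let k = (n - s) div 2
      in (B k *v vector [u (s + 2 * k), u (s + 2 * k + 1)]) $ (if even (n - s) then 1 else 2))"

section \<open>Whole-line Jacobi matrices\<close>

definition jacobi :: "(int \<Rightarrow> real) \<Rightarrow> (int \<Rightarrow> real) \<Rightarrow> (int \<Rightarrow> complex) \<Rightarrow> int \<Rightarrow> complex" where
  "jacobi a b u n = of_real (a n) * u (n + 1) + of_real (b n) * u n + of_real (a (n - 1)) * u (n - 1)"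

text \<open>The operator is taken on its maximal domain.\<close>

definition jacobi_dom :: "(int \<Rightarrow> real) \<Rightarrow> (int \<Rightarrow> real) \<Rightarrow> (int \<Rightarrow> complex) set" where
  "jacobi_dom a b = {u\<in>ell2. jacobi a b u \<in> ell2}"

definition whole_line_jacobi :: "(int \<Rightarrow> real) \<Rightarrow> (int \<Rightarrow> real) \<Rightarrow> bool" where
  "whole_line_jacobi a b \<longleftrightarrow> (\<forall>n. a n \<ge> 0) \<and> self_adjoint (jacobi_dom a b) (jacobi a b)"

definition simon_class :: "(int \<Rightarrow> real) \<Rightarrow> (int \<Rightarrow> real) \<Rightarrow> bool" where
  "simon_class a b \<longleftrightarrow>
     (\<exists>\<mu>. (\<forall>j. self_adjoint_spectral_measure (jacobi_dom a b) (jacobi a b) (delta j) (\<mu> j)) \<and>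
          (\<forall>n m. \<mu> n = \<mu> m))"

definition jacobi_reflectionless :: "(int \<Rightarrow> real) \<Rightarrow> (int \<Rightarrow> real) \<Rightarrow> real set \<Rightarrow> bool" where
  "jacobi_reflectionless a b A \<longleftrightarrow>
     (\<forall>n. \<exists>\<mu>. self_adjoint_spectral_measure (jacobi_dom a b) (jacobi a b) (delta n) \<mu> \<and>
        (AE l in lborel. l \<in> A \<longrightarrow>
           (\<exists>g. ((\<lambda>e. LINT x|\<mu>. 1 / (complex_of_real x - Complex l e)) \<longlongrightarrow> g) (at_right 0) \<and>
                Re g = 0)))"

definition jacobi_spectrum :: "(int \<Rightarrow> real) \<Rightarrow> (int \<Rightarrow> real) \<Rightarrow> real set" where
  "jacobi_spectrum a b = {x. complex_of_real x \<in> spectrum (jacobi_dom a b) (jacobi a b)}"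

definition jacobi_periodic :: "(int \<Rightarrow> real) \<Rightarrow> (int \<Rightarrow> real) \<Rightarrow> bool" where
  "jacobi_periodic a b \<longleftrightarrow> (\<exists>p>0. \<forall>n. a (n + p) = a n \<and> b (n + p) = b n)"

definition jacobi_direct_sum_2x2 :: "(int \<Rightarrow> real) \<Rightarrow> (int \<Rightarrow> real) \<Rightarrow> bool" where
  "jacobi_direct_sum_2x2 a b \<longleftrightarrow> (\<exists>s B. jacobi a b = direct_sum_2x2 s B)"

section \<open>Whole-line CMV matrices\<close>

definition Theta :: "complex \<Rightarrow> complex^2^2" where
  "Theta c = (let r = complex_of_real (sqrt (1 - (cmod c)\<^sup>2))
              in vector [vector [cnj c, r], vector [r, - c]])"

definition cmv :: "(int \<Rightarrow> complex) \<Rightarrow> (int \<Rightarrow> complex) \<Rightarrow> int \<Rightarrow> complex" where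
  "cmv \<alpha> = direct_sum_2x2 0 (\<lambda>k. Theta (\<alpha> (2 * k))) \<circ> direct_sum_2x2 (-1) (\<lambda>k. Theta (\<alpha> (2 * k - 1)))"

definition verblunsky :: "(int \<Rightarrow> complex) \<Rightarrow> bool" where
  "verblunsky \<alpha> \<longleftrightarrow> (\<forall>n. cmod (\<alpha> n) \<le> 1)"

definition khrushchev_class :: "(int \<Rightarrow> complex) \<Rightarrow> bool" where
  "khrushchev_class \<alpha> \<longleftrightarrow>
     (\<exists>\<mu>. (\<forall>j. unitary_spectral_measure (cmv \<alpha>) (delta j) (\<mu> j)) \<and> (\<forall>n m. \<mu> n = \<mu> m))"

definition schur_function :: "(complex \<Rightarrow> complex) \<Rightarrow> bool" where
  "schur_function f \<longleftrightarrow> f holomorphic_on ball 0 1 \<and> (\<forall>z\<in>ball 0 1. cmod (f z) \<le> 1)"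

text \<open>
  \<open>F n\<close> is the \<open>n\<close>-th Schur iterate. After the first parameter of modulus one nothing is
  required any more, and later entries of \<open>\<gamma>\<close> are ignored.
\<close>

definition schur_parameters :: "(complex \<Rightarrow> complex) \<Rightarrow> (nat \<Rightarrow> complex) \<Rightarrow> bool" where
  "schur_parameters f \<gamma> \<longleftrightarrow>
     (\<exists>F. F 0 = f \<and>
        (\<forall>n. (\<forall>k<n. cmod (\<gamma> k) < 1) \<longrightarrow>
           schur_function (F n) \<and> F n 0 = \<gamma> n \<and>
           (if cmod (\<gamma> n) = 1 then \<forall>z\<in>ball 0 1. F n z = \<gamma> n
            else \<forall>z\<in>ball 0 1. z * F (Suc n) z = (F n z - \<gamma> n) / (1 - cnj (\<gamma> n) * F n z))))"

text \<open>The choice is unique on the unit disc, and only values there are used.\<close>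

definition schur_fun :: "(nat \<Rightarrow> complex) \<Rightarrow> complex \<Rightarrow> complex" where
  "schur_fun \<gamma> = (SOME f. schur_parameters f \<gamma>)"

definition schur_plus :: "(int \<Rightarrow> complex) \<Rightarrow> int \<Rightarrow> complex \<Rightarrow> complex" where
  "schur_plus \<alpha> n = schur_fun (\<lambda>k. \<alpha> (n + int k))"

definition schur_minus :: "(int \<Rightarrow> complex) \<Rightarrow> int \<Rightarrow> complex \<Rightarrow> complex" where
  "schur_minus \<alpha> n = schur_fun (\<lambda>k. - cnj (\<alpha> (n - 1 - int k)))"

text \<open>
  Almost every point of the circle with respect to arc length is expressed as \<open>cis t\<close> for
  almost every real \<open>t\<close>.
\<close>

definition cmv_reflectionless :: "(int \<Rightarrow> complex) \<Rightarrow> complex set \<Rightarrow> bool" where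
  "cmv_reflectionless \<alpha> A \<longleftrightarrow>
     (\<forall>n. AE t in lborel. cis t \<in> A \<longrightarrow>
        (\<exists>p m. ((\<lambda>r. schur_plus \<alpha> n (of_real r * cis t)) \<longlongrightarrow> p) (at_left 1) \<and>
               ((\<lambda>r. schur_minus \<alpha> n (of_real r * cis t)) \<longlongrightarrow> m) (at_left 1) \<and>
               cis t * p = cnj m))"

definition single_coefficient_class :: "(int \<Rightarrow> complex) \<Rightarrow> bool" where
  "single_coefficient_class \<alpha> \<longleftrightarrow>
     (\<exists>j\<^sub>0 \<beta>. 0 < cmod \<beta> \<and> cmod \<beta> < 1 \<and> \<alpha> j\<^sub>0 = \<beta> \<and> (\<forall>n. n \<noteq> j\<^sub>0 \<longrightarrow> \<alpha> n = 0))"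

text \<open>
  The boundary case \<open>\<bar>\<beta>\<bar> = 1\<close> of the single-coefficient class. The matrix is then the direct sum
  of two bilateral shifts, so all spectral measures are normalized arc length; it is in the
  Khrushchev class, its spectrum is the circle, it has no eigenvalues, and it is not
  reflectionless there, since one of the two Schur functions vanishes and the other is unimodular
  on the circle. The dichotomy for the Khrushchev class therefore fails for it as well.
\<close>

definition unimodular_single_coefficient :: "(int \<Rightarrow> complex) \<Rightarrow> bool" where
  "unimodular_single_coefficient \<alpha> \<longleftrightarrow>
     (\<exists>j\<^sub>0 \<beta>. cmod \<beta> = 1 \<and> \<alpha> j\<^sub>0 = \<beta> \<and> (\<forall>n. n \<noteq> j\<^sub>0 \<longrightarrow> \<alpha> n = 0))"

end

theory Submission
  imports Defs "HOL-Real_Asymp.Real_Asymp" "HOL-Computational_Algebra.Fundamental_Theorem_Algebra"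
begin

text \<open>
  For the Simon class, comparing the expansions of the diagonal Green functions at infinity shows
  that \<open>b\<close> and \<open>(a n)\<^sup>2 + (a (n - 1))\<^sup>2\<close> are constant, so that \<open>a\<close> has period 2. If some \<open>a n\<close>
  vanishes, the matrix decouples. Otherwise the square of the Green function is an explicit
  rational function, negative in the interior of the spectrum, so the Green function itself has
  imaginary boundary values there.

  For the Khrushchev class, let \<open>k\<close> be the least distance of two nonzero Verblunsky coefficients.
  The diagonal of the \<open>k\<close>-th power is \<open>- (\<Sum>i\<in>{n - k..<n}. \<alpha> i * cnj (\<alpha> (i + k)))\<close>; its constancy
  forces the nonzero coefficients onto a lattice of step \<open>k\<close>, on which \<open>\<alpha> i * cnj (\<alpha> (i + k))\<close> is
  constant. A unimodular coefficient then recurs, and the matrix splits into finite blocks.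
  Otherwise a twisted sum of the \<open>k\<close>-th powers of the matrix and of its inverse is, up to a constant,
  a shift by \<open>2 k\<close>, which confines the spectrum to explicit bands. On the bands \<open>f\<^sub>+\<close> and
  \<open>1 / (z f\<^sub>-)\<close> are the two fixed points of one Moebius map preserving the circle, hence
  mirror images of each other in the circle.
\<close>

section \<open>Square-summable sequences\<close>


text \<open>Gaps in the spectrum are certified by explicit inverses: \<open>X - z\<close> is
  multiplied by a commuting factor until the product is a constant diagonal plus two shifts, and
  where the diagonal dominates this is inverted directly. In both halves the dominance condition and
  the computation of boundary values are governed by one discriminant, read with opposite signs, so
  together they miss only the band edges, a null set. The algebra determines only squares of the
  boundary values; the positive imaginary part of the Green function, respectively the positive real
  part of a Caratheodory function, selects the root.

  The diagonal of a power of a CMV matrix is a sum over closed paths of a walker, and a closed path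
  needs two reflections. The first power that can have a nonzero diagonal therefore sees exactly the
  pairs of nonzero coefficients at minimal distance. With only one nonzero coefficient there is no
  such pair: all diagonal entries of positive powers vanish and carry no information about the
  coefficient. This is where the excluded classes come from.\<close>

lemma ell2_summable_sq: "u \<in> ell2 \<Longrightarrow> (\<lambda>n. (cmod (u n))\<^sup>2) summable_on A"
  unfolding ell2_def using summable_on_subset_banach by blast

lemma ell2_norm_nonneg [simp]: "0 \<le> ell2_norm u"
  by (simp add: ell2_norm_def infsum_nonneg)

lemma L2_set_le_ell2_norm:
  assumes "u \<in> ell2" "finite F"
  shows "L2_set (\<lambda>n. cmod (u n)) F \<le> ell2_norm u"
  unfolding L2_set_def ell2_norm_def
  by (intro real_sqrt_le_mono finite_sum_le_infsum) (use assms ell2_summable_sq in auto)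

text \<open>Membership and the norm bound are both read off from finite sections, so the triangle
  inequality and domination are inherited from \<open>L2_set\<close>.\<close>

lemma ell2_normI:
  assumes "\<And>F. finite F \<Longrightarrow> L2_set (\<lambda>n. cmod (u n)) F \<le> C"
  shows "u \<in> ell2" "ell2_norm u \<le> C"
proof -
  have C: "0 \<le> C" using assms[of "{}"] by simp
  have bd: "(\<Sum>n\<in>F. (cmod (u n))\<^sup>2) \<le> C\<^sup>2" if "finite F" for F
    using assms[OF that] C unfolding L2_set_def
    by (metis real_sqrt_le_iff real_sqrt_abs abs_of_nonneg)
  have s: "(\<lambda>n. (cmod (u n))\<^sup>2) summable_on UNIV"
    by (intro nonneg_bdd_above_summable_on) (auto intro!: bdd_aboveI2 bd)
  then show "u \<in> ell2" by (simp add: ell2_def)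
  have "(\<Sum>\<^sub>\<infinity>n. (cmod (u n))\<^sup>2) \<le> C\<^sup>2"
    by (rule infsum_le_finite_sums[OF s bd])
  then show "ell2_norm u \<le> C"
    unfolding ell2_norm_def using C real_le_lsqrt by (simp add: real_sqrt_le_iff' real_le_lsqrt infsum_nonneg)
qed

lemma cmod_le_ell2_norm: "u \<in> ell2 \<Longrightarrow> cmod (u n) \<le> ell2_norm u"
  using L2_set_le_ell2_norm[of u "{n}"] by simp

lemma
  assumes "u \<in> ell2" "v \<in> ell2"
  shows ell2_add: "u + v \<in> ell2" and ell2_norm_triangle: "ell2_norm (u + v) \<le> ell2_norm u + ell2_norm v"
proof -
  have "L2_set (\<lambda>n. cmod ((u + v) n)) F \<le> ell2_norm u + ell2_norm v" if F: "finite F" for F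
  proof -
    have "L2_set (\<lambda>n. cmod ((u + v) n)) F \<le> L2_set (\<lambda>n. cmod (u n) + cmod (v n)) F"
      by (intro L2_set_mono) (auto simp: norm_triangle_ineq)
    also have "\<dots> \<le> L2_set (\<lambda>n. cmod (u n)) F + L2_set (\<lambda>n. cmod (v n)) F"
      by (rule L2_set_triangle_ineq)
    finally show ?thesis using L2_set_le_ell2_norm[OF assms(1) F] L2_set_le_ell2_norm[OF assms(2) F] by linarith
  qed
  note * = this
  show "u + v \<in> ell2" using * by (rule ell2_normI(1))
  show "ell2_norm (u + v) \<le> ell2_norm u + ell2_norm v" using * by (rule ell2_normI(2))
qed

text \<open>The map \<open>h\<close> serves for shifts, for the swap of the two sites of a block,
  and for restriction to every second site; injectivity ensures that each entry of \<open>v\<close>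
  is charged at most once.\<close>

lemma
  fixes u v :: "int \<Rightarrow> complex"
  assumes v: "v \<in> ell2" and le: "\<And>n. cmod (u n) \<le> C * cmod (v (h n))" and "inj h" "0 \<le> C"
  shows ell2_dominated: "u \<in> ell2" and ell2_norm_dominated: "ell2_norm u \<le> C * ell2_norm v"
proof -
  have "L2_set (\<lambda>n. cmod (u n)) F \<le> C * ell2_norm v" if F: "finite F" for F
  proof -
    have "L2_set (\<lambda>n. cmod (u n)) F \<le> L2_set (\<lambda>n. C * cmod (v (h n))) F"
      by (intro L2_set_mono le) auto
    also have "\<dots> = C * L2_set (\<lambda>n. cmod (v (h n))) F"
      using \<open>0 \<le> C\<close> by (simp add: L2_set_right_distrib)
    also have "L2_set (\<lambda>n. cmod (v (h n))) F = L2_set (\<lambda>n. cmod (v n)) (h ` F)"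
      unfolding L2_set_def by (subst sum.reindex) (use \<open>inj h\<close> in \<open>auto intro: inj_on_subset\<close>)
    also have "C * \<dots> \<le> C * ell2_norm v"
      using L2_set_le_ell2_norm[OF v] F \<open>0 \<le> C\<close> by (intro mult_left_mono) auto
    finally show ?thesis .
  qed
  note * = this
  show "u \<in> ell2" using * by (rule ell2_normI(1))
  show "ell2_norm u \<le> C * ell2_norm v" using * by (rule ell2_normI(2))
qed

lemma
  assumes "u \<in> ell2"
  shows ell2_cscale: "cscale c u \<in> ell2" and ell2_norm_cscale_le: "ell2_norm (cscale c u) \<le> cmod c * ell2_norm u"
  using ell2_dominated[OF assms, of "cscale c u" "cmod c" id]
    ell2_norm_dominated[OF assms, of "cscale c u" "cmod c" id]
  by (auto simp: cscale_def norm_mult)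

lemma ell2_zero [simp]: "0 \<in> ell2" and ell2_norm_zero [simp]: "ell2_norm 0 = 0"
  by (auto simp: ell2_def ell2_norm_def)

lemma ell2_uminus: "u \<in> ell2 \<Longrightarrow> - u \<in> ell2" and ell2_norm_uminus: "ell2_norm (- u) = ell2_norm u"
  by (auto simp: ell2_def ell2_norm_def)

lemma
  assumes "u \<in> ell2" "v \<in> ell2"
  shows ell2_diff: "u - v \<in> ell2" and ell2_norm_diff_le: "ell2_norm (u - v) \<le> ell2_norm u + ell2_norm v"
  using ell2_add[OF assms(1) ell2_uminus[OF assms(2)]] ell2_norm_triangle[OF assms(1) ell2_uminus[OF assms(2)]]
  by (auto simp: ell2_norm_uminus)

lemma ell2_norm_eq_0: "u \<in> ell2 \<Longrightarrow> ell2_norm u = 0 \<Longrightarrow> u = 0"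
  using cmod_le_ell2_norm[of u] by (fastforce simp: fun_eq_iff)

lemma ell2_norm_sq: "(ell2_norm u)\<^sup>2 = (\<Sum>\<^sub>\<infinity>n. (cmod (u n))\<^sup>2)"
  by (simp add: ell2_norm_def infsum_nonneg)

lemma ell2_finite_support:
  assumes "finite {n. u n \<noteq> 0}"
  shows "u \<in> ell2"
proof -
  have "(\<lambda>n. (cmod (u n))\<^sup>2) summable_on {n. u n \<noteq> 0}" using assms by simp
  then show ?thesis unfolding ell2_def
    by (subst (asm) summable_on_cong_neutral[where T = UNIV and g = "\<lambda>n. (cmod (u n))\<^sup>2"]) auto
qed

lemma delta_in_ell2 [simp]: "delta j \<in> ell2"
  by (rule ell2_finite_support) (auto simp: delta_def)

lemma ell2_tail_small:
  assumes "u \<in> ell2" "0 < e"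
  obtains F where "finite F" "ell2_norm (\<lambda>n. if n \<in> F then 0 else u n) < e"
proof -
  let ?f = "\<lambda>n. (cmod (u n))\<^sup>2"
  have s: "?f summable_on UNIV" using assms by (simp add: ell2_def)
  then have "(sum ?f \<longlongrightarrow> infsum ?f UNIV) (finite_subsets_at_top UNIV)"
    by (simp add: infsum_tendsto)
  then have "\<forall>\<^sub>F F in finite_subsets_at_top UNIV. dist (sum ?f F) (infsum ?f UNIV) < e\<^sup>2"
    using \<open>0 < e\<close> by (auto simp: tendsto_iff)
  then obtain F where F: "finite F" "dist (sum ?f F) (infsum ?f UNIV) < e\<^sup>2"
    by (auto simp: eventually_finite_subsets_at_top)
  have "(\<Sum>\<^sub>\<infinity>n. (cmod (if n \<in> F then 0 else u n))\<^sup>2) = infsum ?f (UNIV - F)"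
    by (rule infsum_cong_neutral) auto
  also have "\<dots> = infsum ?f UNIV - infsum ?f F"
    by (rule infsum_Diff[OF s]) (use F in auto)
  also have "\<dots> < e\<^sup>2" using F by (simp add: dist_real_def)
  finally have "ell2_norm (\<lambda>n. if n \<in> F then 0 else u n) < sqrt (e\<^sup>2)"
    unfolding ell2_norm_def by (rule real_sqrt_less_mono)
  with F \<open>0 < e\<close> show ?thesis by (intro that[of F]) auto
qed

lemma sum_fun_apply: "(\<Sum>v\<in>A. f v) n = (\<Sum>v\<in>A. f v n)"
  by (induction A rule: infinite_finite_induct) auto

lemma finite_support_in_span:
  assumes "\<And>j. delta j \<in> cseq.span S" "finite F"
  shows "(\<lambda>n. if n \<in> F then u n else 0) \<in> cseq.span S"
  using assms(2)
proof induction
  case empty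
  then show ?case using cseq.span_zero[of S] by (simp add: zero_fun_def)
next
  case (insert j F)
  have "(\<lambda>n. if n \<in> insert j F then u n else 0) = cscale (u j) (delta j) + (\<lambda>n. if n \<in> F then u n else 0)"
    using insert by (auto simp: cscale_def delta_def)
  then show ?case using insert assms(1) by (simp add: cseq.span_add cseq.span_scale)
qed

text \<open>Reduces pure point spectrum to an algebraic task: each basis vector has to be a finite
  combination of eigenvectors.\<close>

lemma dense_in_ell2_span:
  assumes "\<And>j. delta j \<in> cseq.span S"
  shows "dense_in_ell2 (cseq.span S)"
  unfolding dense_in_ell2_def
proof (intro ballI allI impI)
  fix u and e :: real assume "u \<in> ell2" "e > 0"
  then obtain F where F: "finite F" "ell2_norm (\<lambda>n. if n \<in> F then 0 else u n) < e"
    by (rule ell2_tail_small)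
  moreover have "u - (\<lambda>n. if n \<in> F then u n else 0) = (\<lambda>n. if n \<in> F then 0 else u n)" by auto
  ultimately show "\<exists>v\<in>cseq.span S. ell2_norm (u - v) < e"
    using finite_support_in_span[OF assms F(1), of u] by metis
qed

section \<open>Inner products\<close>

lemma ell2_inner_summable:
  assumes "u \<in> ell2" "v \<in> ell2"
  shows "(\<lambda>n. cnj (u n) * v n) summable_on UNIV"
proof -
  have "(\<lambda>n. (cmod (u n))\<^sup>2 + (cmod (v n))\<^sup>2) summable_on UNIV"
    using assms by (intro summable_on_add) (auto simp: ell2_def)
  then have "(\<lambda>n. norm (cnj (u n) * v n)) summable_on UNIV"
  proof (rule summable_on_comparison_test)
    fix n
    have "0 \<le> (cmod (u n) - cmod (v n))\<^sup>2" by simp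
    then have "2 * (cmod (u n) * cmod (v n)) \<le> (cmod (u n))\<^sup>2 + (cmod (v n))\<^sup>2"
      by (simp add: power2_eq_square algebra_simps)
    moreover have "0 \<le> cmod (u n) * cmod (v n)" by simp
    ultimately have "cmod (u n) * cmod (v n) \<le> (cmod (u n))\<^sup>2 + (cmod (v n))\<^sup>2" by linarith
    then show "norm (cnj (u n) * v n) \<le> (cmod (u n))\<^sup>2 + (cmod (v n))\<^sup>2"
      by (simp add: norm_mult)
  qed auto
  then show ?thesis by (rule abs_summable_summable)
qed

lemma ell2_inner_add_right:
  "u \<in> ell2 \<Longrightarrow> v \<in> ell2 \<Longrightarrow> w \<in> ell2 \<Longrightarrow> ell2_inner u (v + w) = ell2_inner u v + ell2_inner u w"
  unfolding ell2_inner_def using infsum_add[OF ell2_inner_summable ell2_inner_summable, of u v u w]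
  by (simp add: algebra_simps)

lemma ell2_inner_cscale_right: "ell2_inner u (cscale c v) = c * ell2_inner u v"
  unfolding ell2_inner_def cscale_def by (subst infsum_cmult_right'[symmetric]) (simp add: algebra_simps)

lemma ell2_inner_cnj: "cnj (ell2_inner u v) = ell2_inner v u"
  unfolding ell2_inner_def by (simp flip: infsum_cnj add: mult.commute)

lemma ell2_inner_add_left:
  "u \<in> ell2 \<Longrightarrow> v \<in> ell2 \<Longrightarrow> w \<in> ell2 \<Longrightarrow> ell2_inner (u + v) w = ell2_inner u w + ell2_inner v w"
  unfolding ell2_inner_def using infsum_add[OF ell2_inner_summable ell2_inner_summable, of u w v w]
  by (simp add: algebra_simps)

lemma ell2_inner_cscale_left: "ell2_inner (cscale c u) v = cnj c * ell2_inner u v"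
  unfolding ell2_inner_def cscale_def by (subst infsum_cmult_right'[symmetric]) (simp add: algebra_simps)

lemma ell2_inner_diff_right:
  "u \<in> ell2 \<Longrightarrow> v \<in> ell2 \<Longrightarrow> w \<in> ell2 \<Longrightarrow> ell2_inner u (v - w) = ell2_inner u v - ell2_inner u w"
  using ell2_inner_add_right[of u "v - w" w] by (simp add: ell2_diff)

lemma ell2_inner_self:
  assumes "u \<in> ell2"
  shows "ell2_inner u u = of_real ((ell2_norm u)\<^sup>2)"
proof -
  have "((\<lambda>n. (cmod (u n))\<^sup>2) has_sum (ell2_norm u)\<^sup>2) UNIV"
    unfolding ell2_norm_sq using assms by (intro has_sum_infsum ell2_summable_sq)
  then have "((\<lambda>n. complex_of_real ((cmod (u n))\<^sup>2)) has_sum of_real ((ell2_norm u)\<^sup>2)) UNIV"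
    by (rule has_sum_of_real)
  then have "((\<lambda>n. cnj (u n) * u n) has_sum of_real ((ell2_norm u)\<^sup>2)) UNIV"
    by (simp only: complex_norm_square mult.commute)
  then show ?thesis unfolding ell2_inner_def by (rule infsumI)
qed

lemma ell2_inner_delta_left [simp]: "ell2_inner (delta j) u = u j"
proof -
  have "ell2_inner (delta j) u = (\<Sum>\<^sub>\<infinity>n\<in>{j}. u n)"
    unfolding ell2_inner_def by (rule infsum_cong_neutral) (auto simp: delta_def)
  then show ?thesis by simp
qed

lemma ell2_inner_delta_right [simp]: "ell2_inner u (delta j) = cnj (u j)"
  using ell2_inner_cnj[of "delta j" u] by simp

section \<open>Bounded operators and resolvents\<close>

text \<open>Linearity is required on all sequences, boundedness on \<open>ell2\<close>: the
  operators are built from banded matrices, which act on every sequence, so algebraic identities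
  between them can be stated without membership conditions.\<close>

definition bounded_on_ell2 :: "((int \<Rightarrow> complex) \<Rightarrow> int \<Rightarrow> complex) \<Rightarrow> bool" where
  "bounded_on_ell2 X \<longleftrightarrow>
     (\<exists>C\<ge>0. \<forall>u\<in>ell2. X u \<in> ell2 \<and> ell2_norm (X u) \<le> C * ell2_norm u) \<and>
     (\<forall>u v. X (u + v) = X u + X v) \<and> (\<forall>c u. X (cscale c u) = cscale c (X u))"

lemma bounded_on_ell2I:
  assumes "\<And>u. u \<in> ell2 \<Longrightarrow> X u \<in> ell2" "\<And>u. u \<in> ell2 \<Longrightarrow> ell2_norm (X u) \<le> C * ell2_norm u" "0 \<le> C"
    "\<And>u v. X (u + v) = X u + X v" "\<And>c u. X (cscale c u) = cscale c (X u)"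
  shows "bounded_on_ell2 X"
  using assms unfolding bounded_on_ell2_def by blast

lemma bounded_on_ell2D:
  assumes "bounded_on_ell2 X"
  shows "u \<in> ell2 \<Longrightarrow> X u \<in> ell2" "X (u + v) = X u + X v" "X (cscale c u) = cscale c (X u)"
    "X (u - v) = X u - X v" "X 0 = 0"
proof -
  show add: "X (u + v) = X u + X v" for u v using assms unfolding bounded_on_ell2_def by blast
  show "u \<in> ell2 \<Longrightarrow> X u \<in> ell2" "X (cscale c u) = cscale c (X u)"
    using assms unfolding bounded_on_ell2_def by blast+
  show "X (u - v) = X u - X v" using add[of "u - v" v] by (simp add: algebra_simps)
  show "X 0 = 0" using add[of 0 0] by simp
qed

lemma bounded_on_ell2_bound:
  assumes "bounded_on_ell2 X"
  obtains C where "C \<ge> 0" "\<And>u. u \<in> ell2 \<Longrightarrow> ell2_norm (X u) \<le> C * ell2_norm u"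
  using assms unfolding bounded_on_ell2_def by blast

lemma bounded_on_ell2_compose:
  assumes "bounded_on_ell2 X" "bounded_on_ell2 Y"
  shows "bounded_on_ell2 (\<lambda>u. X (Y u))"
proof -
  obtain C where C: "C \<ge> 0" "\<And>u. u \<in> ell2 \<Longrightarrow> ell2_norm (X u) \<le> C * ell2_norm u"
    by (rule bounded_on_ell2_bound[OF assms(1)]) blast
  obtain C' where C': "C' \<ge> 0" "\<And>u. u \<in> ell2 \<Longrightarrow> ell2_norm (Y u) \<le> C' * ell2_norm u"
    by (rule bounded_on_ell2_bound[OF assms(2)]) blast
  show ?thesis
  proof (rule bounded_on_ell2I[where C = "C * C'"])
    fix u :: "int \<Rightarrow> complex" assume u: "u \<in> ell2"
    then have Y: "Y u \<in> ell2" using bounded_on_ell2D[OF assms(2)] by blast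
    then show "X (Y u) \<in> ell2" using bounded_on_ell2D[OF assms(1)] by blast
    have "ell2_norm (X (Y u)) \<le> C * ell2_norm (Y u)" by (rule C(2)[OF Y])
    also have "\<dots> \<le> C * (C' * ell2_norm u)" using C'(2)[OF u] C(1) by (rule mult_left_mono)
    finally show "ell2_norm (X (Y u)) \<le> C * C' * ell2_norm u" by (simp add: mult.assoc)
  qed (use C C' bounded_on_ell2D[OF assms(1)] bounded_on_ell2D[OF assms(2)] in auto)
qed

lemma bounded_on_ell2_add:
  assumes "bounded_on_ell2 X" "bounded_on_ell2 Y"
  shows "bounded_on_ell2 (\<lambda>u. X u + Y u)"
proof -
  obtain C where C: "C \<ge> 0" "\<And>u. u \<in> ell2 \<Longrightarrow> ell2_norm (X u) \<le> C * ell2_norm u"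
    by (rule bounded_on_ell2_bound[OF assms(1)]) blast
  obtain C' where C': "C' \<ge> 0" "\<And>u. u \<in> ell2 \<Longrightarrow> ell2_norm (Y u) \<le> C' * ell2_norm u"
    by (rule bounded_on_ell2_bound[OF assms(2)]) blast
  note X = bounded_on_ell2D[OF assms(1)] and Y = bounded_on_ell2D[OF assms(2)]
  show ?thesis
  proof (rule bounded_on_ell2I[where C = "C + C'"])
    fix u :: "int \<Rightarrow> complex" assume u: "u \<in> ell2"
    show "X u + Y u \<in> ell2" by (intro ell2_add X(1) Y(1) u)
    have "ell2_norm (X u + Y u) \<le> ell2_norm (X u) + ell2_norm (Y u)"
      by (intro ell2_norm_triangle X(1) Y(1) u)
    then show "ell2_norm (X u + Y u) \<le> (C + C') * ell2_norm u"
      using C(2)[OF u] C'(2)[OF u] by (simp add: algebra_simps)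
  next
    show "X (cscale c u) + Y (cscale c u) = cscale c (X u + Y u)" for c u
      unfolding X(3) Y(3) by (simp add: cscale_def fun_eq_iff algebra_simps)
  qed (use C C' X(2) Y(2) in auto)
qed

lemma bounded_on_ell2_id: "bounded_on_ell2 (\<lambda>u. u)"
  by (rule bounded_on_ell2I[where C = 1]) auto

lemma bounded_on_ell2_cscale:
  assumes "bounded_on_ell2 X"
  shows "bounded_on_ell2 (\<lambda>u. cscale c (X u))"
proof -
  have "bounded_on_ell2 (cscale c)"
    by (rule bounded_on_ell2I[where C = "cmod c"])
      (use ell2_cscale ell2_norm_cscale_le in \<open>auto simp: cscale_def fun_eq_iff algebra_simps\<close>)
  then show ?thesis by (rule bounded_on_ell2_compose) fact
qed

lemma bounded_on_ell2_diff:
  assumes "bounded_on_ell2 X" "bounded_on_ell2 Y"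
  shows "bounded_on_ell2 (\<lambda>u. X u - Y u)"
proof -
  have "X u - Y u = X u + cscale (- 1) (Y u)" for u by (auto simp: cscale_def)
  then show ?thesis using bounded_on_ell2_add[OF assms(1) bounded_on_ell2_cscale[OF assms(2), of "- 1"]] by simp
qed

lemma bounded_on_ell2_weighted_shift:
  assumes "inj h" "\<And>n. cmod (g n) \<le> C"
  shows "bounded_on_ell2 (\<lambda>u n. g n * u (h n))"
proof (rule bounded_on_ell2I[where C = C])
  have C: "0 \<le> C" using assms(2)[of 0] norm_ge_zero order_trans by blast
  then show "0 \<le> C" .
  fix u :: "int \<Rightarrow> complex" assume u: "u \<in> ell2"
  have le: "cmod (g n * u (h n)) \<le> C * cmod (u (h n))" for n
    using assms(2) by (auto simp: norm_mult intro: mult_right_mono)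
  show "(\<lambda>n. g n * u (h n)) \<in> ell2" by (rule ell2_dominated[OF u le \<open>inj h\<close> C])
  show "ell2_norm (\<lambda>n. g n * u (h n)) \<le> C * ell2_norm u" by (rule ell2_norm_dominated[OF u le \<open>inj h\<close> C])
qed (auto simp: cscale_def fun_eq_iff algebra_simps)

text \<open>\<open>Q\<close> is a factor commuting with \<open>X - z\<close> such that the product
  \<open>T\<close> is simple enough to invert. Surjectivity of \<open>X - z\<close> follows from
  \<open>(X - z) Q = T\<close>, injectivity and the lower bound from
  \<open>Q (X - z) = T\<close>.\<close>

lemma resolvent_setI:
  assumes X: "bounded_on_ell2 X" and Q: "bounded_on_ell2 Q"
    and comm: "\<And>u. u \<in> ell2 \<Longrightarrow> X (Q u) - cscale z (Q u) = T u" "\<And>u. u \<in> ell2 \<Longrightarrow> Q (X u - cscale z u) = T u"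
    and surj: "\<And>v. v \<in> ell2 \<Longrightarrow> \<exists>u\<in>ell2. T u = v"
    and bdd: "\<And>u. u \<in> ell2 \<Longrightarrow> ell2_norm u \<le> C * ell2_norm (T u)" and "0 \<le> C"
  shows "z \<in> resolvent_set ell2 X"
proof -
  note X' = bounded_on_ell2D[OF X] and Q' = bounded_on_ell2D[OF Q]
  obtain B where B: "B \<ge> 0" "\<And>u. u \<in> ell2 \<Longrightarrow> ell2_norm (Q u) \<le> B * ell2_norm u"
    by (rule bounded_on_ell2_bound[OF Q]) blast
  let ?Y = "\<lambda>u. X u - cscale z u"
  have Yin: "?Y u \<in> ell2" if "u \<in> ell2" for u using that by (intro ell2_diff X' ell2_cscale)
  have le: "ell2_norm u \<le> C * B * ell2_norm (?Y u)" if "u \<in> ell2" for u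
  proof -
    have "ell2_norm u \<le> C * ell2_norm (Q (?Y u))" unfolding comm(2)[OF that] by (rule bdd[OF that])
    also have "\<dots> \<le> C * (B * ell2_norm (?Y u))" using B(2)[OF Yin[OF that]] \<open>0 \<le> C\<close> by (rule mult_left_mono)
    finally show ?thesis by (simp add: mult.assoc)
  qed
  have "inj_on ?Y ell2"
  proof (rule inj_onI)
    fix u v :: "int \<Rightarrow> complex" assume uv: "u \<in> ell2" "v \<in> ell2" "?Y u = ?Y v"
    have "?Y (u - v) = ?Y u - ?Y v" unfolding X'(4) cseq.scale_right_diff_distrib by simp
    then have "?Y (u - v) = 0" using uv(3) by simp
    then have "ell2_norm (u - v) \<le> 0" using le[OF ell2_diff[OF uv(1,2)]] by (metis ell2_norm_zero mult_zero_right)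
    then have "u - v = 0" by (intro ell2_norm_eq_0 ell2_diff uv antisym) auto
    then show "u = v" by simp
  qed
  moreover have "?Y ` ell2 = ell2"
  proof
    show "?Y ` ell2 \<subseteq> ell2" using Yin by auto
    show "ell2 \<subseteq> ?Y ` ell2"
    proof
      fix v :: "int \<Rightarrow> complex" assume "v \<in> ell2"
      then obtain u where u: "u \<in> ell2" "T u = v" using surj by blast
      have "v = ?Y (Q u)" unfolding comm(1)[OF u(1)] u(2) ..
      then show "v \<in> ?Y ` ell2" using Q'(1)[OF u(1)] by (rule image_eqI)
    qed
  qed
  ultimately have "bij_betw ?Y ell2 ell2" unfolding bij_betw_def ..
  moreover have "\<exists>C. \<forall>u\<in>ell2. ell2_norm u \<le> C * ell2_norm (?Y u)" using le by (intro exI ballI)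
  ultimately show ?thesis unfolding resolvent_set_def mem_Collect_eq ..
qed


section \<open>Inverting a constant diagonal perturbed by two shifts\<close>

lemma ell2_pointwise_limit:
  assumes "\<And>N. s N \<in> ell2" "\<And>N. ell2_norm (s N) \<le> C" "\<And>n. (\<lambda>N. s N n) \<longlonglongrightarrow> u n"
  shows "u \<in> ell2"
proof (rule ell2_normI(1))
  fix F :: "int set" assume F: "finite F"
  have "(\<lambda>N. L2_set (\<lambda>n. cmod (s N n)) F) \<longlonglongrightarrow> L2_set (\<lambda>n. cmod (u n)) F"
    unfolding L2_set_def by (intro tendsto_intros assms)
  moreover have "L2_set (\<lambda>n. cmod (s N n)) F \<le> C" for N
    using L2_set_le_ell2_norm[OF assms(1) F] assms(2) order_trans by blast
  ultimately show "L2_set (\<lambda>n. cmod (u n)) F \<le> C"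
    by (intro tendsto_upperbound[of _ _ sequentially]) auto
qed

lemma bounded_on_ell2_two_shifts:
  assumes "\<And>n. cmod (g n) \<le> \<kappa>" "\<And>n. cmod (h n) \<le> \<kappa>"
  shows "bounded_on_ell2 (\<lambda>u n. g n * u (n + m) + h n * u (n - m))"
    and "u \<in> ell2 \<Longrightarrow> ell2_norm (\<lambda>n. g n * u (n + m) + h n * u (n - m)) \<le> 2 * \<kappa> * ell2_norm u"
proof -
  have inj: "inj (\<lambda>n. n + m)" "inj (\<lambda>n. n - m)" by (auto simp: inj_on_def)
  have *: "(\<lambda>n. g n * u (n + m) + h n * u (n - m)) = (\<lambda>n. g n * u (n + m)) + (\<lambda>n. h n * u (n - m))" for u
    by auto
  show "bounded_on_ell2 (\<lambda>u n. g n * u (n + m) + h n * u (n - m))"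
    unfolding * by (intro bounded_on_ell2_add bounded_on_ell2_weighted_shift[where C = \<kappa>] inj assms)
  show "ell2_norm (\<lambda>n. g n * u (n + m) + h n * u (n - m)) \<le> 2 * \<kappa> * ell2_norm u" if "u \<in> ell2"
  proof -
    have \<kappa>: "0 \<le> \<kappa>" using assms(1)[of 0] norm_ge_zero order_trans by blast
    have 1: "cmod (g n * u (n + m)) \<le> \<kappa> * cmod (u (n + m))" for n
      using assms by (auto simp: norm_mult intro: mult_right_mono)
    have 2: "cmod (h n * u (n - m)) \<le> \<kappa> * cmod (u (n - m))" for n
      using assms by (auto simp: norm_mult intro: mult_right_mono)
    have "ell2_norm ((\<lambda>n. g n * u (n + m)) + (\<lambda>n. h n * u (n - m)))
        \<le> ell2_norm (\<lambda>n. g n * u (n + m)) + ell2_norm (\<lambda>n. h n * u (n - m))"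
      by (intro ell2_norm_triangle ell2_dominated[OF that 1 inj(1) \<kappa>] ell2_dominated[OF that 2 inj(2) \<kappa>])
    also have "\<dots> \<le> \<kappa> * ell2_norm u + \<kappa> * ell2_norm u"
      by (intro add_mono ell2_norm_dominated[OF that 1 inj(1) \<kappa>] ell2_norm_dominated[OF that 2 inj(2) \<kappa>])
    finally show ?thesis unfolding * by simp
  qed
qed

text \<open>Neumann series; the iterates converge pointwise, which suffices since only two entries interact.\<close>

lemma
  fixes g h :: "int \<Rightarrow> complex" and y :: complex and m :: int
  assumes g: "\<And>n. cmod (g n) \<le> \<kappa>" and h: "\<And>n. cmod (h n) \<le> \<kappa>" and y: "2 * \<kappa> < cmod y"
  defines "T \<equiv> \<lambda>u n. g n * u (n + m) + h n * u (n - m) + y * u n"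
  shows dominant_diagonal_surj: "v \<in> ell2 \<Longrightarrow> \<exists>u\<in>ell2. T u = v"
    and dominant_diagonal_bound: "u \<in> ell2 \<Longrightarrow> ell2_norm u \<le> 1 / (cmod y - 2 * \<kappa>) * ell2_norm (T u)"
proof -
  define K where "K = (\<lambda>u n. g n * u (n + m) + h n * u (n - m))"
  have \<kappa>: "0 \<le> \<kappa>" using g[of 0] norm_ge_zero order_trans by blast
  then have y0: "0 < cmod y" using y by linarith
  have K: "bounded_on_ell2 K" "\<And>u. u \<in> ell2 \<Longrightarrow> ell2_norm (K u) \<le> 2 * \<kappa> * ell2_norm u"
    unfolding K_def using bounded_on_ell2_two_shifts[OF g h] by auto
  note K' = bounded_on_ell2D[OF K(1)]
  show "ell2_norm u \<le> 1 / (cmod y - 2 * \<kappa>) * ell2_norm (T u)" if u: "u \<in> ell2"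
  proof -
    have Tu: "T u = K u + cscale y u" by (auto simp: T_def K_def cscale_def)
    have Tin: "T u \<in> ell2" unfolding Tu by (intro ell2_add K' ell2_cscale u)
    have yu: "u = cscale (inverse y) (T u - K u)"
      using y0 unfolding Tu by (auto simp: cscale_def)
    have "ell2_norm u \<le> cmod (inverse y) * ell2_norm (T u - K u)"
      by (subst yu, rule ell2_norm_cscale_le) (intro ell2_diff K' u Tin)
    also have "\<dots> \<le> cmod (inverse y) * (ell2_norm (T u) + 2 * \<kappa> * ell2_norm u)"
      using ell2_norm_diff_le[OF Tin K'(1)[OF u]] K(2)[OF u] by (intro mult_left_mono) auto
    finally have "ell2_norm u \<le> (ell2_norm (T u) + 2 * \<kappa> * ell2_norm u) / cmod y"
      by (simp add: norm_inverse divide_inverse mult.commute)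
    then have "(cmod y - 2 * \<kappa>) * ell2_norm u \<le> ell2_norm (T u)"
      using y0 by (simp add: field_simps)
    then show ?thesis using y by (simp add: field_simps)
  qed
  show "\<exists>u\<in>ell2. T u = v" if v: "v \<in> ell2"
  proof -
    define w where "w = cscale (inverse y) v"
    define \<theta> where "\<theta> = 2 * \<kappa> / cmod y"
    have \<theta>: "0 \<le> \<theta>" "\<theta> < 1" using \<kappa> y y0 by (auto simp: \<theta>_def)
    have w: "w \<in> ell2" unfolding w_def by (intro ell2_cscale v)
    define s where "s = rec_nat 0 (\<lambda>N t. w - cscale (inverse y) (K t))"
    have s0: "s 0 = 0" and sS: "\<And>N. s (Suc N) = w - cscale (inverse y) (K (s N))"
      by (auto simp: s_def)
    have KK: "cscale (inverse y) (K t) \<in> ell2" "ell2_norm (cscale (inverse y) (K t)) \<le> \<theta> * ell2_norm t"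
      if t: "t \<in> ell2" for t
    proof -
      show "cscale (inverse y) (K t) \<in> ell2" by (intro ell2_cscale K' t)
      have "ell2_norm (cscale (inverse y) (K t)) \<le> cmod (inverse y) * ell2_norm (K t)"
        by (intro ell2_norm_cscale_le K' t)
      also have "\<dots> \<le> cmod (inverse y) * (2 * \<kappa> * ell2_norm t)"
        by (intro mult_left_mono K(2) t) auto
      finally show "ell2_norm (cscale (inverse y) (K t)) \<le> \<theta> * ell2_norm t"
        by (simp add: \<theta>_def norm_inverse divide_inverse mult_ac)
    qed
    have s: "s N \<in> ell2" for N
    proof (induction N)
      case 0
      show ?case unfolding s0 by (rule ell2_zero)
    next
      case (Suc N)
      show ?case unfolding sS by (intro ell2_diff w KK Suc)
    qed
    have bd: "ell2_norm (s N) \<le> ell2_norm w / (1 - \<theta>)" for N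
    proof (induction N)
      case 0
      show ?case unfolding s0 ell2_norm_zero using \<theta> by simp
    next
      case (Suc N)
      have "ell2_norm (s (Suc N)) \<le> ell2_norm w + \<theta> * ell2_norm (s N)"
        using ell2_norm_diff_le[OF w KK(1)[OF s]] KK(2)[OF s, of N] unfolding sS by (meson add_left_mono order_trans)
      also have "\<dots> \<le> ell2_norm w + \<theta> * (ell2_norm w / (1 - \<theta>))"
        by (intro add_left_mono mult_left_mono Suc \<theta>)
      also have "\<dots> = ell2_norm w / (1 - \<theta>)" using \<theta> by (simp add: field_simps)
      finally show ?case .
    qed
    have d: "ell2_norm (s (Suc N) - s N) \<le> \<theta> ^ N * ell2_norm w" for N
    proof (induction N)
      case 0
      show ?case unfolding s0 sS using K'(5) by (simp add: cscale_def zero_fun_def[symmetric])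
    next
      case (Suc N)
      have "s (Suc (Suc N)) - s (Suc N)
          = (w - cscale (inverse y) (K (s (Suc N)))) - (w - cscale (inverse y) (K (s N)))"
        by (rule arg_cong2[where f = "(-)", OF sS sS])
      also have "\<dots> = - cscale (inverse y) (K (s (Suc N) - s N))"
        unfolding K'(4) cseq.scale_right_diff_distrib by simp
      finally have "ell2_norm (s (Suc (Suc N)) - s (Suc N)) \<le> \<theta> * ell2_norm (s (Suc N) - s N)"
        using KK(2)[OF ell2_diff[OF s s]] by (simp add: ell2_norm_uminus)
      also have "\<dots> \<le> \<theta> * (\<theta> ^ N * ell2_norm w)" by (intro mult_left_mono Suc \<theta>)
      finally show ?case unfolding power_Suc mult.assoc .
    qed
    have "\<exists>l. (\<lambda>N. s N n) \<longlonglongrightarrow> l" for n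
    proof -
      have "summable (\<lambda>N. s (Suc N) n - s N n)"
      proof (rule summable_comparison_test)
        show "summable (\<lambda>N. \<theta> ^ N * ell2_norm w)" using \<theta> by (intro summable_mult2) simp
        have "norm (s (Suc N) n - s N n) \<le> \<theta> ^ N * ell2_norm w" for N
          using order_trans[OF cmod_le_ell2_norm[OF ell2_diff[OF s s], of "Suc N" N n] d] unfolding minus_apply .
        then show "\<exists>N0. \<forall>N\<ge>N0. norm (s (Suc N) n - s N n) \<le> \<theta> ^ N * ell2_norm w" by blast
      qed
      then have "(\<lambda>N. \<Sum>i<N. s (Suc i) n - s i n) \<longlonglongrightarrow> (\<Sum>N. s (Suc N) n - s N n)"
        by (rule summable_LIMSEQ)
      moreover have "(\<Sum>i<N. s (Suc i) n - s i n) = s N n" for N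
        using sum_lessThan_telescope[of "\<lambda>i. s i n" N] unfolding s0 by simp
      ultimately show ?thesis by auto
    qed
    then obtain u where lim: "\<And>n. (\<lambda>N. s N n) \<longlonglongrightarrow> u n" by metis
    have u: "u \<in> ell2" by (rule ell2_pointwise_limit[OF s bd lim])
    have "u n = w n - inverse y * K u n" for n
    proof -
      have "(\<lambda>N. s (Suc N) n) \<longlonglongrightarrow> w n - inverse y * K u n"
        unfolding sS K_def cscale_def minus_apply by (intro tendsto_intros lim)
      moreover have "(\<lambda>N. s (Suc N) n) \<longlonglongrightarrow> u n" using lim by (rule LIMSEQ_Suc)
      ultimately show ?thesis using LIMSEQ_unique by blast
    qed
    then have "y * u n = v n - K u n" for n
      using y0 by (simp add: w_def cscale_def field_simps)
    then have "T u = v" by (auto simp: T_def K_def)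
    then show ?thesis using u by blast
  qed
qed


section \<open>The Simon class\<close>

text \<open>Pair the resolvent equation with \<open>u\<close>; self-adjointness makes the pairing of
  \<open>u\<close> with its image real. The identity supplies both the bound on the resolvent and
  the sign of the imaginary part of the Green function.\<close>

lemma jacobi_resolvent_im:
  assumes sa: "self_adjoint (jacobi_dom a b) (jacobi a b)"
    and u: "u \<in> jacobi_dom a b" and eq: "jacobi a b u - cscale z u = delta j"
  shows "Im (u j) = Im z * (ell2_norm u)\<^sup>2"
proof -
  let ?H = "jacobi a b"
  have in2: "u \<in> ell2" "?H u \<in> ell2" using u by (auto simp: jacobi_dom_def)
  have "ell2_inner u (?H u) = ell2_inner (?H u) u"
    using sa u in2 unfolding self_adjoint_def by blast
  then have real: "Im (ell2_inner u (?H u)) = 0"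
    using ell2_inner_cnj[of u "?H u"] by (metis complex_cnj cnj.simps(2) minus_equation_iff complex.sel(2) equal_neg_zero)
  have "cnj (u j) = ell2_inner u (?H u - cscale z u)" unfolding eq by simp
  also have "\<dots> = ell2_inner u (?H u) - z * of_real ((ell2_norm u)\<^sup>2)"
    using in2 by (simp only: ell2_inner_diff_right ell2_cscale ell2_inner_cscale_right ell2_inner_self)
  finally have "Im (cnj (u j)) = - Im z * (ell2_norm u)\<^sup>2" using real by simp
  then show ?thesis by simp
qed

lemma jacobi_resolvent_bound:
  assumes sa: "self_adjoint (jacobi_dom a b) (jacobi a b)"
    and u: "u \<in> jacobi_dom a b" and eq: "jacobi a b u - cscale z u = delta j" and z: "0 < Im z"
  shows "cmod (u m) \<le> 1 / Im z"
proof -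
  have in2: "u \<in> ell2" using u by (auto simp: jacobi_dom_def)
  have "Im z * (ell2_norm u)\<^sup>2 \<le> cmod (u j)"
    using jacobi_resolvent_im[OF sa u eq] abs_Im_le_cmod[of "u j"] by linarith
  also have "\<dots> \<le> ell2_norm u" by (rule cmod_le_ell2_norm[OF in2])
  finally have *: "Im z * (ell2_norm u)\<^sup>2 \<le> ell2_norm u" .
  have "Im z * ell2_norm u \<le> 1"
  proof (cases "ell2_norm u = 0")
    case False
    then have "0 < ell2_norm u" using ell2_norm_nonneg[of u] by linarith
    then show ?thesis using * by (simp add: power2_eq_square)
  qed simp
  then have "ell2_norm u \<le> 1 / Im z" using z by (simp add: field_simps)
  then show ?thesis using cmod_le_ell2_norm[OF in2, of m] by linarith
qed

text \<open>The moment expansion of the diagonal Green function to third order; the constant term is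
  the second moment, the squared norm of the \<open>j\<close>-th column. The entries of
  \<open>a\<close> and \<open>b\<close> may be unbounded at this stage, so the expansion is obtained
  row by row from the resolvent equation instead of from a Neumann series.\<close>

lemma jacobi_green_asymptotics:
  assumes sa: "self_adjoint (jacobi_dom a b) (jacobi a b)"
    and G: "\<And>y. y > 0 \<Longrightarrow> \<exists>u\<in>jacobi_dom a b. jacobi a b u - cscale (\<i> * of_real y) u = delta j \<and> u j = G y"
  shows "((\<lambda>y. (\<i> * of_real y) ^ 3 * G y + (\<i> * of_real y) ^ 2 + of_real (b j) * (\<i> * of_real y)
            + of_real ((a j)\<^sup>2 + (b j)\<^sup>2 + (a (j - 1))\<^sup>2)) \<longlongrightarrow> 0) at_top"
proof -
  obtain U where U: "\<And>y. y > 0 \<Longrightarrow> U y \<in> jacobi_dom a b"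
    "\<And>y. y > 0 \<Longrightarrow> jacobi a b (U y) - cscale (\<i> * of_real y) (U y) = delta j" "\<And>y. y > 0 \<Longrightarrow> U y j = G y"
    using G by metis
  have lim: "((\<lambda>y. U y m) \<longlongrightarrow> 0) at_top" for m
  proof (rule Lim_null_comparison)
    show "\<forall>\<^sub>F y in at_top. norm (U y m) \<le> 1 / y"
      using eventually_gt_at_top[of 0]
    proof eventually_elim
      case (elim y)
      then show ?case using jacobi_resolvent_bound[OF sa U(1,2), of y m] by simp
    qed
    show "((\<lambda>y::real. 1 / y) \<longlongrightarrow> 0) at_top" by real_asymp
  qed
  define A B where "A = (\<lambda>m. complex_of_real (a (j + m)))" and "B = (\<lambda>m. complex_of_real (b (j + m)))"
  define h where "h = (A 0)\<^sup>2 + (B 0)\<^sup>2 + (A (- 1))\<^sup>2"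
  \<comment> \<open>\<open>R y\<close> is the entry at \<open>j\<close> of the third power of the
    matrix applied to the resolvent column: row \<open>j\<close> of the square, with entries such as
    \<open>A 0 * A 1\<close>, is applied to the image of the column. Its coefficients do not depend
    on \<open>y\<close>, so it tends to zero with the column.\<close>
  define R where "R = (\<lambda>y. let u = (\<lambda>m. U y (j + m)) in
     A 0 * A 1 * (A 2 * u 3 + B 2 * u 2 + A 1 * u 1) + A 0 * (B 1 + B 0) * (A 1 * u 2 + B 1 * u 1 + A 0 * u 0)
     + h * (A 0 * u 1 + B 0 * u 0 + A (- 1) * u (- 1))
     + A (- 1) * (B (- 1) + B 0) * (A (- 1) * u 0 + B (- 1) * u (- 1) + A (- 2) * u (- 2))
     + A (- 1) * A (- 2) * (A (- 2) * u (- 1) + B (- 2) * u (- 2) + A (- 3) * u (- 3)))"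
  have R: "(R \<longlongrightarrow> 0) at_top"
    unfolding R_def Let_def by (auto intro!: tendsto_eq_intros lim)
  have "R y = (\<i> * of_real y) ^ 3 * G y + (\<i> * of_real y) ^ 2 + of_real (b j) * (\<i> * of_real y)
            + of_real ((a j)\<^sup>2 + (b j)\<^sup>2 + (a (j - 1))\<^sup>2)" if y: "y > 0" for y
  proof -
    define z where "z = \<i> * complex_of_real y"
    define u where "u = (\<lambda>m. U y (j + m))"
    have e: "z * u m = A m * u (m + 1) + B m * u m + A (m - 1) * u (m - 1) - (if m = 0 then 1 else 0)" for m
      using fun_cong[OF U(2)[OF y], of "j + m"]
      by (auto simp: z_def u_def A_def B_def jacobi_def cscale_def delta_def algebra_simps)
    have e0: "z * u 0 = A 0 * u 1 + B 0 * u 0 + A (- 1) * u (- 1) - 1"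
      and e1: "z * u 1 = A 1 * u 2 + B 1 * u 1 + A 0 * u 0"
      and e2: "z * u 2 = A 2 * u 3 + B 2 * u 2 + A 1 * u 1"
      and e3: "z * u (- 1) = A (- 1) * u 0 + B (- 1) * u (- 1) + A (- 2) * u (- 2)"
      and e4: "z * u (- 2) = A (- 2) * u (- 1) + B (- 2) * u (- 2) + A (- 3) * u (- 3)"
      using e[of 0] e[of 1] e[of 2] e[of "- 1"] e[of "- 2"] by simp_all
    have "R y = A 0 * A 1 * (z * u 2) + A 0 * (B 1 + B 0) * (z * u 1) + h * (z * u 0 + 1)
        + A (- 1) * (B (- 1) + B 0) * (z * u (- 1)) + A (- 1) * A (- 2) * (z * u (- 2))"
      unfolding e0 e1 e2 e3 e4 by (simp add: R_def Let_def u_def)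
    also have "\<dots> = z * (A 0 * (A 1 * u 2 + B 1 * u 1 + A 0 * u 0) + B 0 * (A 0 * u 1 + B 0 * u 0 + A (- 1) * u (- 1))
        + A (- 1) * (A (- 1) * u 0 + B (- 1) * u (- 1) + A (- 2) * u (- 2))) + h"
      by (simp add: h_def algebra_simps power2_eq_square)
    also have "\<dots> = z * (A 0 * (z * u 1) + B 0 * (z * u 0 + 1) + A (- 1) * (z * u (- 1))) + h"
      unfolding e0 e1 e3 by simp
    also have "\<dots> = z * (z * (A 0 * u 1 + B 0 * u 0 + A (- 1) * u (- 1)) + B 0) + h"
      by (simp add: algebra_simps)
    also have "A 0 * u 1 + B 0 * u 0 + A (- 1) * u (- 1) = z * u 0 + 1" using e0 by simp
    also have "z * (z * \<dots> + B 0) + h = z ^ 3 * u 0 + z ^ 2 + B 0 * z + h" by (simp add: algebra_simps power2_eq_square power3_eq_cube)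
    finally show ?thesis using U(3)[OF y] by (simp add: h_def A_def B_def u_def z_def)
  qed
  with eventually_gt_at_top[of "0::real"] show ?thesis
    by (intro Lim_transform_eventually[OF R]) (rule eventually_mono)
qed

lemma simon_class_greenE:
  assumes "simon_class a b"
  obtains \<mu> where "\<And>j. self_adjoint_spectral_measure (jacobi_dom a b) (jacobi a b) (delta j) \<mu>"
    "\<And>j z. Im z \<noteq> 0 \<Longrightarrow> \<exists>u\<in>jacobi_dom a b. jacobi a b u - cscale z u = delta j
        \<and> u j = (LINT x|\<mu>. 1 / (complex_of_real x - z))"
proof -
  obtain \<nu> where \<nu>: "\<And>j. self_adjoint_spectral_measure (jacobi_dom a b) (jacobi a b) (delta j) (\<nu> j)"
    "\<And>n m. \<nu> n = \<nu> m"
    using assms unfolding simon_class_def by blast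
  have *: "self_adjoint_spectral_measure (jacobi_dom a b) (jacobi a b) (delta j) (\<nu> 0)" for j
    using \<nu>(1)[of j] \<nu>(2)[of j 0] by simp
  moreover have "\<exists>u\<in>jacobi_dom a b. jacobi a b u - cscale z u = delta j
        \<and> u j = (LINT x|\<nu> 0. 1 / (complex_of_real x - z))" if "Im z \<noteq> 0" for j z
    using *[of j] that unfolding self_adjoint_spectral_measure_def by (metis ell2_inner_delta_left)
  ultimately show ?thesis by (rule that)
qed

lemma simon_class_period_2:
  assumes "whole_line_jacobi a b" "simon_class a b"
  shows "a (n + 2) = a n" "b n = b m"
proof -
  have sa: "self_adjoint (jacobi_dom a b) (jacobi a b)" and nonneg: "\<And>n. a n \<ge> 0"
    using assms(1) by (auto simp: whole_line_jacobi_def)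
  obtain \<mu> where \<mu>: "\<And>j z. Im z \<noteq> 0 \<Longrightarrow> \<exists>u\<in>jacobi_dom a b. jacobi a b u - cscale z u = delta j
        \<and> u j = (LINT x|\<mu>. 1 / (complex_of_real x - z))"
    using simon_class_greenE[OF assms(2)] by metis
  define h where "h = (\<lambda>j. (a j)\<^sup>2 + (b j)\<^sup>2 + (a (j - 1))\<^sup>2)"
  have eq: "b j = b k \<and> h j = h k" for j k
  proof -
    have lim: "((\<lambda>y. (\<i> * of_real y) ^ 3 * (LINT x|\<mu>. 1 / (complex_of_real x - \<i> * of_real y)) + (\<i> * of_real y) ^ 2
        + of_real (b j) * (\<i> * of_real y) + of_real (h j)) \<longlongrightarrow> 0) at_top" for j
      unfolding h_def by (rule jacobi_green_asymptotics[OF sa]) (use \<mu> in auto)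
    \<comment> \<open>At \<open>z = \<i> * y\<close> the linear term is purely imaginary and the
      constant term is real, so the two comparisons separate.\<close>
    have d: "((\<lambda>y. of_real (b j - b k) * (\<i> * of_real y) + complex_of_real (h j - h k)) \<longlongrightarrow> 0) at_top"
      using tendsto_diff[OF lim[of j] lim[of k]] by (simp add: algebra_simps)
    have "((\<lambda>y::real. h j - h k) \<longlongrightarrow> 0) at_top" using tendsto_Re[OF d] by simp
    then have "h j = h k" by (simp add: tendsto_const_iff)
    moreover have im: "((\<lambda>y::real. (b j - b k) * y) \<longlongrightarrow> 0) at_top" using tendsto_Im[OF d] by simp
    have "((\<lambda>y::real. (b j - b k) * y * (1 / y)) \<longlongrightarrow> 0) at_top"
      by (rule tendsto_mult_zero[OF im]) real_asymp
    then have "((\<lambda>y::real. b j - b k) \<longlongrightarrow> 0) at_top"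
      by (rule Lim_transform_eventually) (rule eventually_mono[OF eventually_gt_at_top[of "0::real"]], simp)
    then have "b j = b k" by (simp add: tendsto_const_iff)
    ultimately show ?thesis by simp
  qed
  then show "b n = b m" by blast
  \<comment> \<open>The second moments at \<open>n + 2\<close> and \<open>n + 1\<close> share the
    summand \<open>(a (n + 1))\<^sup>2\<close>, and the squares of \<open>b\<close> agree.\<close>
  have "(a (n + 2))\<^sup>2 = (a n)\<^sup>2"
    using eq[of "n + 2" "n + 1"] by (auto simp: h_def algebra_simps)
  then show "a (n + 2) = a n" using nonneg power2_eq_iff_nonneg by blast
qed

lemma jacobi_bounded_on_ell2:
  assumes "\<And>n. \<bar>a n\<bar> \<le> A" "\<And>n. \<bar>b n\<bar> \<le> B"
  shows "bounded_on_ell2 (jacobi a b)" "jacobi_dom a b = ell2"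
proof -
  have *: "jacobi a b = (\<lambda>u. (\<lambda>n. of_real (a n) * u (n + 1) + of_real (a (n - 1)) * u (n - 1)) + (\<lambda>n. of_real (b n) * u n))"
    by (auto simp: jacobi_def fun_eq_iff)
  show "bounded_on_ell2 (jacobi a b)"
    unfolding * by (intro bounded_on_ell2_add bounded_on_ell2_two_shifts(1)[where \<kappa> = A]
        bounded_on_ell2_weighted_shift[where C = B and h = "\<lambda>n. n"]) (use assms in auto)
  then show "jacobi_dom a b = ell2" by (auto simp: jacobi_dom_def bounded_on_ell2D)
qed

section \<open>The case of a vanishing off-diagonal entry\<close>

lemma direct_sum_2x2_fst:
  "direct_sum_2x2 s B u (s + 2 * k) = B k $ 1 $ 1 * u (s + 2 * k) + B k $ 1 $ 2 * u (s + 2 * k + 1)"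
  by (simp add: direct_sum_2x2_def matrix_vector_mult_def sum_2)

lemma direct_sum_2x2_snd:
  "direct_sum_2x2 s B u (s + 2 * k + 1) = B k $ 2 $ 1 * u (s + 2 * k) + B k $ 2 $ 2 * u (s + 2 * k + 1)"
  by (simp add: direct_sum_2x2_def matrix_vector_mult_def sum_2)

text \<open>Evaluation at \<open>x i\<close> sees only \<open>w i\<close>, so the \<open>w i\<close>
  are linearly independent. This is the test for infinite multiplicity.\<close>

lemma not_in_finite_span:
  assumes "\<And>i j::nat. w i (x j) = 0 \<longleftrightarrow> i \<noteq> j" "finite F" "range w \<subseteq> cseq.span F"
  shows False
proof -
  have inj: "inj w" by (rule injI) (metis assms(1))
  have "\<not> cseq.dependent (range w)"
  proof
    assume "cseq.dependent (range w)"
    then obtain t c v where t: "finite t" "t \<subseteq> range w" "(\<Sum>v\<in>t. cscale (c v) v) = 0" "v \<in> t" "c v \<noteq> 0"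
      unfolding cseq.dependent_explicit by blast
    obtain i where i: "v = w i" using t by auto
    have "0 = (\<Sum>v\<in>t. cscale (c v) v) (x i)" using t(3) by simp
    also have "\<dots> = (\<Sum>u\<in>t. c u * u (x i))" by (simp add: sum_fun_apply cscale_def)
    also have "\<dots> = (\<Sum>u\<in>{v}. c u * u (x i))"
      using t i assms(1) by (intro sum.mono_neutral_right) auto
    finally show False using t i assms(1) by auto
  qed
  then have "finite (range w)" using cseq.independent_span_bound[OF assms(2) _ assms(3)] by blast
  then show False using inj finite_imageD by blast
qed

lemma period_2_shift:
  fixes a :: "int \<Rightarrow> 'a"
  assumes "\<And>n. a (n + 2) = a n"
  shows "a (n + 2 * k) = a n"
proof (induction k rule: int_induct[where k = 0])
  case (step1 i)
  then show ?case using assms[of "n + 2 * i"] by (simp add: algebra_simps)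
next
  case (step2 i)
  then show ?case using assms[of "n + 2 * (i - 1)"] by (simp add: algebra_simps)
qed simp

text \<open>As \<open>a\<close> has period 2, the vanishing entry recurs at every second bond, and
  all blocks on the sites \<open>s + 2 * k\<close>, \<open>s + 2 * k + 1\<close> equal the symmetric
  matrix with diagonal \<open>b 0\<close> and off-diagonal entry \<open>a s\<close>. Its
  eigenvectors are the sum and the difference of the two basis vectors.\<close>

lemma jacobi_decoupled:
  assumes a: "\<And>n. a (n + 2) = a n" "a (s - 1) = 0" and b: "\<And>n. b n = b 0" and a0: "\<And>n. a n \<ge> 0"
  shows "jacobi_direct_sum_2x2 a b" "pure_point_spectrum (jacobi_dom a b) (jacobi a b)"
    "eigenvalues_infinite_multiplicity (jacobi_dom a b) (jacobi a b)"
proof -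
  note per = period_2_shift[of a, OF a(1)]
  let ?p = "a s"
  have as: "a (s + 2 * k) = ?p" "a (s + 2 * k + 1) = 0" "a (s + 2 * k - 1) = 0" for k
    using per[of s k] per[of "s - 1" "k + 1"] per[of "s - 1" "k"] a(2) by (simp_all add: algebra_simps)
  have cases: "(\<exists>k. n = s + 2 * k) \<or> (\<exists>k. n = s + 2 * k + 1)" for n by presburger
  have J1: "jacobi a b u (s + 2 * k) = of_real (b 0) * u (s + 2 * k) + of_real ?p * u (s + 2 * k + 1)" for u k
    by (simp add: jacobi_def as b[of "s + 2 * k"])
  have J2: "jacobi a b u (s + 2 * k + 1) = of_real ?p * u (s + 2 * k) + of_real (b 0) * u (s + 2 * k + 1)" for u k
    using as(1)[of k] as(2)[of k] by (simp add: jacobi_def b[of "s + 2 * k + 1"])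
  define B :: "int \<Rightarrow> complex^2^2" where "B = (\<lambda>k. vector [vector [of_real (b 0), of_real ?p], vector [of_real ?p, of_real (b 0)]])"
  have "jacobi a b u n = direct_sum_2x2 s B u n" for u n
    using cases[of n] by (auto simp: J1 J2 direct_sum_2x2_fst direct_sum_2x2_snd B_def)
  then show "jacobi_direct_sum_2x2 a b" unfolding jacobi_direct_sum_2x2_def by blast
  have bdd: "\<bar>a n\<bar> \<le> ?p" for n using cases[of n] as a0[of s] by auto
  have dom: "jacobi_dom a b = ell2" by (rule jacobi_bounded_on_ell2[OF bdd, of _ "\<bar>b 0\<bar>"]) (metis b order_refl)
  show "pure_point_spectrum (jacobi_dom a b) (jacobi a b)"
    unfolding pure_point_spectrum_def
  proof (rule dense_in_ell2_span)
    fix j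
    let ?S = "cseq.span (\<Union>l. eigenspace (jacobi_dom a b) (jacobi a b) l)"
    obtain k where k: "j = s + 2 * k \<or> j = s + 2 * k + 1" using cases by blast
    let ?d = "delta (s + 2 * k)" and ?d' = "delta (s + 2 * k + 1)"
    have ev: "?d + cscale c ?d' \<in> ?S" if "c * c = 1" for c
    proof (rule cseq.span_base, rule UN_I)
      show "?d + cscale c ?d' \<in> eigenspace (jacobi_dom a b) (jacobi a b) (of_real (b 0) + c * of_real ?p)"
        unfolding eigenspace_def dom
      proof (intro CollectI conjI ext)
        show "?d + cscale c ?d' \<in> ell2" by (intro ell2_add ell2_cscale delta_in_ell2)
        have "c * (c * x) = x" for x using that by (simp flip: mult.assoc)
        moreover have "m * 2 \<noteq> 1 + k * 2" "1 + m * 2 \<noteq> k * 2" for m k :: int by presburger+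
        ultimately have simps: "c * (c * x) = x" "m * 2 \<noteq> 1 + k * 2" "1 + m * 2 \<noteq> k * 2" for x and m k :: int by blast+
        show "jacobi a b (?d + cscale c ?d') n = cscale (of_real (b 0) + c * of_real ?p) (?d + cscale c ?d') n" for n
          using cases[of n]
        proof (elim disjE exE)
          fix m assume n: "n = s + 2 * m"
          show ?thesis unfolding n J1 using simps
            by (auto simp: delta_def cscale_def algebra_simps)
        next
          fix m assume n: "n = s + 2 * m + 1"
          show ?thesis unfolding n J2 using simps
            by (auto simp: delta_def cscale_def algebra_simps)
        qed
      qed
    qed simp
    have "?d = cscale (1 / 2) ((?d + cscale 1 ?d') + (?d + cscale (- 1) ?d'))"
      by (auto simp: cscale_def)
    then have 1: "?d \<in> ?S" using cseq.span_scale cseq.span_add ev[of 1] ev[of "- 1"]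
      by (metis minus_mult_minus mult_1)
    have "?d' = (?d + cscale 1 ?d') - ?d" by (auto simp: cscale_def)
    then have "?d' \<in> ?S" using cseq.span_diff[OF ev[of 1] 1] by simp
    with 1 k show "delta j \<in> ?S" by auto
  qed
  show "eigenvalues_infinite_multiplicity (jacobi_dom a b) (jacobi a b)"
    unfolding eigenvalues_infinite_multiplicity_def
  proof (intro allI impI notI)
    fix l assume ne: "eigenspace (jacobi_dom a b) (jacobi a b) l \<noteq> {0}"
      and "\<exists>F. finite F \<and> eigenspace (jacobi_dom a b) (jacobi a b) l \<subseteq> cseq.span F"
    then obtain F where F: "finite F" "eigenspace (jacobi_dom a b) (jacobi a b) l \<subseteq> cseq.span F" by blast
    have "jacobi a b 0 = 0" by (auto simp: jacobi_def)
    then have "0 \<in> eigenspace (jacobi_dom a b) (jacobi a b) l" by (auto simp: eigenspace_def dom cscale_def)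
    with ne obtain u where u: "u \<in> eigenspace (jacobi_dom a b) (jacobi a b) l" "u \<noteq> 0" by blast
    then obtain n0 where n0: "u n0 \<noteq> 0" by fastforce
    have eig: "jacobi a b u n = l * u n" for n
      using u(1) by (auto simp: eigenspace_def cscale_def)
    define k0 where "k0 = (n0 - s) div 2"
    \<comment> \<open>The part of the eigenvector \<open>u\<close> in the block that contains
      \<open>n0\<close>, moved \<open>i\<close> blocks to the right; all blocks being equal, it is
      again an eigenvector.\<close>
    define w where "w = (\<lambda>i::nat. \<lambda>n. if (n - s) div 2 = k0 + int i then u (n - 2 * int i) else 0)"
    have "w i \<in> eigenspace (jacobi_dom a b) (jacobi a b) l" for i
      unfolding eigenspace_def dom
    proof (intro CollectI conjI ext)
      have "{n. w i n \<noteq> 0} \<subseteq> {s + 2 * (k0 + int i), s + 2 * (k0 + int i) + 1}"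
        by (auto simp: w_def split: if_splits)
      then show "w i \<in> ell2" by (intro ell2_finite_support) (auto intro: finite_subset)
      fix n
      have *: "(s + 2 * k + 1 - s) div 2 = k" "(s + 2 * k - s) div 2 = k" for k by auto
      show "jacobi a b (w i) n = cscale l (w i) n"
        using cases[of n]
      proof (elim disjE exE)
        fix k assume n: "n = s + 2 * k"
        show ?thesis using eig[of "s + 2 * (k - int i)"]
          unfolding n J1 w_def cscale_def * by (auto simp: algebra_simps)
      next
        fix k assume n: "n = s + 2 * k + 1"
        show ?thesis using eig[of "s + 2 * (k - int i) + 1"]
          unfolding n J2 w_def cscale_def * by (auto simp: algebra_simps)
      qed
    qed
    then have "range w \<subseteq> cseq.span F" using F by auto
    moreover have "w i (n0 + 2 * int j) = 0 \<longleftrightarrow> i \<noteq> j" for i j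
    proof -
      have "(n0 + 2 * int j - s) div 2 = k0 + int j" unfolding k0_def by presburger
      then show ?thesis using n0 by (auto simp: w_def)
    qed
    ultimately show False using not_in_finite_span[of w "\<lambda>j. n0 + 2 * int j" F] F(1) by blast
  qed
qed

section \<open>The case of positive off-diagonal entries: Green function, spectrum and boundary
  values\<close>

lemma ell2_tendsto_0:
  assumes "u \<in> ell2" "inj (x :: nat \<Rightarrow> int)"
  shows "(\<lambda>i. u (x i)) \<longlonglongrightarrow> 0"
proof (rule LIMSEQ_I)
  fix e :: real assume "e > 0"
  obtain F where F: "finite F" "ell2_norm (\<lambda>n. if n \<in> F then 0 else u n) < e"
    by (rule ell2_tail_small[OF assms(1) \<open>e > 0\<close>])
  have in2: "(\<lambda>n. if n \<in> F then 0 else u n) \<in> ell2"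
    by (rule ell2_dominated[OF assms(1), where C = 1 and h = "\<lambda>n. n"]) auto
  have small: "cmod (u n) < e" if "n \<notin> F" for n
    using cmod_le_ell2_norm[OF in2, of n] F that by simp
  have "finite (x -` F)" using F assms(2) by (simp add: finite_vimageI)
  then obtain N where N: "x -` F \<subseteq> {..<N}" using finite_nat_bounded by blast
  have "\<forall>i\<ge>N. norm (u (x i) - 0) < e"
  proof (intro allI impI)
    fix i assume "N \<le> i"
    then have "x i \<notin> F" using N by auto
    then show "norm (u (x i) - 0) < e" using small by simp
  qed
  then show "\<exists>N. \<forall>i\<ge>N. norm (u (x i) - 0) < e" by blast
qed

text \<open>
  The quantity \<open>v (i + 1) * v (i - 1) - (v i)\<^sup>2\<close> does not depend on \<open>i\<close> along a half-line without
  source, so it vanishes for decaying solutions.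
\<close>

lemma three_term_half_line:
  fixes v :: "nat \<Rightarrow> complex"
  assumes rec: "\<And>i. x * (v (i + 2) + v i) + y * v (i + 1) = 0" and "x \<noteq> 0" and lim: "v \<longlonglongrightarrow> 0"
  shows "x * (v 1)\<^sup>2 + x * (v 0)\<^sup>2 + y * v 0 * v 1 = 0"
proof -
  \<comment> \<open>\<open>c i\<close> is \<open>x * ((v i)\<^sup>2 - v (i + 1) * v (i - 1))\<close>
    with \<open>v (i - 1)\<close> eliminated by the recurrence, which gives it a meaning at
    \<open>i = 0\<close>.\<close>
  define c where "c = (\<lambda>i. x * (v (i + 1))\<^sup>2 + x * (v i)\<^sup>2 + y * v i * v (i + 1))"
  have "c (Suc i) = c i" for i
  proof -
    have e: "x * v (i + 2) = - x * v i - y * v (i + 1)" using rec[of i] by (simp add: algebra_simps add_eq_0_iff)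
    have "x * c (Suc i) = (x * v (i + 2))\<^sup>2 + x * x * (v (i + 1))\<^sup>2 + y * v (i + 1) * (x * v (i + 2))"
      by (simp add: c_def algebra_simps power2_eq_square)
    also have "\<dots> = x * c i" unfolding e by (simp add: c_def algebra_simps power2_eq_square)
    finally show ?thesis using \<open>x \<noteq> 0\<close> by simp
  qed
  then have "c i = c 0" for i by (induction i) auto
  then have const: "c = (\<lambda>i. c 0)" by auto
  have lim1: "(\<lambda>i. v (i + 1)) \<longlonglongrightarrow> 0" using LIMSEQ_Suc[OF lim] by simp
  have "c \<longlonglongrightarrow> x * 0\<^sup>2 + x * 0\<^sup>2 + y * 0 * 0"
    unfolding c_def by (intro tendsto_intros lim lim1)
  then have "(\<lambda>i::nat. c 0) \<longlonglongrightarrow> 0" using const by simp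
  then have "c 0 = 0" by (simp add: LIMSEQ_const_iff)
  then show ?thesis by (simp add: c_def)
qed

text \<open>The two half-lines make \<open>v 1\<close> and \<open>v (- 1)\<close> roots of the same
  quadratic \<open>x * t\<^sup>2 + y * v 0 * t + x * (v 0)\<^sup>2\<close>. Distinct roots would
  have the sum \<open>- y * v 0 / x\<close>, contradicting the source \<open>w\<close> at the
  origin. Hence they agree, and eliminating them leaves an equation for \<open>v 0\<close>
  alone.\<close>

lemma three_term_green:
  fixes v :: "int \<Rightarrow> complex"
  assumes v: "v \<in> ell2" and x: "x \<noteq> 0" and w: "w \<noteq> 0"
    and rec: "\<And>i. x * (v (i + 1) + v (i - 1)) + y * v i = (if i = 0 then w else 0)"
  shows "(v 0)\<^sup>2 * (y\<^sup>2 - 4 * x\<^sup>2) = w\<^sup>2"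
proof -
  have 1: "x * (v 1)\<^sup>2 + x * (v 0)\<^sup>2 + y * v 0 * v 1 = 0"
    using three_term_half_line[of x "\<lambda>i. v (int i)" y] rec[of "int _ + 1"] x ell2_tendsto_0[OF v, of int]
    by (simp add: algebra_simps inj_on_def)
  have "x * (v (- int (i + 2)) + v (- int i)) + y * v (- int (i + 1)) = 0" for i
  proof -
    have "- int (i + 1) + 1 = - int i" "- int (i + 1) - 1 = - int (i + 2)" "- int (i + 1) \<noteq> 0" by simp_all
    then show ?thesis using rec[of "- int (i + 1)"] by (simp only: add.commute if_False)
  qed
  then have 2: "x * (v (- 1))\<^sup>2 + x * (v 0)\<^sup>2 + y * v 0 * v (- 1) = 0"
    using three_term_half_line[of x "\<lambda>i. v (- int i)" y] x ell2_tendsto_0[OF v, of "\<lambda>i. - int i"]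
    by (simp add: inj_on_def)
  have 0: "x * (v 1 + v (- 1)) + y * v 0 = w" using rec[of 0] by simp
  have "(v 1 - v (- 1)) * (x * (v 1 + v (- 1)) + y * v 0)
      = (x * (v 1)\<^sup>2 + x * (v 0)\<^sup>2 + y * v 0 * v 1) - (x * (v (- 1))\<^sup>2 + x * (v 0)\<^sup>2 + y * v 0 * v (- 1))"
    by (simp add: algebra_simps power2_eq_square)
  also have "\<dots> = 0" unfolding 1 2 by simp
  finally have "(v 1 - v (- 1)) * (x * (v 1 + v (- 1)) + y * v 0) = 0" .
  then have sym: "v (- 1) = v 1" using 0 w by simp
  have "w\<^sup>2 - (y * v 0)\<^sup>2 = 4 * x * (x * (v 1)\<^sup>2 + y * v 0 * v 1)"
    unfolding 0[symmetric] sym by (simp add: algebra_simps power2_eq_square)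
  also have "x * (v 1)\<^sup>2 + y * v 0 * v 1 = - (x * (v 0)\<^sup>2)" using 1 by (simp add: eq_neg_iff_add_eq_0 algebra_simps)
  finally show ?thesis by (simp add: algebra_simps power2_eq_square)
qed

text \<open>Convergence of the square leaves two candidates; the upper half plane selects one,
  because there \<open>G = \<i> * csqrt (- G\<^sup>2)\<close>. The principal root is continuous at
  positive \<open>s\<close>, while at \<open>s = 0\<close> the modulus settles the limit.\<close>

lemma sqrt_limit_upper_half_plane:
  fixes G :: "real \<Rightarrow> complex"
  assumes lim: "((\<lambda>e. (G e)\<^sup>2) \<longlongrightarrow> - of_real s) F" and im: "\<forall>\<^sub>F e in F. 0 < Im (G e)" and s: "0 \<le> s"
  shows "(G \<longlongrightarrow> \<i> * of_real (sqrt s)) F"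
proof -
  have root: "(G e) = \<i> * csqrt (- (G e)\<^sup>2)" if "0 < Im (G e)" for e
  proof -
    have "csqrt ((- \<i> * G e)\<^sup>2) = - \<i> * G e" by (rule csqrt_square) (use that in simp)
    then show ?thesis by (simp add: power_mult_distrib)
  qed
  have "((\<lambda>e. csqrt (- (G e)\<^sup>2)) \<longlongrightarrow> csqrt (of_real s)) F"
  proof (cases "s = 0")
    case True
    have "((\<lambda>e. norm (csqrt (- (G e)\<^sup>2))) \<longlongrightarrow> 0) F"
    proof -
      have "((\<lambda>e. - (G e)\<^sup>2) \<longlongrightarrow> 0) F" using tendsto_minus[OF lim] True by simp
      then have "((\<lambda>e. sqrt (norm (- (G e)\<^sup>2))) \<longlongrightarrow> sqrt (norm (0::complex))) F"
        by (intro tendsto_real_sqrt tendsto_norm)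
      then show ?thesis by simp
    qed
    from tendsto_norm_zero_cancel[OF this] show ?thesis using True by simp
  next
    case False
    have "((\<lambda>e. - (G e)\<^sup>2) \<longlongrightarrow> of_real s) F" using tendsto_minus[OF lim] by simp
    moreover have "isCont csqrt (of_real s)" by (rule continuous_at_csqrt) (use s False in auto)
    ultimately show ?thesis by (metis isCont_tendsto_compose)
  qed
  then have "((\<lambda>e. \<i> * csqrt (- (G e)\<^sup>2)) \<longlongrightarrow> \<i> * of_real (sqrt s)) F"
    using s by (intro tendsto_mult_left) (simp add: csqrt_of_real_nonneg)
  then show ?thesis
    by (rule Lim_transform_eventually) (use im root in \<open>auto elim!: eventually_mono\<close>)
qed

context
  fixes a b :: "int \<Rightarrow> real"
  assumes a2: "\<And>n. a (n + 2) = a n" and apos: "\<And>n. 0 < a n" and b: "\<And>n. b n = b 0"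
begin

text \<open>With the Floquet discriminant \<open>\<Delta> = (w\<^sup>2 - (a 0)\<^sup>2 - (a
  1)\<^sup>2) / (a 0 * a 1)\<close> of the two-periodic matrix, where \<open>w\<close> is the energy
  minus \<open>b 0\<close>, this is \<open>(a 0 * a 1)\<^sup>2 * (\<Delta>\<^sup>2 - 4)\<close>:
  negative inside the bands, positive in the gaps.\<close>

definition "discr w = ((a 0)\<^sup>2 + (a 1)\<^sup>2 - w\<^sup>2)\<^sup>2 - 4 * (a 0)\<^sup>2 * (a 1)\<^sup>2"

lemma period_2_cases: "a n = a 0 \<and> a (n + 1) = a 1 \<and> a (n - 1) = a 1 \<or> a n = a 1 \<and> a (n + 1) = a 0 \<and> a (n - 1) = a 0"
proof (induction n rule: int_induct[where k = 0])
  case base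
  show ?case using a2[of "- 1"] by simp
next
  case (step1 i)
  have "i + 1 + 1 = i + 2" "i + 1 - 1 = i" by simp_all
  then show ?case using step1(2) a2[of i] by metis
next
  case (step2 i)
  have "i - 1 + 1 = i" "i - 1 - 1 + 2 = i" by simp_all
  then show ?case using step2(2) a2[of "i - 1 - 1"] by metis
qed

text \<open>Eliminating the sites at odd distance from \<open>j\<close> turns the resolvent equation
  into a three-term recurrence with constant coefficients on the remaining sites, to which
  \<open>three_term_green\<close> applies. The elimination multiplies the source by
  \<open>w\<close>.\<close>

lemma period_2_green_sq:
  fixes u :: "int \<Rightarrow> complex" and z :: complex
  assumes u: "u \<in> ell2" and eq: "jacobi a b u - cscale z u = delta j" and z: "Im z \<noteq> 0"
  shows "(u j)\<^sup>2 * (((a 0)\<^sup>2 + (a 1)\<^sup>2 - (z - b 0)\<^sup>2)\<^sup>2 - 4 * (a 0)\<^sup>2 * (a 1)\<^sup>2) = (z - b 0)\<^sup>2"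
proof -
  define w where "w = z - b 0"
  have w: "w \<noteq> 0" using z by (auto simp: w_def)
  define v where "v = (\<lambda>i. u (j + 2 * i))"
  have v: "v \<in> ell2"
    by (rule ell2_dominated[OF u, where C = 1 and h = "\<lambda>i. j + 2 * i"]) (auto simp: v_def inj_on_def)
  define P Q where "P = complex_of_real (a j)" and "Q = complex_of_real (a (j + 1))"
  note per = period_2_shift[of a, OF a2]
  have e: "of_real (a n) * u (n + 1) + of_real (a (n - 1)) * u (n - 1) = w * u n + (if n = j then 1 else 0)" for n
    using fun_cong[OF eq, of n] b[of n] by (auto simp: jacobi_def cscale_def delta_def w_def algebra_simps)
  have even: "P * u (j + 2 * i + 1) + Q * u (j + 2 * i - 1) = w * v i + (if i = 0 then 1 else 0)" for i
    using e[of "j + 2 * i"] per[of j i] per[of "j + 1" "i - 1"] by (auto simp: P_def Q_def v_def algebra_simps)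
  have odd: "Q * v (i + 1) + P * v i = w * u (j + 2 * i + 1)" for i
  proof -
    have "1 + i * 2 \<noteq> 0" by presburger
    then show ?thesis using e[of "j + 2 * i + 1"] per[of j i] per[of "j + 1" i] by (auto simp: P_def Q_def v_def algebra_simps)
  qed
  have "P * Q * (v (i + 1) + v (i - 1)) + (P\<^sup>2 + Q\<^sup>2 - w\<^sup>2) * v i = (if i = 0 then w else 0)" for i
  proof -
    have "P * Q * (v (i + 1) + v (i - 1)) + (P\<^sup>2 + Q\<^sup>2) * v i
        = P * (Q * v (i + 1) + P * v i) + Q * (Q * v (i - 1 + 1) + P * v (i - 1))"
      by (simp add: algebra_simps power2_eq_square)
    also have "\<dots> = w * (P * u (j + 2 * i + 1) + Q * u (j + 2 * i - 1))"
      unfolding odd by (simp add: algebra_simps)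
    also have "\<dots> = w\<^sup>2 * v i + (if i = 0 then w else 0)"
      unfolding even by (simp add: algebra_simps power2_eq_square)
    finally show ?thesis by (simp add: algebra_simps)
  qed
  then have "(v 0)\<^sup>2 * ((P\<^sup>2 + Q\<^sup>2 - w\<^sup>2)\<^sup>2 - 4 * (P * Q)\<^sup>2) = w\<^sup>2"
    by (rule three_term_green[OF v _ w, rotated]) (use apos in \<open>auto simp: P_def Q_def less_le\<close>)
  moreover have "P\<^sup>2 + Q\<^sup>2 = (a 0)\<^sup>2 + (a 1)\<^sup>2" "(P * Q)\<^sup>2 = (a 0)\<^sup>2 * (a 1)\<^sup>2"
    using period_2_cases[of j] by (auto simp: P_def Q_def power_mult_distrib)
  ultimately show ?thesis by (simp add: v_def w_def mult.assoc)
qed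

lemma period_2_bounded: "bounded_on_ell2 (jacobi a b)" "jacobi_dom a b = ell2"
proof -
  have 1: "\<bar>a n\<bar> \<le> max (a 0) (a 1)" for n using period_2_cases[of n] apos[of n] by auto
  have 2: "\<bar>b n\<bar> \<le> \<bar>b 0\<bar>" for n using b[of n] by simp
  show "bounded_on_ell2 (jacobi a b)" "jacobi_dom a b = ell2"
    using jacobi_bounded_on_ell2[of a _ b, OF 1 2] by auto
qed

text \<open>Writing \<open>H\<close> for the matrix, the product of \<open>H - l\<close> and
  \<open>H - (2 * b 0 - l)\<close> is the square of \<open>H - b 0\<close> minus a constant. It
  couples only sites at distance two, with entries \<open>a 0 * a 1\<close> and constant diagonal,
  and positivity of \<open>discr\<close> is diagonal dominance.\<close>

lemma period_2_spectrum:
  assumes "l \<in> jacobi_spectrum a b"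
  shows "discr (l - b 0) \<le> 0"
proof (rule ccontr)
  assume neg: "\<not> ?thesis"
  define w where "w = l - b 0"
  define y where "y = (a 0)\<^sup>2 + (a 1)\<^sup>2 - w\<^sup>2"
  have "(2 * (a 0 * a 1))\<^sup>2 < y\<^sup>2" using neg by (simp add: discr_def y_def w_def algebra_simps power_mult_distrib)
  then have "2 * (a 0 * a 1) < \<bar>y\<bar>" using abs_less_iff by (metis abs_le_square_iff abs_ge_self linorder_not_le order_trans)
  then have y: "2 * (a 0 * a 1) < cmod (complex_of_real y)" by simp
  define x where "x = complex_of_real (a 0 * a 1)"
  have x: "cmod x \<le> a 0 * a 1" using apos by (simp add: x_def less_imp_le norm_mult)
  define T where "T = (\<lambda>(u :: int \<Rightarrow> complex) n. x * u (n + 2) + x * u (n - 2) + complex_of_real y * u n)"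
  have "of_real l \<in> resolvent_set ell2 (jacobi a b)"
  proof (rule resolvent_setI[where T = T and C = "1 / (cmod (complex_of_real y) - 2 * (a 0 * a 1))"])
    let ?Q = "\<lambda>u. jacobi a b u - cscale (2 * b 0 - l) u"
    show "bounded_on_ell2 (jacobi a b)" by (rule period_2_bounded)
    show "bounded_on_ell2 ?Q"
      by (intro bounded_on_ell2_diff bounded_on_ell2_cscale bounded_on_ell2_id period_2_bounded)
    have J: "jacobi a b u n = of_real (a n) * u (n + 1) + of_real (b 0) * u n + of_real (a (n - 1)) * u (n - 1)" for u n
      using b[of n] by (simp add: jacobi_def)
    \<comment> \<open>The values \<open>s = 1\<close> and \<open>s = - 1\<close> give the two orders
      of the factors.\<close>
    have "jacobi a b (jacobi a b u - cscale r u) n - t * (jacobi a b u - cscale r u) n = T u n"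
      if "r = of_real (b 0) - s * of_real w" "t = of_real (b 0) + s * of_real w" "s * s = 1" for u n r t s
    proof -
      have ab: "complex_of_real (a n) * of_real (a (n + 1)) = x" "complex_of_real (a (n - 1)) * of_real (a (n - 2)) = x"
        "(complex_of_real (a n))\<^sup>2 + (complex_of_real (a (n - 1)))\<^sup>2 = y + w\<^sup>2"
        using period_2_cases[of n] a2[of "n - 2"] by (auto simp: x_def y_def)
      have t: "T u n = of_real (a n) * of_real (a (n + 1)) * u (n + 2) + of_real (a (n - 1)) * of_real (a (n - 2)) * u (n - 2)
          + ((complex_of_real (a n))\<^sup>2 + (complex_of_real (a (n - 1)))\<^sup>2 - (s * s) * w\<^sup>2) * u n"
        unfolding ab that(3) T_def by simp
      show ?thesis unfolding t that(1,2) J cscale_def minus_apply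
        by (simp add: algebra_simps power2_eq_square)
    qed
    from this[where s = "- 1"] this[where s = 1]
    show "jacobi a b (?Q u) - cscale (complex_of_real l) (?Q u) = T u"
      "?Q (jacobi a b u - cscale (complex_of_real l) u) = T u" for u
      unfolding fun_eq_iff by (simp_all add: w_def cscale_def)
    show "\<exists>u\<in>ell2. T u = v" if "v \<in> ell2" for v
      unfolding T_def by (rule dominant_diagonal_surj[where \<kappa> = "a 0 * a 1"]) (use x y that in auto)
    show "ell2_norm u \<le> 1 / (cmod (complex_of_real y) - 2 * (a 0 * a 1)) * ell2_norm (T u)" if "u \<in> ell2" for u
      unfolding T_def by (rule dominant_diagonal_bound) (use x y that in auto)
    show "0 \<le> 1 / (cmod (complex_of_real y) - 2 * (a 0 * a 1))" using y by simp
  qed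
  then show False using assms by (simp add: jacobi_spectrum_def spectrum_def period_2_bounded)
qed

text \<open>The zeros are the band edges, at distance \<open>a 0 + a 1\<close> or
  \<open>\<bar>a 0 - a 1\<bar>\<close> from \<open>b 0\<close>; they are the exceptional null set
  for the boundary values.\<close>

lemma finite_discr_zeros: "finite {l. discr (l - b 0) = 0}"
proof -
  have "discr (l - b 0) = 0 \<longleftrightarrow> ((l - b 0)\<^sup>2 - (a 0 + a 1)\<^sup>2) * ((l - b 0)\<^sup>2 - (a 0 - a 1)\<^sup>2) = 0" for l
    unfolding discr_def by (rule arg_cong[where f = "\<lambda>x. x = 0"]) algebra
  then have "{l. discr (l - b 0) = 0} \<subseteq> {b 0 + (a 0 + a 1), b 0 - (a 0 + a 1), b 0 + (a 0 - a 1), b 0 - (a 0 - a 1)}"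
    by (auto simp: power2_eq_iff)
  then show ?thesis by (rule finite_subset) simp
qed

lemma period_2_reflectionless:
  assumes sa: "self_adjoint (jacobi_dom a b) (jacobi a b)" and simon: "simon_class a b"
  shows "jacobi_reflectionless a b (jacobi_spectrum a b)"
  unfolding jacobi_reflectionless_def
proof
  fix n
  obtain \<mu> where sm: "self_adjoint_spectral_measure (jacobi_dom a b) (jacobi a b) (delta n) \<mu>"
    and \<mu>: "\<And>z. Im z \<noteq> 0 \<Longrightarrow> \<exists>u\<in>jacobi_dom a b. jacobi a b u - cscale z u = delta n
        \<and> u n = (LINT x|\<mu>. 1 / (complex_of_real x - z))"
    using simon_class_greenE[OF simon] by metis
  define G where "G = (\<lambda>z. LINT x|\<mu>. 1 / (complex_of_real x - z))"
  define D where "D = (\<lambda>w::complex. ((a 0)\<^sup>2 + (a 1)\<^sup>2 - w\<^sup>2)\<^sup>2 - 4 * (a 0)\<^sup>2 * (a 1)\<^sup>2)"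
  have G: "(G z)\<^sup>2 * D (z - b 0) = (z - b 0)\<^sup>2" "0 < Im (G z)" if "0 < Im z" for z
  proof -
    obtain u where u: "u \<in> jacobi_dom a b" "jacobi a b u - cscale z u = delta n" "u n = G z"
      using \<mu>[of z] \<open>0 < Im z\<close> unfolding G_def by auto
    have u2: "u \<in> ell2" using u(1) by (simp add: jacobi_dom_def)
    show "(G z)\<^sup>2 * D (z - b 0) = (z - b 0)\<^sup>2"
      using period_2_green_sq[OF u2 u(2)] that u(3) by (simp add: D_def)
    have "u \<noteq> 0"
    proof
      assume "u = 0"
      then have "jacobi a b u n - cscale z u n = 0" by (simp add: jacobi_def cscale_def)
      then show False using fun_cong[OF u(2), of n] by (simp add: delta_def)
    qed
    then have "ell2_norm u \<noteq> 0" using ell2_norm_eq_0[OF u2] by blast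
    then show "0 < Im (G z)" using jacobi_resolvent_im[OF sa u(1,2)] that u(3) by simp
  qed
  have lim: "\<exists>g. ((\<lambda>e. G (Complex l e)) \<longlongrightarrow> g) (at_right 0) \<and> Re g = 0" if neg: "discr (l - b 0) < 0" for l
  proof -
    define w where "w = l - b 0"
    have pos: "\<forall>\<^sub>F e in at_right 0. 0 < (e::real)" by (simp add: eventually_at_right_less)
    have tow: "((\<lambda>e. Complex l e - b 0) \<longlongrightarrow> of_real w) (at_right 0)"
    proof -
      have "((\<lambda>e. Complex l e - b 0) \<longlongrightarrow> Complex l 0 - b 0) (at_right 0)" by (intro tendsto_intros)
      moreover have "Complex l 0 - b 0 = of_real w" by (simp add: w_def complex_eq_iff)
      ultimately show ?thesis by simp
    qed
    have Dw: "D (of_real w) = of_real (discr w)" by (simp add: D_def discr_def)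
    have "((\<lambda>e. (Complex l e - b 0)\<^sup>2 / D (Complex l e - b 0)) \<longlongrightarrow> (of_real w)\<^sup>2 / D (of_real w)) (at_right 0)"
      unfolding D_def by (intro tendsto_intros tow) (use Dw neg in \<open>auto simp: D_def w_def\<close>)
    moreover have "\<forall>\<^sub>F e in at_right 0. (Complex l e - b 0)\<^sup>2 / D (Complex l e - b 0) = (G (Complex l e))\<^sup>2"
      using pos
    proof eventually_elim
      case (elim e)
      have "Complex l e - b 0 \<noteq> 0" using elim by (auto simp: complex_eq_iff)
      \<comment> \<open>Off the real axis the identity for the square of \<open>G\<close> has a
        nonzero right-hand side, so its factor \<open>D\<close> cannot vanish.\<close>
      then have "D (Complex l e - b 0) \<noteq> 0" using G(1)[of "Complex l e"] elim by auto
      then show ?case using G(1)[of "Complex l e"] elim by (simp add: field_simps)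
    qed
    ultimately have "((\<lambda>e. (G (Complex l e))\<^sup>2) \<longlongrightarrow> (of_real w)\<^sup>2 / D (of_real w)) (at_right 0)"
      by (rule Lim_transform_eventually)
    then have "((\<lambda>e. (G (Complex l e))\<^sup>2) \<longlongrightarrow> - of_real (- (w\<^sup>2 / discr w))) (at_right 0)"
      by (simp add: Dw)
    then have "((\<lambda>e. G (Complex l e)) \<longlongrightarrow> \<i> * of_real (sqrt (- (w\<^sup>2 / discr w)))) (at_right 0)"
    proof (rule sqrt_limit_upper_half_plane)
      show "\<forall>\<^sub>F e in at_right 0. 0 < Im (G (Complex l e))"
        using pos by (rule eventually_mono) (simp add: G(2))
      show "0 \<le> - (w\<^sup>2 / discr w)" using neg by (simp add: w_def divide_le_0_iff)
    qed
    then show ?thesis by (intro exI conjI) auto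
  qed
  have "AE l in lborel. l \<notin> {l. discr (l - b 0) = 0}"
    using finite_imp_null_set_lborel[OF finite_discr_zeros] by (rule AE_not_in)
  then have "AE l in lborel. l \<in> jacobi_spectrum a b \<longrightarrow>
           (\<exists>g. ((\<lambda>e. G (Complex l e)) \<longlongrightarrow> g) (at_right 0) \<and> Re g = 0)"
  proof (rule eventually_mono, intro impI)
    fix l assume "l \<notin> {l. discr (l - b 0) = 0}" "l \<in> jacobi_spectrum a b"
    then have "discr (l - b 0) < 0" using period_2_spectrum[of l] by simp
    then show "\<exists>g. ((\<lambda>e. G (Complex l e)) \<longlongrightarrow> g) (at_right 0) \<and> Re g = 0" by (rule lim)
  qed
  then show "\<exists>\<mu>. self_adjoint_spectral_measure (jacobi_dom a b) (jacobi a b) (delta n) \<mu> \<and>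
        (AE l in lborel. l \<in> jacobi_spectrum a b \<longrightarrow>
           (\<exists>g. ((\<lambda>e. LINT x|\<mu>. 1 / (complex_of_real x - Complex l e)) \<longlongrightarrow> g) (at_right 0) \<and> Re g = 0))"
    using sm unfolding G_def by blast
qed

end

lemma simon_class_dichotomy:
  assumes "whole_line_jacobi a b" "simon_class a b"
  shows "jacobi_periodic a b \<and> jacobi_reflectionless a b (jacobi_spectrum a b) \<or>
    jacobi_direct_sum_2x2 a b \<and> pure_point_spectrum (jacobi_dom a b) (jacobi a b) \<and>
    eigenvalues_infinite_multiplicity (jacobi_dom a b) (jacobi a b)"
proof -
  have nonneg: "\<And>n. a n \<ge> 0" and sa: "self_adjoint (jacobi_dom a b) (jacobi a b)"
    using assms(1) by (auto simp: whole_line_jacobi_def)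
  note per = simon_class_period_2[OF assms]
  show ?thesis
  proof (cases "\<exists>n. a n = 0")
    case True
    then obtain n where "a n = 0" by blast
    then have "a (n + 1 - 1) = 0" by simp
    then show ?thesis using jacobi_decoupled[of a "n + 1" b] per nonneg by blast
  next
    case False
    then have "\<And>n. 0 < a n" using nonneg by (simp add: less_le)
    then have "jacobi_reflectionless a b (jacobi_spectrum a b)"
      using period_2_reflectionless[of a b, OF per(1) _ per(2) sa assms(2)] by blast
    moreover have "jacobi_periodic a b"
      unfolding jacobi_periodic_def using per by (intro exI[of _ 2]) auto
    ultimately show ?thesis by blast
  qed
qed


section \<open>CMV matrices\<close>

definition rho :: "(int \<Rightarrow> complex) \<Rightarrow> int \<Rightarrow> complex" where
  "rho \<alpha> n = complex_of_real (sqrt (1 - (cmod (\<alpha> n))\<^sup>2))"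

definition even_factor :: "(int \<Rightarrow> complex) \<Rightarrow> (int \<Rightarrow> complex) \<Rightarrow> int \<Rightarrow> complex" where
  "even_factor \<alpha> = direct_sum_2x2 0 (\<lambda>k. Theta (\<alpha> (2 * k)))"

definition odd_factor :: "(int \<Rightarrow> complex) \<Rightarrow> (int \<Rightarrow> complex) \<Rightarrow> int \<Rightarrow> complex" where
  "odd_factor \<alpha> = direct_sum_2x2 (-1) (\<lambda>k. Theta (\<alpha> (2 * k - 1)))"

lemma cmv_eq: "cmv \<alpha> u = even_factor \<alpha> (odd_factor \<alpha> u)"
  by (simp add: cmv_def even_factor_def odd_factor_def)

lemma even_factor_apply:
  "even_factor \<alpha> u n = (if even n then cnj (\<alpha> n) * u n + rho \<alpha> n * u (n + 1)
     else rho \<alpha> (n - 1) * u (n - 1) - \<alpha> (n - 1) * u n)"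
proof (cases "even n")
  case True
  then have "2 * (n div 2) = n" by simp
  then show ?thesis using True
    by (simp add: even_factor_def direct_sum_2x2_def matrix_vector_mult_def sum_2 Theta_def Let_def rho_def)
next
  case False
  then have "2 * (n div 2) = n - 1" by presburger
  then show ?thesis using False
    by (simp add: even_factor_def direct_sum_2x2_def matrix_vector_mult_def sum_2 Theta_def Let_def rho_def)
qed

lemma odd_factor_apply:
  "odd_factor \<alpha> u n = (if odd n then cnj (\<alpha> n) * u n + rho \<alpha> n * u (n + 1)
     else rho \<alpha> (n - 1) * u (n - 1) - \<alpha> (n - 1) * u n)"
proof (cases "odd n")
  case True
  then obtain k where n: "n = 2 * k + 1" by (elim oddE)
  show ?thesis
    by (simp add: n odd_factor_def direct_sum_2x2_def matrix_vector_mult_def sum_2 Theta_def Let_def rho_def add.commute)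
next
  case False
  then have "2 * ((n + 1) div 2) = n" by presburger
  then show ?thesis using False
    by (simp add: odd_factor_def direct_sum_2x2_def matrix_vector_mult_def sum_2 Theta_def Let_def rho_def)
qed

text \<open>The matrix \<open>Theta c\<close> is symmetric and its adjoint is
  \<open>Theta (cnj c)\<close>. The inverse thus uses conjugated coefficients and applies the even
  factor first, so it is not the CMV matrix of the conjugated coefficients.\<close>

definition cmv_inv :: "(int \<Rightarrow> complex) \<Rightarrow> (int \<Rightarrow> complex) \<Rightarrow> int \<Rightarrow> complex" where
  "cmv_inv \<alpha> u = odd_factor (cnj \<circ> \<alpha>) (even_factor (cnj \<circ> \<alpha>) u)"

lemma rho_cnj [simp]: "rho (cnj \<circ> \<alpha>) = rho \<alpha>"
  by (auto simp: rho_def)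

lemma cnj_rho [simp]: "cnj (rho \<alpha> n) = rho \<alpha> n"
  by (simp add: rho_def)

lemma rho_sq:
  assumes "verblunsky \<alpha>"
  shows "rho \<alpha> n * rho \<alpha> n = 1 - \<alpha> n * cnj (\<alpha> n)"
proof -
  have "(cmod (\<alpha> n))\<^sup>2 \<le> 1" using assms by (simp add: verblunsky_def power_le_one)
  then have "rho \<alpha> n * rho \<alpha> n = complex_of_real (1 - (cmod (\<alpha> n))\<^sup>2)"
    unfolding rho_def of_real_mult[symmetric] by simp
  then show ?thesis unfolding of_real_diff of_real_1 complex_norm_square .
qed

lemma verblunsky_cnj: "verblunsky \<alpha> \<Longrightarrow> verblunsky (cnj \<circ> \<alpha>)"
  by (simp add: verblunsky_def)

lemma factor_inverse:
  assumes "verblunsky \<alpha>"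
  shows "even_factor (cnj \<circ> \<alpha>) (even_factor \<alpha> u) = u" "odd_factor (cnj \<circ> \<alpha>) (odd_factor \<alpha> u) = u"
proof -
  have one: "\<alpha> m * cnj (\<alpha> m) + rho \<alpha> m * rho \<alpha> m = 1" for m
    unfolding rho_sq[OF assms] by (simp only: add_diff_cancel_left' add_diff_eq)
  have 1: "\<alpha> m * (cnj (\<alpha> m) * s + rho \<alpha> m * t) + rho \<alpha> m * (rho \<alpha> m * s - \<alpha> m * t) = s" for m s t
  proof -
    have "\<alpha> m * (cnj (\<alpha> m) * s + rho \<alpha> m * t) + rho \<alpha> m * (rho \<alpha> m * s - \<alpha> m * t)
        = (\<alpha> m * cnj (\<alpha> m) + rho \<alpha> m * rho \<alpha> m) * s" by (simp only: algebra_simps)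
    then show ?thesis unfolding one by (simp only: mult_1_left)
  qed
  have 2: "rho \<alpha> m * (cnj (\<alpha> m) * s + rho \<alpha> m * t) - cnj (\<alpha> m) * (rho \<alpha> m * s - \<alpha> m * t) = t" for m s t
  proof -
    have "rho \<alpha> m * (cnj (\<alpha> m) * s + rho \<alpha> m * t) - cnj (\<alpha> m) * (rho \<alpha> m * s - \<alpha> m * t)
        = (\<alpha> m * cnj (\<alpha> m) + rho \<alpha> m * rho \<alpha> m) * t" by (simp only: algebra_simps)
    then show ?thesis unfolding one by (simp only: mult_1_left)
  qed
  have "even_factor (cnj \<circ> \<alpha>) (even_factor \<alpha> u) n = u n" for n
    using 1[of n "u n" "u (n + 1)"] 2[of "n - 1" "u (n - 1)" "u n"]
    unfolding even_factor_apply rho_cnj comp_apply by (cases "even n") simp_all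
  then show "even_factor (cnj \<circ> \<alpha>) (even_factor \<alpha> u) = u" by (rule ext)
  have "odd_factor (cnj \<circ> \<alpha>) (odd_factor \<alpha> u) n = u n" for n
    using 1[of n "u n" "u (n + 1)"] 2[of "n - 1" "u (n - 1)" "u n"]
    unfolding odd_factor_apply rho_cnj comp_apply by (cases "odd n") simp_all
  then show "odd_factor (cnj \<circ> \<alpha>) (odd_factor \<alpha> u) = u" by (rule ext)
qed

lemma cmv_cmv_inv:
  assumes "verblunsky \<alpha>"
  shows "cmv \<alpha> (cmv_inv \<alpha> u) = u" "cmv_inv \<alpha> (cmv \<alpha> u) = u"
  using factor_inverse[OF assms] factor_inverse[OF verblunsky_cnj[OF assms]]
  by (simp_all add: cmv_eq cmv_inv_def comp_def)

lemma norm_rho_le: "verblunsky \<alpha> \<Longrightarrow> cmod (rho \<alpha> n) \<le> 1"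
  using power_le_one[of "cmod (\<alpha> n)" 2] by (simp add: rho_def verblunsky_def)

lemma
  assumes "verblunsky \<alpha>"
  shows bounded_even_factor: "bounded_on_ell2 (even_factor \<alpha>)"
    and bounded_odd_factor: "bounded_on_ell2 (odd_factor \<alpha>)"
proof -
  \<comment> \<open>\<open>\<sigma> b\<close> exchanges the two sites of a block; \<open>b\<close>
    tells whether the blocks begin at even sites.\<close>
  define \<sigma> where "\<sigma> = (\<lambda>b n :: int. if even n = b then n + 1 else n - 1)"
  have inj: "inj (\<sigma> b)" for b
    unfolding \<sigma>_def by (rule injI) (auto split: if_splits; presburger)
  have F: "bounded_on_ell2 (\<lambda>u. (\<lambda>n. (if even n = b then cnj (\<alpha> n) else - \<alpha> (n - 1)) * u n)
      + (\<lambda>n. (if even n = b then rho \<alpha> n else rho \<alpha> (n - 1)) * u (\<sigma> b n)))" for b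
    by (intro bounded_on_ell2_add bounded_on_ell2_weighted_shift[where C = 1]
        bounded_on_ell2_weighted_shift[where C = 1 and h = "\<lambda>n. n"] inj)
      (use assms norm_rho_le[OF assms] in \<open>auto simp: verblunsky_def\<close>)
  have "even_factor \<alpha> = (\<lambda>u. (\<lambda>n. (if even n = True then cnj (\<alpha> n) else - \<alpha> (n - 1)) * u n)
      + (\<lambda>n. (if even n = True then rho \<alpha> n else rho \<alpha> (n - 1)) * u (\<sigma> True n)))"
    by (auto simp: fun_eq_iff even_factor_apply \<sigma>_def)
  then show "bounded_on_ell2 (even_factor \<alpha>)" using F[of True] by (simp only:)
  have "odd_factor \<alpha> = (\<lambda>u. (\<lambda>n. (if even n = False then cnj (\<alpha> n) else - \<alpha> (n - 1)) * u n)
      + (\<lambda>n. (if even n = False then rho \<alpha> n else rho \<alpha> (n - 1)) * u (\<sigma> False n)))"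
    by (auto simp: fun_eq_iff odd_factor_apply \<sigma>_def)
  then show "bounded_on_ell2 (odd_factor \<alpha>)" using F[of False] by (simp only:)
qed

lemma bounded_cmv:
  assumes "verblunsky \<alpha>"
  shows "bounded_on_ell2 (cmv \<alpha>)" "bounded_on_ell2 (cmv_inv \<alpha>)"
  using bounded_on_ell2_compose[OF bounded_even_factor[OF assms] bounded_odd_factor[OF assms]]
    bounded_on_ell2_compose[OF bounded_odd_factor bounded_even_factor, OF verblunsky_cnj verblunsky_cnj, OF assms assms]
  by (simp_all add: cmv_eq[abs_def] cmv_inv_def[abs_def])

text \<open>The weight \<open>r\<close> is real and constant on each block, so reindexing by the
  involution \<open>\<sigma>\<close> carries the coupling over to the other argument.\<close>

lemma ell2_inner_block:
  fixes c r :: "int \<Rightarrow> complex" and \<sigma> :: "int \<Rightarrow> int"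
  assumes \<sigma>: "\<And>n. \<sigma> (\<sigma> n) = n" and r: "\<And>n. r (\<sigma> n) = r n" "\<And>n. cnj (r n) = r n"
    and bd: "\<And>n. cmod (c n) \<le> 1" "\<And>n. cmod (r n) \<le> 1" and u: "u \<in> ell2" and v: "v \<in> ell2"
  shows "ell2_inner (\<lambda>n. c n * u n + r n * u (\<sigma> n)) v = ell2_inner u (\<lambda>n. cnj (c n) * v n + r n * v (\<sigma> n))"
proof -
  have bij: "bij_betw \<sigma> UNIV UNIV" by (rule bij_betwI[where g = \<sigma>]) (auto simp: \<sigma>)
  have inj: "inj \<sigma>" using bij by (simp add: bij_betw_def)
  have in2: "(\<lambda>n. c n * w n) \<in> ell2" "(\<lambda>n. cnj (c n) * w n) \<in> ell2" "(\<lambda>n. r n * w (\<sigma> n)) \<in> ell2"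
    if "w \<in> ell2" for w
    using bounded_on_ell2D(1)[OF bounded_on_ell2_weighted_shift[where C = 1 and h = "\<lambda>n. n" and g = c] that]
      bounded_on_ell2D(1)[OF bounded_on_ell2_weighted_shift[where C = 1 and h = "\<lambda>n. n" and g = "\<lambda>n. cnj (c n)"] that]
      bounded_on_ell2D(1)[OF bounded_on_ell2_weighted_shift[where C = 1 and g = r, OF inj] that] bd
    by auto
  have split: "(\<lambda>n. f n + g n) = f + g" for f g :: "int \<Rightarrow> complex" by auto
  have "ell2_inner (\<lambda>n. r n * u (\<sigma> n)) v = (\<Sum>\<^sub>\<infinity>n. cnj (u (\<sigma> n)) * (r (\<sigma> n) * v (\<sigma> (\<sigma> n))))"
    unfolding ell2_inner_def by (rule infsum_cong) (simp add: r \<sigma>)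
  also have "\<dots> = ell2_inner u (\<lambda>n. r n * v (\<sigma> n))"
    unfolding ell2_inner_def
    using infsum_reindex_bij_betw[OF bij, of "\<lambda>m. cnj (u m) * (r m * v (\<sigma> m))"] by simp
  finally have 2: "ell2_inner (\<lambda>n. r n * u (\<sigma> n)) v = ell2_inner u (\<lambda>n. r n * v (\<sigma> n))" .
  have 1: "ell2_inner (\<lambda>n. c n * u n) v = ell2_inner u (\<lambda>n. cnj (c n) * v n)"
    unfolding ell2_inner_def by (rule infsum_cong) simp
  show ?thesis unfolding split
    by (simp only: ell2_inner_add_left[OF in2(1,3)[OF u] v] ell2_inner_add_right[OF u in2(2,3)[OF v]] 1 2)
qed

lemma ell2_inner_factor:
  assumes "verblunsky \<alpha>" "u \<in> ell2" "v \<in> ell2"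
  shows "ell2_inner (even_factor \<alpha> u) v = ell2_inner u (even_factor (cnj \<circ> \<alpha>) v)"
    "ell2_inner (odd_factor \<alpha> u) v = ell2_inner u (odd_factor (cnj \<circ> \<alpha>) v)"
proof -
  define \<sigma> where "\<sigma> = (\<lambda>b n :: int. if even n = b then n + 1 else n - 1)"
  define c where "c = (\<lambda>b n. if even n = b then cnj (\<alpha> n) else - \<alpha> (n - 1))"
  define r where "r = (\<lambda>b n. if even n = b then rho \<alpha> n else rho \<alpha> (n - 1))"
  have gen: "ell2_inner (\<lambda>n. c b n * u n + r b n * u (\<sigma> b n)) v
      = ell2_inner u (\<lambda>n. cnj (c b n) * v n + r b n * v (\<sigma> b n))" for b
    by (rule ell2_inner_block)
      (use assms norm_rho_le[OF assms(1)] in \<open>auto simp: \<sigma>_def c_def r_def verblunsky_def\<close>)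
  have "even_factor \<alpha> u = (\<lambda>n. c True n * u n + r True n * u (\<sigma> True n))"
    "even_factor (cnj \<circ> \<alpha>) v = (\<lambda>n. cnj (c True n) * v n + r True n * v (\<sigma> True n))"
    "odd_factor \<alpha> u = (\<lambda>n. c False n * u n + r False n * u (\<sigma> False n))"
    "odd_factor (cnj \<circ> \<alpha>) v = (\<lambda>n. cnj (c False n) * v n + r False n * v (\<sigma> False n))"
    by (auto simp: fun_eq_iff even_factor_apply odd_factor_apply c_def r_def \<sigma>_def)
  then show "ell2_inner (even_factor \<alpha> u) v = ell2_inner u (even_factor (cnj \<circ> \<alpha>) v)"
    "ell2_inner (odd_factor \<alpha> u) v = ell2_inner u (odd_factor (cnj \<circ> \<alpha>) v)"
    using gen[of True] gen[of False] by (simp_all only:)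
qed

lemma cmv_isometry:
  assumes "verblunsky \<alpha>" "u \<in> ell2" "v \<in> ell2"
  shows "ell2_inner (cmv \<alpha> u) (cmv \<alpha> v) = ell2_inner u v"
proof -
  have in2: "odd_factor \<alpha> w \<in> ell2" "even_factor \<alpha> w \<in> ell2" if "w \<in> ell2" for w
    using that bounded_on_ell2D(1) bounded_even_factor[OF assms(1)] bounded_odd_factor[OF assms(1)] by blast+
  show ?thesis unfolding cmv_eq
    by (simp only: ell2_inner_factor[OF assms(1)] in2 assms(2,3) factor_inverse[OF assms(1)])
qed

section \<open>Eigenvectors of isometries\<close>

context
  fixes E :: "(int \<Rightarrow> complex) \<Rightarrow> int \<Rightarrow> complex"
  assumes bdd: "bounded_on_ell2 E"
    and iso: "\<And>u v. u \<in> ell2 \<Longrightarrow> v \<in> ell2 \<Longrightarrow> ell2_inner (E u) (E v) = ell2_inner u v"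
begin

lemma eigenspace_span_subset: "y \<in> cseq.span (\<Union>l. eigenspace ell2 E l) \<Longrightarrow> y \<in> ell2"
proof (induction rule: cseq.span_induct_alt)
  case base
  show ?case by (rule ell2_zero)
next
  case (step c x y)
  then show ?case by (intro ell2_add ell2_cscale) (auto simp: eigenspace_def)
qed

text \<open>If \<open>e\<close> were nonzero, its eigenvalue would be unimodular, and the isometry
  would give \<open>ell2_inner e (E x) = l * ell2_inner e x\<close>. Then
  \<open>E x - cscale l x\<close>, which is \<open>e\<close>, would be orthogonal to
  \<open>e\<close>.\<close>

lemma isometry_no_jordan_block:
  assumes x: "x \<in> ell2" and e: "e \<in> ell2" "E e = cscale l e" and eq: "E x - cscale l x = e"
  shows "e = 0"
proof (rule ell2_norm_eq_0[OF e(1)], rule ccontr)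
  assume ne: "ell2_norm e \<noteq> 0"
  have Ex: "E x \<in> ell2" by (rule bounded_on_ell2D(1)[OF bdd x])
  have "cnj l * l * ell2_inner e e = ell2_inner e e"
    using iso[OF e(1) e(1)] unfolding e(2) ell2_inner_cscale_left ell2_inner_cscale_right by (simp only: mult_ac)
  moreover have "ell2_inner e e \<noteq> 0" using ne by (simp add: ell2_inner_self[OF e(1)])
  ultimately have l: "cnj l * l = 1" by (metis mult_cancel_right1)
  have "cnj l * ell2_inner e (E x) = ell2_inner e x"
    using iso[OF e(1) x] unfolding e(2) ell2_inner_cscale_left .
  moreover have "ell2_inner e (E x) = (l * cnj l) * ell2_inner e (E x)"
    using l by (simp only: mult.commute mult_1_left mult_1_right)
  ultimately have "ell2_inner e (E x) = l * ell2_inner e x" by (simp only: mult.assoc)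
  moreover have "ell2_inner e e = ell2_inner e (E x) - l * ell2_inner e x"
    using ell2_inner_diff_right[OF e(1) Ex ell2_cscale[OF x, of l]] unfolding eq ell2_inner_cscale_right .
  ultimately show False using ne by (simp add: ell2_inner_self[OF e(1)])
qed

text \<open>Every vector of the eigenvector span is \<open>(E - l) y'\<close> plus an eigenvector
  for \<open>l\<close>, since eigenvectors for \<open>m \<noteq> l\<close> can be divided by
  \<open>m - l\<close>. Subtracting such a \<open>y'\<close> from \<open>v\<close> leaves a vector
  that \<open>E - l\<close> maps to an eigenvector for \<open>l\<close>; this image vanishes because
  there are no Jordan blocks.\<close>

lemma isometry_root_in_span:
  assumes v: "v \<in> ell2" and E: "E v - cscale l v \<in> cseq.span (\<Union>l. eigenspace ell2 E l)"
  shows "v \<in> cseq.span (\<Union>l. eigenspace ell2 E l)"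
proof -
  let ?U = "cseq.span (\<Union>l. eigenspace ell2 E l)"
  note E' = bounded_on_ell2D[OF bdd]
  have "\<exists>y'\<in>?U. \<exists>e\<in>eigenspace ell2 E l. y = E y' - cscale l y' + e" if "y \<in> ?U" for y
    using that
  proof (induction rule: cseq.span_induct_alt)
    case base
    have "0 \<in> eigenspace ell2 E l" unfolding eigenspace_def mem_Collect_eq E'(5) cseq.scale_zero_right by simp
    moreover have "0 = E 0 - cscale l 0 + 0" unfolding E'(5) cseq.scale_zero_right by simp
    ultimately show ?case using cseq.span_zero by blast
  next
    case (step c x y)
    then obtain m y' e where x: "x \<in> eigenspace ell2 E m" and y': "y' \<in> ?U"
      and e: "e \<in> eigenspace ell2 E l" and y: "y = E y' - cscale l y' + e" by blast
    have Ex: "E x = cscale m x" and x2: "x \<in> ell2" and Ee: "E e = cscale l e" and e2: "e \<in> ell2"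
      using x e by (auto simp: eigenspace_def)
    show ?case
    proof (cases "m = l")
      case True
      have "cscale c x + e \<in> eigenspace ell2 E l"
        unfolding eigenspace_def
      proof (intro CollectI conjI)
        show "cscale c x + e \<in> ell2" by (intro ell2_add ell2_cscale x2 e2)
        show "E (cscale c x + e) = cscale l (cscale c x + e)"
          unfolding E'(2,3) Ex Ee True by (simp add: cscale_def fun_eq_iff algebra_simps)
      qed
      moreover have "cscale c x + y = E y' - cscale l y' + (cscale c x + e)" unfolding y by (simp add: add.left_commute)
      ultimately show ?thesis using y' by blast
    next
      case False
      define t where "t = c / (m - l)"
      have c: "c = t * (m - l)" using False by (simp add: t_def)
      have "cscale t x + y' \<in> ?U"
        using x by (intro cseq.span_add cseq.span_scale y' cseq.span_base) auto
      moreover have "cscale c x + y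
          = E (cscale t x + y') - cscale l (cscale t x + y') + e"
        unfolding y E'(2,3) Ex c by (simp add: cscale_def fun_eq_iff algebra_simps)
      ultimately show ?thesis using e by blast
    qed
  qed
  from this[OF E] obtain y' e where y': "y' \<in> ?U" and e: "e \<in> eigenspace ell2 E l"
    and eq: "E v - cscale l v = E y' - cscale l y' + e" by blast
  define x where "x = v - y'"
  have x: "x \<in> ell2" unfolding x_def by (intro ell2_diff v eigenspace_span_subset[OF y'])
  have xe: "E x - cscale l x = e"
    using eq unfolding x_def E'(4) cseq.scale_right_diff_distrib by (simp add: algebra_simps)
  then have "e = 0" using isometry_no_jordan_block[OF x _ _ xe] e by (auto simp: eigenspace_def)
  then have "x \<in> eigenspace ell2 E l" using xe x by (simp add: eigenspace_def)
  then have "x + y' \<in> ?U" by (intro cseq.span_add y' cseq.span_base) auto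
  then show ?thesis by (simp add: x_def)
qed

section \<open>Polynomials in an isometry, evaluated by Horner's scheme, and vectors with
  finite-dimensional orbit\<close>

definition op_poly :: "complex poly \<Rightarrow> (int \<Rightarrow> complex) \<Rightarrow> int \<Rightarrow> complex" where
  "op_poly p v = fold_coeffs (\<lambda>a w. cscale a v + E w) p 0"

lemma op_poly_0 [simp]: "op_poly 0 v = 0"
  by (simp add: op_poly_def)

lemma op_poly_pCons: "op_poly (pCons a p) v = cscale a v + E (op_poly p v)"
proof (cases "a = 0 \<and> p = 0")
  case True
  then show ?thesis using bounded_on_ell2D(5)[OF bdd] by (simp add: fun_eq_iff cscale_def)
next
  case False
  then show ?thesis unfolding op_poly_def
    by (cases "a = 0") (simp_all add: fold_coeffs_pCons_coeff_not_0_eq fold_coeffs_pCons_not_0_0_eq)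
qed

lemma op_poly_in_ell2: "v \<in> ell2 \<Longrightarrow> op_poly p v \<in> ell2"
  using bounded_on_ell2D(1)[OF bdd]
  by (induction p) (simp_all only: op_poly_0 ell2_zero op_poly_pCons ell2_add ell2_cscale)

lemma op_poly_add: "op_poly (p + q) v = op_poly p v + op_poly q v"
proof (induction p q rule: poly_induct2)
  case (pCons a p b q)
  have "op_poly (pCons a p + pCons b q) v = cscale (a + b) v + E (op_poly (p + q) v)"
    by (simp only: add_pCons op_poly_pCons)
  also have "\<dots> = op_poly (pCons a p) v + op_poly (pCons b q) v"
    unfolding pCons.IH bounded_on_ell2D(2)[OF bdd] op_poly_pCons cseq.scale_left_distrib by (simp add: ac_simps)
  finally show ?case .
qed simp

lemma op_poly_smult: "op_poly (smult c p) v = cscale c (op_poly p v)"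
proof (induction p)
  case (pCons a p)
  have "op_poly (smult c (pCons a p)) v = cscale (c * a) v + E (op_poly (smult c p) v)"
    by (simp only: smult_pCons op_poly_pCons)
  also have "\<dots> = cscale c (op_poly (pCons a p) v)"
    unfolding pCons.IH bounded_on_ell2D(3)[OF bdd] op_poly_pCons cseq.scale_right_distrib cseq.scale_scale ..
  finally show ?case .
qed (simp only: smult_0_right op_poly_0 cseq.scale_zero_right)

lemma op_poly_monom: "op_poly (monom c i) v = cscale c ((E ^^ i) v)"
proof (induction i)
  case 0
  show ?case by (simp add: monom_0 op_poly_pCons bounded_on_ell2D(5)[OF bdd])
next
  case (Suc i)
  have "op_poly (monom c (Suc i)) v = cscale 0 v + E (op_poly (monom c i) v)"
    by (simp only: monom_Suc op_poly_pCons)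
  then show ?case unfolding Suc bounded_on_ell2D(3)[OF bdd] by simp
qed

lemma op_poly_in_span:
  assumes "p \<noteq> 0" "v \<in> ell2" "op_poly p v \<in> cseq.span (\<Union>l. eigenspace ell2 E l)"
  shows "v \<in> cseq.span (\<Union>l. eigenspace ell2 E l)"
  using assms
proof (induction "degree p" arbitrary: p)
  case 0
  then obtain c where "p = [:c:]" "c \<noteq> 0" by (metis degree_eq_zeroE pCons_0_0)
  then have "op_poly p v = cscale c v" by (simp add: op_poly_pCons bounded_on_ell2D(5)[OF bdd])
  then have "cscale (inverse c) (cscale c v) \<in> cseq.span (\<Union>l. eigenspace ell2 E l)"
    using 0 by (metis cseq.span_scale)
  then show ?case using \<open>c \<noteq> 0\<close> by simp
next
  case (Suc d)
  then have "\<not> constant (poly p)" by (simp add: constant_degree)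
  then obtain l where "poly p l = 0" using fundamental_theorem_of_algebra by blast
  then obtain q where q: "p = [:- l, 1:] * q" by (metis poly_eq_0_iff_dvd dvdE)
  then have "q \<noteq> 0" using Suc by auto
  then have "degree p = degree [:- l, 1:] + degree q" unfolding q by (intro degree_mult_eq) auto
  then have deg: "degree q = d" using Suc.hyps(2) by simp
  have "p = smult (- l) q + pCons 0 q" using q by simp
  then have "op_poly p v = cscale (- l) (op_poly q v) + E (op_poly q v)"
    by (simp only: op_poly_add op_poly_smult op_poly_pCons cseq.scale_zero_left add_0)
  then have "E (op_poly q v) - cscale l (op_poly q v) \<in> cseq.span (\<Union>l. eigenspace ell2 E l)"
    using Suc.prems(3) by simp
  then have "op_poly q v \<in> cseq.span (\<Union>l. eigenspace ell2 E l)"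
    by (rule isometry_root_in_span[OF op_poly_in_ell2[OF Suc.prems(2)]])
  then show ?case using Suc.hyps(1)[of q] deg \<open>q \<noteq> 0\<close> Suc.prems(2) by blast
qed

text \<open>A finite-dimensional space that contains the orbit yields a nonzero polynomial
  annihilating \<open>v\<close>; \<open>op_poly_in_span\<close> then removes its roots one at a
  time.\<close>

lemma finite_orbit_in_span:
  assumes v: "v \<in> ell2" and F: "finite F" "\<And>i. (E ^^ i) v \<in> cseq.span F"
  shows "v \<in> cseq.span (\<Union>l. eigenspace ell2 E l)"
proof -
  have "\<exists>p. p \<noteq> 0 \<and> op_poly p v = 0"
  \<comment> \<open>Linear dependence speaks of sets of vectors, so an orbit with a repetition is
    treated apart: there the difference of two monomials annihilates \<open>v\<close>.\<close>
  proof (cases "inj (\<lambda>i. (E ^^ i) v)")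
    case False
    then obtain i j where ij: "i \<noteq> j" "(E ^^ i) v = (E ^^ j) v" by (auto simp: inj_def)
    have "op_poly (monom 1 i + monom (- 1) j) v = 0"
      unfolding op_poly_add op_poly_monom ij(2) by (simp add: cscale_def fun_eq_iff)
    moreover have "monom 1 i + monom (- 1) j \<noteq> (0 :: complex poly)"
    proof
      assume "monom 1 i + monom (- 1) j = (0 :: complex poly)"
      then have "coeff (monom 1 i + monom (- 1) j) i = (0 :: complex)" by simp
      then show False using ij(1) by (simp add: coeff_monom)
    qed
    ultimately show ?thesis by blast
  next
    case True
    have "\<not> finite (range (\<lambda>i. (E ^^ i) v))" using True finite_imageD by blast
    moreover have "range (\<lambda>i. (E ^^ i) v) \<subseteq> cseq.span F" using F(2) by auto
    ultimately have "cseq.dependent (range (\<lambda>i. (E ^^ i) v))"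
      using cseq.independent_span_bound[OF F(1)] by blast
    then obtain t c w where t: "finite t" "t \<subseteq> range (\<lambda>i. (E ^^ i) v)" "(\<Sum>x\<in>t. cscale (c x) x) = 0" "w \<in> t" "c w \<noteq> 0"
      unfolding cseq.dependent_explicit by blast
    define idx where "idx = inv (\<lambda>i. (E ^^ i) v)"
    have idx: "(E ^^ idx x) v = x" if "x \<in> t" for x
      unfolding idx_def by (rule f_inv_into_f[where f = "\<lambda>i. (E ^^ i) v"]) (use that t(2) in blast)
    define p where "p = (\<Sum>x\<in>t. monom (c x) (idx x))"
    have "op_poly (\<Sum>x\<in>s. monom (c x) (idx x)) v = (\<Sum>x\<in>s. cscale (c x) ((E ^^ idx x) v))" if "finite s" for s
      using that by induction (simp_all add: op_poly_add op_poly_monom)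
    then have "op_poly p v = (\<Sum>x\<in>t. cscale (c x) x)" using t(1) idx unfolding p_def by (simp cong: sum.cong)
    moreover have "p \<noteq> 0"
    proof
      have "coeff p (idx w) = (\<Sum>x\<in>t. if x = w then c x else 0)"
        unfolding p_def coeff_sum
      proof (rule sum.cong)
        fix x assume "x \<in> t"
        then have "idx x = idx w \<longleftrightarrow> x = w" using idx t(4) by metis
        then show "coeff (monom (c x) (idx x)) (idx w) = (if x = w then c x else 0)" by simp
      qed simp
      also have "\<dots> = c w" using t by simp
      finally have "coeff p (idx w) = c w" .
      moreover assume "p = 0"
      ultimately show False using t(5) by simp
    qed
    ultimately show ?thesis using t(3) by auto
  qed
  then obtain p where "p \<noteq> 0" "op_poly p v = 0" by blast
  then show ?thesis using op_poly_in_span[OF _ v] cseq.span_zero by metis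
qed

end

text \<open>At a unimodular coefficient \<open>rho\<close> vanishes, which cuts the bond from
  \<open>p\<close> to \<open>p + 1\<close>. Sequences supported on \<open>{p<..q}\<close> therefore
  form a finite-dimensional invariant space containing \<open>delta n\<close>.\<close>

lemma cmv_block_pure_point:
  assumes ver: "verblunsky \<alpha>"
    and blocks: "\<And>n. \<exists>p q. p < n \<and> n \<le> q \<and> cmod (\<alpha> p) = 1 \<and> cmod (\<alpha> q) = 1"
  shows "pure_point_spectrum ell2 (cmv \<alpha>)"
  unfolding pure_point_spectrum_def
proof (rule dense_in_ell2_span)
  fix n
  obtain p q where pq: "p < n" "n \<le> q" "cmod (\<alpha> p) = 1" "cmod (\<alpha> q) = 1" using blocks by blast
  have rho0: "rho \<alpha> p = 0" "rho \<alpha> q = 0" using pq by (simp_all add: rho_def)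
  define V where "V = {u :: int \<Rightarrow> complex. \<forall>m. m \<notin> {p<..q} \<longrightarrow> u m = 0}"
  have vanish: "u m = 0" "rho \<alpha> m * u (m + 1) = 0" "rho \<alpha> (m - 1) * u (m - 1) = 0"
    if "u \<in> V" "m \<notin> {p<..q}" for u m
  proof -
    have zero: "u l = 0" if "l \<notin> {p<..q}" for l using \<open>u \<in> V\<close> that by (simp add: V_def)
    show "u m = 0" by (rule zero) fact
    show "rho \<alpha> m * u (m + 1) = 0" using that(2) rho0 zero[of "m + 1"] by (cases "m = p") auto
    show "rho \<alpha> (m - 1) * u (m - 1) = 0" using that(2) rho0 zero[of "m - 1"] by (cases "m - 1 = q") auto
  qed
  have ev: "even_factor \<alpha> u \<in> V" and od: "odd_factor \<alpha> u \<in> V" if "u \<in> V" for u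
    using vanish[OF that] by (auto simp: V_def even_factor_apply odd_factor_apply)
  have "(cmv \<alpha> ^^ i) (delta n) \<in> V" for i
  proof (induction i)
    case 0
    then show ?case using pq by (auto simp: V_def delta_def)
  next
    case (Suc i)
    then show ?case by (simp add: cmv_eq ev od)
  qed
  moreover have "V \<subseteq> cseq.span (delta ` {p<..q})"
  proof
    fix u assume u: "u \<in> V"
    have "u = (\<Sum>m\<in>{p<..q}. cscale (u m) (delta m))"
    proof
      fix l
      have "(\<Sum>m\<in>{p<..q}. cscale (u m) (delta m)) l = (\<Sum>m\<in>{p<..q}. if m = l then u m else 0)"
        by (simp add: sum_fun_apply cscale_def delta_def mult_ac if_distrib eq_commute cong: if_cong)
      then show "u l = (\<Sum>m\<in>{p<..q}. cscale (u m) (delta m)) l" using u by (auto simp: V_def)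
    qed
    also have "\<dots> \<in> cseq.span (delta ` {p<..q})"
      by (intro cseq.span_sum cseq.span_scale cseq.span_base) auto
    finally show "u \<in> cseq.span (delta ` {p<..q})" .
  qed
  ultimately show "delta n \<in> cseq.span (\<Union>l. eigenspace ell2 (cmv \<alpha>) l)"
    by (intro finite_orbit_in_span[OF bounded_cmv(1)[OF ver] cmv_isometry[OF ver], where F = "delta ` {p<..q}"]) auto
qed


section \<open>The quantum walk\<close>

text \<open>
  A state assigns to each site an amplitude for moving right and one for moving left. In one step
  every walker meets the block of the next edge, so that two steps of the walk, restricted to
  right-movers on odd and left-movers on even sites, form one application of the CMV matrix.
\<close>

fun walk :: "(int \<Rightarrow> complex) \<Rightarrow> (int \<Rightarrow> complex) \<times> (int \<Rightarrow> complex) \<Rightarrow> (int \<Rightarrow> complex) \<times> (int \<Rightarrow> complex)" where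
  "walk \<alpha> (R, L) = (\<lambda>n. rho \<alpha> (n - 1) * R (n - 1) - \<alpha> (n - 1) * L n,
                    \<lambda>n. cnj (\<alpha> n) * R n + rho \<alpha> n * L (n + 1))"

definition odd_part :: "(int \<Rightarrow> complex) \<Rightarrow> int \<Rightarrow> complex" where
  "odd_part u n = (if odd n then u n else 0)"

definition even_part :: "(int \<Rightarrow> complex) \<Rightarrow> int \<Rightarrow> complex" where
  "even_part u n = (if even n then u n else 0)"

lemma walk_odd_even: "walk \<alpha> (odd_part u, even_part u) = (even_part (odd_factor \<alpha> u), odd_part (odd_factor \<alpha> u))"
  by (auto simp: odd_part_def even_part_def odd_factor_apply fun_eq_iff)

lemma walk_even_odd: "walk \<alpha> (even_part u, odd_part u) = (odd_part (even_factor \<alpha> u), even_part (even_factor \<alpha> u))"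
  by (auto simp: odd_part_def even_part_def even_factor_apply fun_eq_iff)

lemma funpow_double_Suc: "(f ^^ (Suc k + Suc k)) x = f (f ((f ^^ (k + k)) x))"
  by simp

lemma walk_cmv:
  "(walk \<alpha> ^^ (k + k)) (odd_part u, even_part u) = (odd_part ((cmv \<alpha> ^^ k) u), even_part ((cmv \<alpha> ^^ k) u))"
proof (induction k)
  case (Suc k)
  have "walk \<alpha> (walk \<alpha> (odd_part w, even_part w)) = (odd_part (cmv \<alpha> w), even_part (cmv \<alpha> w))" for w
    unfolding walk_odd_even walk_even_odd cmv_eq ..
  then show ?case unfolding funpow_double_Suc Suc by simp
qed simp

text \<open>The inverse meets the even factor first, so the walk with conjugated coefficients starts
  with right-movers on even and left-movers on odd sites.\<close>

lemma walk_cmv_inv: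
  "(walk (cnj \<circ> \<alpha>) ^^ (k + k)) (even_part u, odd_part u) = (even_part ((cmv_inv \<alpha> ^^ k) u), odd_part ((cmv_inv \<alpha> ^^ k) u))"
proof (induction k)
  case (Suc k)
  have "walk (cnj \<circ> \<alpha>) (walk (cnj \<circ> \<alpha>) (even_part w, odd_part w)) = (even_part (cmv_inv \<alpha> w), odd_part (cmv_inv \<alpha> w))" for w
    unfolding walk_odd_even walk_even_odd cmv_inv_def ..
  then show ?case unfolding funpow_double_Suc Suc by simp
qed simp

definition spaced :: "nat \<Rightarrow> (int \<Rightarrow> complex) \<Rightarrow> bool" where
  "spaced k \<alpha> \<longleftrightarrow> (\<forall>m n. m < n \<and> n < m + int k \<longrightarrow> \<alpha> m = 0 \<or> \<alpha> n = 0)"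

lemma spacedD: "spaced k \<alpha> \<Longrightarrow> \<alpha> m \<noteq> 0 \<Longrightarrow> m \<noteq> n \<Longrightarrow> \<bar>m - n\<bar> < int k \<Longrightarrow> \<alpha> n = 0"
  unfolding spaced_def by (cases "m < n") (smt (verit))+

lemma rho_0: "\<alpha> n = 0 \<Longrightarrow> rho \<alpha> n = 1"
  by (simp add: rho_def)

text \<open>If any \<open>j\<close> consecutive edges contain at most one scatterer, then a walker scatters at most once in \<open>j\<close> steps.\<close>

lemma walk_power:
  assumes sp: "spaced k \<alpha>" and "j \<le> k"
  shows "(walk \<alpha> ^^ j) (R, L) =
     (\<lambda>n. (\<Prod>q\<in>{n - int j..<n}. rho \<alpha> q) * R (n - int j) - (\<Sum>q\<in>{n - int j..<n}. \<alpha> q * L (int j + 2 * q + 1 - n)),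
      \<lambda>n. (\<Prod>q\<in>{n..<n + int j}. rho \<alpha> q) * L (n + int j) + (\<Sum>q\<in>{n..<n + int j}. cnj (\<alpha> q) * R (2 * q - n - int j + 1)))"
  using \<open>j \<le> k\<close>
proof (induction j)
  case (Suc j)
  then have jk: "j < k" by simp
  have IH: "(walk \<alpha> ^^ Suc j) (R, L) = walk \<alpha>
     (\<lambda>n. (\<Prod>q\<in>{n - int j..<n}. rho \<alpha> q) * R (n - int j) - (\<Sum>q\<in>{n - int j..<n}. \<alpha> q * L (int j + 2 * q + 1 - n)),
      \<lambda>n. (\<Prod>q\<in>{n..<n + int j}. rho \<alpha> q) * L (n + int j) + (\<Sum>q\<in>{n..<n + int j}. cnj (\<alpha> q) * R (2 * q - n - int j + 1)))"
    using Suc by simp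
  have zero: "\<alpha> q = 0" if "\<alpha> m \<noteq> 0" "q \<noteq> m" "\<bar>m - q\<bar> \<le> int j" for m q
    using spacedD[OF sp that(1), of q] that jk by auto
  have 1: "rho \<alpha> (n - 1) * ((\<Prod>q\<in>{n - 1 - int j..<n - 1}. rho \<alpha> q) * R (n - 1 - int j)
        - (\<Sum>q\<in>{n - 1 - int j..<n - 1}. \<alpha> q * L (int j + 2 * q + 1 - (n - 1))))
      - \<alpha> (n - 1) * ((\<Prod>q\<in>{n..<n + int j}. rho \<alpha> q) * L (n + int j) + (\<Sum>q\<in>{n..<n + int j}. cnj (\<alpha> q) * R (2 * q - n - int j + 1)))
      = (\<Prod>q\<in>{n - int (Suc j)..<n}. rho \<alpha> q) * R (n - int (Suc j))
        - (\<Sum>q\<in>{n - int (Suc j)..<n}. \<alpha> q * L (int (Suc j) + 2 * q + 1 - n))" for n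
  proof -
    have set: "{n - int (Suc j)..<n} = insert (n - 1) {n - 1 - int j..<n - 1}" by auto
    have ins: "prod f {n - int (Suc j)..<n} = f (n - 1) * prod f {n - 1 - int j..<n - 1}"
      "sum f {n - int (Suc j)..<n} = f (n - 1) + sum f {n - 1 - int j..<n - 1}" for f :: "int \<Rightarrow> complex"
      unfolding set by simp_all
    have shift: "int j + 2 * q + 1 - (n - 1) = int (Suc j) + 2 * q + 1 - n" "n - 1 - int j = n - int (Suc j)" for q by auto
    show ?thesis
    \<comment> \<open>Either the new edge is free and only lengthens the path, or it scatters; then
      all other edges within reach are free, the products are one and the sums vanish.\<close>
    proof (cases "\<alpha> (n - 1) = 0")
      case True
      then show ?thesis unfolding ins shift by (simp add: rho_0)
    next
      case False
      have z1: "\<alpha> q = 0" if "q \<in> {n - 1 - int j..<n - 1}" for q using zero[OF False, of q] that by auto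
      have z2: "\<alpha> q = 0" if "q \<in> {n..<n + int j}" for q using zero[OF False, of q] that by auto
      have p: "(\<Prod>q\<in>{n - 1 - int j..<n - 1}. rho \<alpha> q) = 1" "(\<Prod>q\<in>{n..<n + int j}. rho \<alpha> q) = 1"
        using z1 z2 rho_0 by (auto intro!: prod.neutral)
      have s: "(\<Sum>q\<in>{n - 1 - int j..<n - 1}. \<alpha> q * f q) = 0" "(\<Sum>q\<in>{n..<n + int j}. cnj (\<alpha> q) * f q) = 0" for f
        using z1 z2 by (auto intro!: sum.neutral)
      have "int (Suc j) + 2 * (n - 1) + 1 - n = n + int j" by simp
      then show ?thesis unfolding ins unfolding shift(2)[symmetric] p s by simp
    qed
  qed
  have 2: "cnj (\<alpha> n) * ((\<Prod>q\<in>{n - int j..<n}. rho \<alpha> q) * R (n - int j) - (\<Sum>q\<in>{n - int j..<n}. \<alpha> q * L (int j + 2 * q + 1 - n)))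
      + rho \<alpha> n * ((\<Prod>q\<in>{n + 1..<n + 1 + int j}. rho \<alpha> q) * L (n + 1 + int j)
        + (\<Sum>q\<in>{n + 1..<n + 1 + int j}. cnj (\<alpha> q) * R (2 * q - (n + 1) - int j + 1)))
      = (\<Prod>q\<in>{n..<n + int (Suc j)}. rho \<alpha> q) * L (n + int (Suc j))
        + (\<Sum>q\<in>{n..<n + int (Suc j)}. cnj (\<alpha> q) * R (2 * q - n - int (Suc j) + 1))" for n
  proof -
    have set: "{n..<n + int (Suc j)} = insert n {n + 1..<n + 1 + int j}" by auto
    have ins: "prod f {n..<n + int (Suc j)} = f n * prod f {n + 1..<n + 1 + int j}"
      "sum f {n..<n + int (Suc j)} = f n + sum f {n + 1..<n + 1 + int j}" for f :: "int \<Rightarrow> complex"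
      unfolding set by simp_all
    have shift: "2 * q - (n + 1) - int j + 1 = 2 * q - n - int (Suc j) + 1" "n + 1 + int j = n + int (Suc j)" for q by auto
    show ?thesis
    proof (cases "\<alpha> n = 0")
      case True
      then show ?thesis unfolding ins shift by (simp add: rho_0)
    next
      case False
      have z1: "\<alpha> q = 0" if "q \<in> {n + 1..<n + 1 + int j}" for q using zero[OF False, of q] that by auto
      have z2: "\<alpha> q = 0" if "q \<in> {n - int j..<n}" for q using zero[OF False, of q] that by auto
      have p: "(\<Prod>q\<in>{n + 1..<n + 1 + int j}. rho \<alpha> q) = 1" "(\<Prod>q\<in>{n - int j..<n}. rho \<alpha> q) = 1"
        using z1 z2 rho_0 by (auto intro!: prod.neutral)
      have s: "(\<Sum>q\<in>{n + 1..<n + 1 + int j}. cnj (\<alpha> q) * f q) = 0" "(\<Sum>q\<in>{n - int j..<n}. \<alpha> q * f q) = 0" for f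
        using z1 z2 by (auto intro!: sum.neutral)
      have "2 * n - n - int (Suc j) + 1 = n - int j" by simp
      then show ?thesis unfolding ins unfolding shift(2)[symmetric] p s by simp
    qed
  qed
  show ?case unfolding IH walk.simps 1 2 ..
qed simp

lemma walk_double:
  assumes sp: "spaced k \<alpha>"
  defines "R' \<equiv> \<lambda>R L n. (\<Prod>q\<in>{n - int k..<n}. rho \<alpha> q) * R (n - int k) - (\<Sum>q\<in>{n - int k..<n}. \<alpha> q * L (int k + 2 * q + 1 - n))"
    and "L' \<equiv> \<lambda>R L n. (\<Prod>q\<in>{n..<n + int k}. rho \<alpha> q) * L (n + int k) + (\<Sum>q\<in>{n..<n + int k}. cnj (\<alpha> q) * R (2 * q - n - int k + 1))"
  shows "(walk \<alpha> ^^ (k + k)) (R, L) = (R' (R' R L) (L' R L), L' (R' R L) (L' R L))"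
  unfolding funpow_add comp_apply walk_power[OF sp order_refl] R'_def L'_def ..

lemma sum_single_index:
  fixes f :: "int \<Rightarrow> complex"
  assumes "finite A"
  shows "(\<Sum>i\<in>A. f i * (if P i then 1 else 0)) = (\<Sum>i\<in>{i \<in> A. P i}. f i)"
proof -
  have "(\<Sum>i\<in>A. f i * (if P i then 1 else 0)) = (\<Sum>i\<in>A. if P i then f i else 0)"
    by (rule sum.cong) auto
  then show ?thesis by (simp add: sum.inter_filter[OF assms])
qed

text \<open>The \<open>k\<close>-th power is \<open>2 * k\<close> steps of the walk, with at most
  one reflection in each half. To be back at \<open>n\<close> with the same direction a walker must
  be reflected once in each half, and the timing forces the two edges to be \<open>i\<close> and
  \<open>i + k\<close>. The sign comes from the entry \<open>- c\<close> of
  \<open>Theta c\<close>.\<close>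

lemma cmv_power_diagonal:
  assumes sp: "spaced k \<alpha>" and k: "0 < k"
  shows "(cmv \<alpha> ^^ k) (delta n) n = - (\<Sum>i\<in>{n - int k..<n}. \<alpha> i * cnj (\<alpha> (i + int k)))"
proof (cases "odd n")
  case True
  have parts: "odd_part (delta n) = delta n" "even_part (delta n) = (\<lambda>_. 0)"
    using True by (auto simp: odd_part_def even_part_def delta_def fun_eq_iff)
  define L where "L = (\<lambda>m. \<Sum>q\<in>{m..<m + int k}. cnj (\<alpha> q) * delta n (2 * q - m - int k + 1))"
  have L: "L (int k + 2 * q + 1 - n) = cnj (\<alpha> (q + int k))" if "q \<in> {n - int k..<n}" for q
  proof -
    define m where "m = int k + 2 * q + 1 - n"
    have "{i \<in> {m..<m + int k}. 2 * i - m - int k + 1 = n} = {q + int k}"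
      using that by (auto simp: m_def)
    then show ?thesis unfolding m_def[symmetric] L_def delta_def by (simp add: sum_single_index)
  qed
  have "(cmv \<alpha> ^^ k) (delta n) n = fst ((walk \<alpha> ^^ (k + k)) (odd_part (delta n), even_part (delta n))) n"
    unfolding walk_cmv using True by (simp add: odd_part_def)
  also have "\<dots> = - (\<Sum>q\<in>{n - int k..<n}. \<alpha> q * L (int k + 2 * q + 1 - n))"
    unfolding walk_double[OF sp] parts L_def using k by (simp add: delta_def)
  also have "(\<Sum>q\<in>{n - int k..<n}. \<alpha> q * L (int k + 2 * q + 1 - n)) = (\<Sum>i\<in>{n - int k..<n}. \<alpha> i * cnj (\<alpha> (i + int k)))"
    by (rule sum.cong) (simp_all only: L)
  finally show ?thesis .
next
  case False
  have parts: "odd_part (delta n) = (\<lambda>_. 0)" "even_part (delta n) = delta n"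
    using False by (auto simp: odd_part_def even_part_def delta_def fun_eq_iff)
  define R where "R = (\<lambda>m. \<Sum>q\<in>{m - int k..<m}. \<alpha> q * delta n (int k + 2 * q + 1 - m))"
  have R: "R (2 * q - n - int k + 1) = \<alpha> (q - int k)" if "q \<in> {n..<n + int k}" for q
  proof -
    define m where "m = 2 * q - n - int k + 1"
    have "{i \<in> {m - int k..<m}. int k + 2 * i + 1 - m = n} = {q - int k}"
      using that by (auto simp: m_def)
    then show ?thesis unfolding m_def[symmetric] R_def delta_def by (simp add: sum_single_index)
  qed
  have "(cmv \<alpha> ^^ k) (delta n) n = snd ((walk \<alpha> ^^ (k + k)) (odd_part (delta n), even_part (delta n))) n"
    unfolding walk_cmv using False by (simp add: even_part_def)
  also have "\<dots> = - (\<Sum>q\<in>{n..<n + int k}. cnj (\<alpha> q) * R (2 * q - n - int k + 1))"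
    unfolding walk_double[OF sp] parts R_def using k by (simp add: delta_def sum_negf)
  also have "(\<Sum>q\<in>{n..<n + int k}. cnj (\<alpha> q) * R (2 * q - n - int k + 1)) = (\<Sum>q\<in>{n..<n + int k}. cnj (\<alpha> q) * \<alpha> (q - int k))"
    by (rule sum.cong) (simp_all only: R)
  also have "\<dots> = (\<Sum>i\<in>{n - int k..<n}. \<alpha> i * cnj (\<alpha> (i + int k)))"
    by (rule sum.reindex_bij_witness[where i = "\<lambda>i. i + int k" and j = "\<lambda>q. q - int k"]) auto
  finally show ?thesis .
qed

section \<open>The Khrushchev class\<close>

text \<open>What equality of the moments forces once two coefficients are nonzero. The product
  condition determines all lattice coefficients from one of them: the moduli repeat with period
  \<open>2 * k\<close>, and a translation by \<open>2 * k\<close> multiplies by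
  \<open>cnj d / d\<close>.\<close>

definition sieved :: "nat \<Rightarrow> int \<Rightarrow> complex \<Rightarrow> (int \<Rightarrow> complex) \<Rightarrow> bool" where
  "sieved k s d \<alpha> \<longleftrightarrow> 0 < k \<and> d \<noteq> 0 \<and> (\<forall>n. \<not> int k dvd n - s \<longrightarrow> \<alpha> n = 0) \<and>
     (\<forall>n. int k dvd n - s \<longrightarrow> \<alpha> n * cnj (\<alpha> (n + int k)) = d)"

lemma khrushchev_power_diagonal:
  assumes "khrushchev_class \<alpha>"
  shows "(cmv \<alpha> ^^ k) (delta n) n = (cmv \<alpha> ^^ k) (delta m) m"
proof -
  obtain \<mu> where \<mu>: "\<And>j. unitary_spectral_measure (cmv \<alpha>) (delta j) (\<mu> j)" "\<And>n m. \<mu> n = \<mu> m"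
    using assms unfolding khrushchev_class_def by blast
  have "(LINT x|\<mu> j. x ^ k) = (cmv \<alpha> ^^ k) (delta j) j" for j
    using \<mu>(1)[of j] unfolding unitary_spectral_measure_def by simp
  then show ?thesis using \<mu>(2) by metis
qed

text \<open>Equal diagonals of the \<open>k\<close>-th power mean that the sums of \<open>c\<close>
  over all windows of length \<open>k\<close> agree; neighbouring windows differ by their end
  points, so \<open>c\<close> has period \<open>k\<close>. Nonvanishing at \<open>s\<close> then
  propagates along the lattice in both directions, and minimality of \<open>k\<close> leaves no room
  for nonzero coefficients between lattice sites.\<close>

lemma khrushchev_sieved:
  assumes kh: "khrushchev_class \<alpha>" and two: "\<alpha> p \<noteq> 0" "\<alpha> q \<noteq> 0" "p \<noteq> q"
  obtains k s d where "sieved k s d \<alpha>"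
proof -
  let ?P = "\<lambda>k. 0 < k \<and> (\<exists>m. \<alpha> m \<noteq> 0 \<and> \<alpha> (m + int k) \<noteq> 0)"
  have "\<exists>k. ?P k"
  proof (cases "p < q")
    case True
    then show ?thesis using two by (intro exI[of _ "nat (q - p)"]) (auto intro!: exI[of _ p])
  next
    case False
    then show ?thesis using two by (intro exI[of _ "nat (p - q)"]) (auto intro!: exI[of _ q])
  qed
  define k where "k = (LEAST k. ?P k)"
  have P: "?P k" unfolding k_def by (rule LeastI_ex) fact
  have least: "k \<le> j" if "?P j" for j unfolding k_def by (rule Least_le[of ?P j, OF that])
  have sp: "spaced k \<alpha>"
    unfolding spaced_def
  proof (intro allI impI, rule ccontr)
    fix m n assume mn: "m < n \<and> n < m + int k" and "\<not> (\<alpha> m = 0 \<or> \<alpha> n = 0)"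
    then have "?P (nat (n - m))" by (auto intro!: exI[of _ m])
    from least[OF this] mn show False by linarith
  qed
  obtain s where s: "\<alpha> s \<noteq> 0" "\<alpha> (s + int k) \<noteq> 0" and k: "0 < k" using P by blast
  define c where "c = (\<lambda>i. \<alpha> i * cnj (\<alpha> (i + int k)))"
  have per: "c (n + int k) = c n" for n
  proof -
    have "(\<Sum>i\<in>{n..<n + int k}. c i) = (\<Sum>i\<in>{n + 1..<n + 1 + int k}. c i)"
      using khrushchev_power_diagonal[OF kh, of k "n + int k" "n + 1 + int k"]
      unfolding cmv_power_diagonal[OF sp k] c_def by simp
    moreover have "{n..<n + int k} = insert n {n + 1..<n + int k}" "{n + 1..<n + 1 + int k} = insert (n + int k) {n + 1..<n + int k}"
      using k by auto
    ultimately show ?thesis by simp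
  qed
  have per': "c (s + int k * i) = c s" for i
  proof (induction i rule: int_induct[where k = 0])
    case (step1 i)
    then show ?case using per[of "s + int k * i"] by (simp add: algebra_simps)
  next
    case (step2 i)
    then show ?case using per[of "s + int k * (i - 1)"] by (simp add: algebra_simps)
  qed simp
  have nz: "c s \<noteq> 0" using s by (simp add: c_def)
  have nonzero: "\<alpha> (s + int k * i) \<noteq> 0" for i
    using per'[of i] nz by (auto simp: c_def)
  have "\<alpha> n = 0" if "\<not> int k dvd n - s" for n
  proof -
    define r where "r = (n - s) mod int k"
    have "r \<noteq> 0" using that by (simp add: r_def mod_eq_0_iff_dvd)
    moreover have "0 \<le> r" "r < int k" using k by (simp_all add: r_def)
    ultimately have r: "0 < r" "r < int k" by auto
    have "n = s + int k * ((n - s) div int k) + r" by (simp add: r_def)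
    then show ?thesis using spacedD[OF sp nonzero[of "(n - s) div int k"], of n] r by auto
  qed
  moreover have "\<alpha> n * cnj (\<alpha> (n + int k)) = c s" if "int k dvd n - s" for n
  proof -
    from that obtain i where "n - s = int k * i" by (elim dvdE)
    then have "n = s + int k * i" by simp
    then show ?thesis using per'[of i] by (simp add: c_def)
  qed
  ultimately have "sieved k s (c s) \<alpha>" using k nz by (simp add: sieved_def)
  then show ?thesis by (rule that)
qed

section \<open>Sieved coefficients and two rounds of the walk\<close>

lemma sieved_cnj: "sieved k s d \<alpha> \<Longrightarrow> sieved k s (cnj d) (cnj \<circ> \<alpha>)"
  unfolding sieved_def by (metis comp_apply complex_cnj_cancel_iff complex_cnj_mult complex_cnj_zero)

context
  fixes k :: nat and s :: int and d :: complex and \<alpha> :: "int \<Rightarrow> complex"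
  assumes sv: "sieved k s d \<alpha>"
begin

lemma sieved_pos: "0 < k" using sv by (simp add: sieved_def)

lemma sieved_zero: "\<not> int k dvd n - s \<Longrightarrow> \<alpha> n = 0" using sv by (simp add: sieved_def)

lemma sieved_corr: "int k dvd n - s \<Longrightarrow> \<alpha> n * cnj (\<alpha> (n + int k)) = d" using sv by (simp add: sieved_def)

lemma sieved_nonzero: "int k dvd n - s \<Longrightarrow> \<alpha> n \<noteq> 0"
  using sieved_corr[of n] sv by (auto simp: sieved_def)

lemma sieved_dvd_shift:
  assumes "int k dvd n - s"
  shows "int k dvd n + int k - s" "int k dvd n - int k - s"
proof -
  have "n + int k - s = (n - s) + int k" "n - int k - s = (n - s) - int k" by simp_all
  then show "int k dvd n + int k - s" "int k dvd n - int k - s"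
    using dvd_add[OF assms dvd_refl] dvd_diff[OF assms dvd_refl] by (simp_all only:)
qed

lemma sieved_window:
  assumes "int k dvd q - s" "q \<in> A" "A \<subseteq> {q - int k<..<q + int k}" "finite A"
  shows "(\<Prod>i\<in>A. rho \<alpha> i) = rho \<alpha> q" "(\<Sum>i\<in>A. \<alpha> i * f i) = \<alpha> q * f q"
    "(\<Sum>i\<in>A. cnj (\<alpha> i) * f i) = cnj (\<alpha> q) * f q"
proof -
  have z: "\<alpha> i = 0" if "i \<in> A" "i \<noteq> q" for i
  proof (rule sieved_zero, rule notI)
    assume "int k dvd i - s"
    then have "int k dvd (i - s) - (q - s)" using assms(1) by (rule dvd_diff)
    then have "int k dvd i - q" by simp
    moreover have "i \<in> {q - int k<..<q + int k}" using assms(3) that(1) by blast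
    then have "\<bar>i - q\<bar> < int k" by auto
    ultimately show False using that(2) zdvd_not_zless[of "\<bar>i - q\<bar>" "int k"] by auto
  qed
  have "(\<Prod>i\<in>A. rho \<alpha> i) = (\<Prod>i\<in>{q}. rho \<alpha> i)" "(\<Sum>i\<in>A. \<alpha> i * f i) = (\<Sum>i\<in>{q}. \<alpha> i * f i)"
    "(\<Sum>i\<in>A. cnj (\<alpha> i) * f i) = (\<Sum>i\<in>{q}. cnj (\<alpha> i) * f i)"
    by (rule prod.mono_neutral_right sum.mono_neutral_right; use assms z rho_0 in auto)+
  then show "(\<Prod>i\<in>A. rho \<alpha> i) = rho \<alpha> q" "(\<Sum>i\<in>A. \<alpha> i * f i) = \<alpha> q * f q"
    "(\<Sum>i\<in>A. cnj (\<alpha> i) * f i) = cnj (\<alpha> q) * f q" by simp_all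
qed

lemma sieved_spaced: "spaced k \<alpha>"
  unfolding spaced_def
proof (intro allI impI, rule ccontr)
  fix m n assume mn: "m < n \<and> n < m + int k" and "\<not> (\<alpha> m = 0 \<or> \<alpha> n = 0)"
  then have "int k dvd m - s" "int k dvd n - s" using sieved_zero by blast+
  then have "int k dvd (n - s) - (m - s)" by (rule dvd_diff[rotated])
  then have "int k dvd n - m" by simp
  then show False using mn zdvd_not_zless[of "n - m" "int k"] by auto
qed

lemma sieved_wall:
  obtains q where "int k dvd q - s" "q \<in> {n - int k..<n}"
proof -
  define r where "r = (n - 1 - s) mod int k"
  have r: "0 \<le> r" "r < int k" using sieved_pos by (simp_all add: r_def)
  have "int k dvd (n - 1 - s) - r" unfolding r_def by (rule dvd_minus_mod)
  then have "int k dvd (n - 1 - r) - s" by (simp add: algebra_simps)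
  then show ?thesis by (rule that) (use r in auto)
qed

text \<open>\<open>q\<close> is the only scatterer among the \<open>k\<close> edges to the left of
  \<open>n\<close>, and \<open>q + k\<close> the only one among the \<open>k\<close> edges to the
  right. Each of the four terms is a path that is transmitted or reflected in either of two rounds
  of \<open>k\<close> steps.\<close>

lemma walk_double_sieved:
  assumes q: "int k dvd q - s" "q \<in> {n - int k..<n}"
  shows "fst ((walk \<alpha> ^^ (k + k)) (R, L)) n =
      rho \<alpha> q * rho \<alpha> (q - int k) * R (n - 2 * int k) - rho \<alpha> q * \<alpha> (q - int k) * L (2 * q + 1 - n)
      - \<alpha> q * rho \<alpha> (q + int k) * L (2 * q + 2 * int k + 1 - n) - \<alpha> q * cnj (\<alpha> (q + int k)) * R n" (is ?thesis1)
    and "snd ((walk \<alpha> ^^ (k + k)) (R, L)) n =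
      rho \<alpha> (q + int k) * rho \<alpha> (q + 2 * int k) * L (n + 2 * int k)
      + rho \<alpha> (q + int k) * cnj (\<alpha> (q + 2 * int k)) * R (2 * q + 2 * int k + 1 - n)
      + cnj (\<alpha> (q + int k)) * rho \<alpha> q * R (2 * q + 1 - n) - cnj (\<alpha> (q + int k)) * \<alpha> q * L n" (is ?thesis2)
proof -
  note k = sieved_pos
  define R' where "R' = (\<lambda>n. (\<Prod>q\<in>{n - int k..<n}. rho \<alpha> q) * R (n - int k) - (\<Sum>q\<in>{n - int k..<n}. \<alpha> q * L (int k + 2 * q + 1 - n)))"
  define L' where "L' = (\<lambda>n. (\<Prod>q\<in>{n..<n + int k}. rho \<alpha> q) * L (n + int k) + (\<Sum>q\<in>{n..<n + int k}. cnj (\<alpha> q) * R (2 * q - n - int k + 1)))"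
  note dv = q(1) sieved_dvd_shift[OF q(1)] sieved_dvd_shift(1)[OF sieved_dvd_shift(1)[OF q(1)]]
  have left: "(\<Prod>i\<in>{m - int k..<m}. rho \<alpha> i) = rho \<alpha> w" "(\<Sum>i\<in>{m - int k..<m}. \<alpha> i * f i) = \<alpha> w * f w"
    if "int k dvd w - s" "w \<in> {m - int k..<m}" for m w f
    by (rule sieved_window[OF that]; use that k in auto)+
  have right: "(\<Prod>i\<in>{m..<m + int k}. rho \<alpha> i) = rho \<alpha> w" "(\<Sum>i\<in>{m..<m + int k}. cnj (\<alpha> i) * f i) = cnj (\<alpha> w) * f w"
    if "int k dvd w - s" "w \<in> {m..<m + int k}" for m w f
    by (rule sieved_window[OF that]; use that k in auto)+
  have R': "R' m = rho \<alpha> w * R (m - int k) - \<alpha> w * L (int k + 2 * w + 1 - m)"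
    if "int k dvd w - s" "w \<in> {m - int k..<m}" for m w
    unfolding R'_def left[OF that] ..
  have L': "L' m = rho \<alpha> w * L (m + int k) + cnj (\<alpha> w) * R (2 * w - m - int k + 1)"
    if "int k dvd w - s" "w \<in> {m..<m + int k}" for m w
    unfolding L'_def right[OF that] ..
  have "fst ((walk \<alpha> ^^ (k + k)) (R, L)) n = rho \<alpha> q * R' (n - int k) - \<alpha> q * L' (int k + 2 * q + 1 - n)"
    unfolding walk_double[OF sieved_spaced] fst_conv left[OF q] R'_def L'_def ..
  also have "R' (n - int k) = rho \<alpha> (q - int k) * R (n - int k - int k) - \<alpha> (q - int k) * L (int k + 2 * (q - int k) + 1 - (n - int k))"
    by (rule R'[OF dv(3)]) (use q in auto)
  also have "L' (int k + 2 * q + 1 - n) = rho \<alpha> (q + int k) * L (int k + 2 * q + 1 - n + int k)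
      + cnj (\<alpha> (q + int k)) * R (2 * (q + int k) - (int k + 2 * q + 1 - n) - int k + 1)"
    by (rule L'[OF dv(2)]) (use q in auto)
  finally show ?thesis1 by (simp add: algebra_simps)
  have q': "q + int k \<in> {n..<n + int k}" using q by auto
  have "snd ((walk \<alpha> ^^ (k + k)) (R, L)) n = rho \<alpha> (q + int k) * L' (n + int k) + cnj (\<alpha> (q + int k)) * R' (2 * (q + int k) - n - int k + 1)"
    unfolding walk_double[OF sieved_spaced] snd_conv right[OF dv(2) q'] R'_def L'_def ..
  also have "L' (n + int k) = rho \<alpha> (q + int k + int k) * L (n + int k + int k)
      + cnj (\<alpha> (q + int k + int k)) * R (2 * (q + int k + int k) - (n + int k) - int k + 1)"
    by (rule L'[OF dv(4)]) (use q in auto)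
  also have "R' (2 * (q + int k) - n - int k + 1) = rho \<alpha> q * R (2 * (q + int k) - n - int k + 1 - int k)
      - \<alpha> q * L (int k + 2 * q + 1 - (2 * (q + int k) - n - int k + 1))"
    by (rule R'[OF dv(1)]) (use q in auto)
  finally show ?thesis2 by (simp add: algebra_simps)
qed

end

section \<open>The phase of the correlation and the twisted sum of powers\<close>

context
  fixes k :: nat and s :: int and d :: complex and \<alpha> :: "int \<Rightarrow> complex"
  assumes sv: "sieved k s d \<alpha>"
begin

definition "phase = d / of_real (cmod d)"

lemma phase: "phase * cnj phase = 1" "cmod phase = 1" "cnj phase * d = of_real (cmod d)" "phase * cnj d = of_real (cmod d)"
proof -
  have d: "cmod d \<noteq> 0" using sv by (simp add: sieved_def)
  show "cmod phase = 1" using d by (simp add: phase_def norm_divide)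
  then show "phase * cnj phase = 1" by (simp add: complex_norm_square[symmetric])
  have "d * cnj d = of_real (cmod d) * of_real (cmod d)"
    by (simp add: complex_norm_square[symmetric] power2_eq_square)
  then show "cnj phase * d = of_real (cmod d)" "phase * cnj d = of_real (cmod d)"
    using d by (simp_all add: phase_def field_simps)
qed

text \<open>Compare the correlation at \<open>n\<close> with the conjugate of the one at
  \<open>n + k\<close>; the common factor \<open>cnj (\<alpha> (n + k))\<close> is nonzero and
  cancels. The phase is split between the two sides because it is in this form that single
  reflections cancel later.\<close>

lemma sieved_period:
  assumes "int k dvd n - s"
  shows "phase * \<alpha> (n + 2 * int k) = cnj phase * \<alpha> n"
proof -
  have 1: "\<alpha> n * cnj (\<alpha> (n + int k)) = d" by (rule sieved_corr[OF sv assms])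
  have 2: "\<alpha> (n + int k) * cnj (\<alpha> (n + 2 * int k)) = d"
    using sieved_corr[OF sv sieved_dvd_shift(1)[OF sv assms]] by (simp add: algebra_simps)
  have "cnj (\<alpha> (n + int k)) * (phase * \<alpha> (n + 2 * int k)) = phase * cnj d"
    using arg_cong[OF 2, of cnj] by (simp add: algebra_simps)
  also have "\<dots> = cnj phase * d" by (simp only: phase)
  also have "\<dots> = cnj (\<alpha> (n + int k)) * (cnj phase * \<alpha> n)" unfolding 1[symmetric] by (simp add: algebra_simps)
  finally show ?thesis using sieved_nonzero[OF sv sieved_dvd_shift(1)[OF sv assms]] by simp
qed

lemma sieved_norm_period: "int k dvd n - s \<Longrightarrow> cmod (\<alpha> (n + 2 * int k)) = cmod (\<alpha> n)"
  using arg_cong[OF sieved_period, of n cmod] by (simp add: norm_mult phase)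

lemma sieved_rho_period: "int k dvd n - s \<Longrightarrow> rho \<alpha> (n + 2 * int k) = rho \<alpha> n"
  by (simp add: rho_def sieved_norm_period)

text \<open>The phase is chosen such that the contributions with a single reflection cancel.\<close>

lemma cmv_magic_formula:
  assumes q: "int k dvd q - s" "q \<in> {n - int k..<n}"
  shows "cnj phase * (cmv \<alpha> ^^ k) u n + phase * (cmv_inv \<alpha> ^^ k) u n =
     rho \<alpha> q * rho \<alpha> (q + int k) *
       (if odd n then phase * u (n + 2 * int k) + cnj phase * u (n - 2 * int k)
        else cnj phase * u (n + 2 * int k) + phase * u (n - 2 * int k))
     - 2 * of_real (cmod d) * u n"
proof -
  note dv = q(1) sieved_dvd_shift[OF sv q(1)]
  \<comment> \<open>The further edges in reach, \<open>q - k\<close> and \<open>q + 2 * k\<close>,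
    are translates of \<open>q + k\<close> and \<open>q\<close> by a period; their data are
    expressed through those two.\<close>
  have e: "q - int k + 2 * int k = q + int k" by simp
  define r t where "r = rho \<alpha> q" and "t = rho \<alpha> (q + int k)"
  define A B where "A = \<alpha> q" and "B = \<alpha> (q + int k)"
  have rt: "rho \<alpha> (q + 2 * int k) = r" "rho \<alpha> (q - int k) = t"
    using sieved_rho_period[OF dv(1)] sieved_rho_period[OF dv(3), unfolded e] by (simp_all add: r_def t_def)
  have A2: "phase * \<alpha> (q + 2 * int k) = cnj phase * A" using sieved_period[OF dv(1)] by (simp add: A_def)
  have B2: "cnj phase * \<alpha> (q - int k) = phase * B" using sieved_period[OF dv(3), unfolded e] by (simp add: B_def)
  have A3: "cnj phase * cnj (\<alpha> (q + 2 * int k)) = phase * cnj A" using arg_cong[OF A2, of cnj] by simp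
  have B3: "phase * cnj (\<alpha> (q - int k)) = cnj phase * cnj B" using arg_cong[OF B2, of cnj] by simp
  have AB: "cnj phase * (A * cnj B) = of_real (cmod d)" "phase * (cnj A * B) = of_real (cmod d)"
    using sieved_corr[OF sv dv(1)] phase(3,4) by (auto simp: A_def B_def)
  show ?thesis
  \<comment> \<open>An odd site is a right-mover for \<open>cmv \<alpha>\<close> and a left-mover
    for the inverse; at an even site the roles are exchanged, which conjugates the phases of the
    shifts.\<close>
  proof (cases "odd n")
    case True
    have par: "even_part u (2 * q + 1 - n) = u (2 * q + 1 - n)" "even_part u (2 * q + 2 * int k + 1 - n) = u (2 * q + 2 * int k + 1 - n)"
      "odd_part u n = u n" "odd_part u (n + 2 * int k) = u (n + 2 * int k)" "odd_part u (n - 2 * int k) = u (n - 2 * int k)"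
      using True by (simp_all add: odd_part_def even_part_def)
    have E: "(cmv \<alpha> ^^ k) u n = r * t * u (n - 2 * int k) - r * \<alpha> (q - int k) * u (2 * q + 1 - n)
        - A * t * u (2 * q + 2 * int k + 1 - n) - A * cnj B * u n"
      using walk_double_sieved(1)[OF sv q, of "odd_part u" "even_part u"] True
      unfolding walk_cmv fst_conv par by (simp add: odd_part_def rt r_def[symmetric] t_def[symmetric] A_def[symmetric] B_def[symmetric])
    have I: "(cmv_inv \<alpha> ^^ k) u n = t * r * u (n + 2 * int k) + t * \<alpha> (q + 2 * int k) * u (2 * q + 2 * int k + 1 - n)
        + B * r * u (2 * q + 1 - n) - B * cnj A * u n"
      using walk_double_sieved(2)[OF sieved_cnj[OF sv] q, of "even_part u" "odd_part u"] True
      unfolding walk_cmv_inv snd_conv par by (simp add: odd_part_def rt r_def[symmetric] t_def[symmetric] A_def[symmetric] B_def[symmetric])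
    have "cnj phase * (cmv \<alpha> ^^ k) u n + phase * (cmv_inv \<alpha> ^^ k) u n
        = r * t * (phase * u (n + 2 * int k) + cnj phase * u (n - 2 * int k))
        + r * (phase * B - cnj phase * \<alpha> (q - int k)) * u (2 * q + 1 - n)
        + t * (phase * \<alpha> (q + 2 * int k) - cnj phase * A) * u (2 * q + 2 * int k + 1 - n)
        - (cnj phase * (A * cnj B) + phase * (cnj A * B)) * u n"
      unfolding E I by (simp add: algebra_simps)
    then show ?thesis using True unfolding A2 B2 AB by (simp add: r_def t_def)
  next
    case False
    have par: "odd_part u (2 * q + 1 - n) = u (2 * q + 1 - n)" "odd_part u (2 * q + 2 * int k + 1 - n) = u (2 * q + 2 * int k + 1 - n)"
      "even_part u n = u n" "even_part u (n + 2 * int k) = u (n + 2 * int k)" "even_part u (n - 2 * int k) = u (n - 2 * int k)"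
      using False by (simp_all add: odd_part_def even_part_def)
    have E: "(cmv \<alpha> ^^ k) u n = t * r * u (n + 2 * int k) + t * cnj (\<alpha> (q + 2 * int k)) * u (2 * q + 2 * int k + 1 - n)
        + cnj B * r * u (2 * q + 1 - n) - cnj B * A * u n"
      using walk_double_sieved(2)[OF sv q, of "odd_part u" "even_part u"] False
      unfolding walk_cmv snd_conv par by (simp add: even_part_def rt r_def[symmetric] t_def[symmetric] A_def[symmetric] B_def[symmetric])
    have I: "(cmv_inv \<alpha> ^^ k) u n = r * t * u (n - 2 * int k) - r * cnj (\<alpha> (q - int k)) * u (2 * q + 1 - n)
        - cnj A * t * u (2 * q + 2 * int k + 1 - n) - cnj A * B * u n"
      using walk_double_sieved(1)[OF sieved_cnj[OF sv] q, of "even_part u" "odd_part u"] False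
      unfolding walk_cmv_inv fst_conv par by (simp add: even_part_def rt r_def[symmetric] t_def[symmetric] A_def[symmetric] B_def[symmetric])
    have "cnj phase * (cmv \<alpha> ^^ k) u n + phase * (cmv_inv \<alpha> ^^ k) u n
        = r * t * (cnj phase * u (n + 2 * int k) + phase * u (n - 2 * int k))
        + r * (cnj phase * cnj B - phase * cnj (\<alpha> (q - int k))) * u (2 * q + 1 - n)
        + t * (cnj phase * cnj (\<alpha> (q + 2 * int k)) - phase * cnj A) * u (2 * q + 2 * int k + 1 - n)
        - (cnj phase * (A * cnj B) + phase * (cnj A * B)) * u n"
      unfolding E I by (simp add: algebra_simps)
    then show ?thesis using False unfolding A3 B3 AB by (simp add: r_def t_def)
  qed
qed

end


section \<open>Gaps in the spectrum of sieved CMV matrices, and unimodular coefficients\<close>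

lemma bounded_on_ell2_funpow: "bounded_on_ell2 X \<Longrightarrow> bounded_on_ell2 (X ^^ k)"
proof (induction k)
  case 0
  then show ?case using bounded_on_ell2_id by (simp add: id_def)
next
  case (Suc k)
  then show ?case using bounded_on_ell2_compose[of X "X ^^ k"] by (simp add: comp_def)
qed

text \<open>\<open>S\<close> is the cofactor in the factorization of \<open>X ^ k - z ^ k\<close> by
  \<open>X - z\<close>, built by the recursion \<open>S \<mapsto> X S + z ^ k\<close> from
  \<open>k\<close> to \<open>Suc k\<close>.\<close>

lemma power_minus_scalar_factor:
  assumes X: "bounded_on_ell2 X"
  obtains S where "bounded_on_ell2 S" "\<And>u. S (X u - cscale z u) = (X ^^ k) u - cscale (z ^ k) u"
    "\<And>u. X (S u) - cscale z (S u) = (X ^^ k) u - cscale (z ^ k) u"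
proof -
  note X' = bounded_on_ell2D[OF X]
  have "\<exists>S. bounded_on_ell2 S \<and> (\<forall>u. S (X u - cscale z u) = (X ^^ k) u - cscale (z ^ k) u) \<and>
    (\<forall>u. X (S u) - cscale z (S u) = (X ^^ k) u - cscale (z ^ k) u)"
  proof (induction k)
    case 0
    have "bounded_on_ell2 (\<lambda>_. 0)" by (rule bounded_on_ell2I[where C = 0]) (simp_all only: ell2_zero ell2_norm_zero, auto simp: cscale_def fun_eq_iff)
    then show ?case by (intro exI[of _ "\<lambda>_. 0"]) (simp only: X'(5) cseq.scale_zero_right, simp)
  next
    case (Suc k)
    then obtain S where S: "bounded_on_ell2 S" "\<And>u. S (X u - cscale z u) = (X ^^ k) u - cscale (z ^ k) u"
      "\<And>u. X (S u) - cscale z (S u) = (X ^^ k) u - cscale (z ^ k) u" by blast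
    have b: "bounded_on_ell2 (\<lambda>u. X (S u) + cscale (z ^ k) u)"
      by (intro bounded_on_ell2_add bounded_on_ell2_compose[OF X S(1)] bounded_on_ell2_cscale bounded_on_ell2_id)
    have pow: "(X ^^ Suc k) u - cscale (z ^ Suc k) u = X ((X ^^ k) u - cscale (z ^ k) u) + cscale (z ^ k) (X u - cscale z u)" for u
      unfolding X'(3,4) by (simp add: cscale_def fun_eq_iff algebra_simps)
    have "X (S (X u - cscale z u)) + cscale (z ^ k) (X u - cscale z u) = (X ^^ Suc k) u - cscale (z ^ Suc k) u" for u
      unfolding S(2) pow ..
    moreover have "X (X (S u) + cscale (z ^ k) u) - cscale z (X (S u) + cscale (z ^ k) u) = (X ^^ Suc k) u - cscale (z ^ Suc k) u" for u
    proof -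
      have "X (X (S u) + cscale (z ^ k) u) - cscale z (X (S u) + cscale (z ^ k) u)
          = X (X (S u) - cscale z (S u)) + cscale (z ^ k) (X u - cscale z u)"
        unfolding X'(2,3,4) by (simp add: cscale_def fun_eq_iff algebra_simps)
      then show ?thesis unfolding S(3) pow .
    qed
    ultimately show ?case using b by blast
  qed
  then show ?thesis using that by blast
qed

lemma funpow_left_inverse:
  fixes f g :: "'a \<Rightarrow> 'a"
  assumes "\<And>u. g (f u) = u"
  shows "(g ^^ k) ((f ^^ k) u) = u"
proof (induction k)
  case (Suc k)
  have "(g ^^ Suc k) ((f ^^ Suc k) u) = (g ^^ k) (g (f ((f ^^ k) u)))" by (simp add: funpow_swap1)
  then show ?case unfolding assms Suc .
qed simp

lemma funpow_commute: "(\<And>u. g (f u) = f (g u)) \<Longrightarrow> g ((f ^^ k) u) = (f ^^ k) (g u)"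
  by (induction k) simp_all

context
  fixes k :: nat and s :: int and d :: complex and \<alpha> :: "int \<Rightarrow> complex"
  assumes sv: "sieved k s d \<alpha>" and ver: "verblunsky \<alpha>"
begin

lemma sieved_dvd_obtain:
  assumes "int k dvd n - s"
  obtains i where "n = s + int k * i"
proof -
  from assms obtain i where "n - s = int k * i" by (elim dvdE)
  then show ?thesis by (intro that[of i]) simp
qed

lemma sieved_rho_prod:
  assumes "int k dvd q - s"
  shows "rho \<alpha> q * rho \<alpha> (q + int k) = rho \<alpha> s * rho \<alpha> (s + int k)"
proof -
  have *: "rho \<alpha> (s + int k * i + int k) * rho \<alpha> (s + int k * i + int k + int k) = rho \<alpha> (s + int k * i) * rho \<alpha> (s + int k * i + int k)" for i
    using sieved_rho_period[OF sv, of "s + int k * i"] by (simp add: algebra_simps)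
  have "rho \<alpha> (s + int k * i) * rho \<alpha> (s + int k * i + int k) = rho \<alpha> s * rho \<alpha> (s + int k)" for i
  proof (induction i rule: int_induct[where k = 0])
    case (step1 i)
    then show ?case using *[of i] by (simp add: algebra_simps)
  next
    case (step2 i)
    then show ?case using *[of "i - 1"] by (simp add: algebra_simps)
  qed simp
  then show ?thesis using sieved_dvd_obtain[OF assms] by metis
qed

text \<open>Write \<open>E\<close> for the matrix and \<open>p\<close> for the phase. On the circle
  \<open>c = p * cnj (z ^ k)\<close> satisfies \<open>c * z ^ k = p\<close>, so the twisted sum of
  the powers of \<open>E\<close>, minus its value \<open>y\<close> at \<open>z\<close>, factors as
  \<open>(cnj p - c * E^-k) * (E^k - z^k)\<close>, and the last factor is divisible by
  \<open>E - z\<close>. By \<open>cmv_magic_formula\<close> the product couples only sites at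
  distance \<open>2 * k\<close>, and \<open>gap\<close> is diagonal dominance.\<close>

lemma sieved_resolvent:
  assumes z: "cmod z = 1"
    and gap: "2 * cmod (rho \<alpha> s * rho \<alpha> (s + int k)) < \<bar>2 * Re (cnj (phase d) * z ^ k) + 2 * cmod d\<bar>"
  shows "z \<in> resolvent_set ell2 (cmv \<alpha>)"
proof -
  let ?p = "phase d" and ?E = "cmv \<alpha>" and ?I = "cmv_inv \<alpha>"
  define \<kappa> where "\<kappa> = rho \<alpha> s * rho \<alpha> (s + int k)"
  define y where "y = complex_of_real (2 * Re (cnj ?p * z ^ k))"
  note E = bounded_cmv(1)[OF ver] and I = bounded_on_ell2_funpow[OF bounded_cmv(2)[OF ver], of k]
  note E' = bounded_on_ell2D[OF E] and I' = bounded_on_ell2D[OF I]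
  obtain S where S: "bounded_on_ell2 S" "\<And>u. S (?E u - cscale z u) = (?E ^^ k) u - cscale (z ^ k) u"
    "\<And>u. ?E (S u) - cscale z (S u) = (?E ^^ k) u - cscale (z ^ k) u"
    using power_minus_scalar_factor[OF E, of z k] by blast
  define c where "c = ?p * cnj (z ^ k)"
  have zk: "cnj (z ^ k) * z ^ k = 1" using z by (simp add: norm_power complex_norm_square[symmetric] mult.commute[of "cnj _"] flip: complex_cnj_power)
  have y: "y = cnj ?p * z ^ k + c"
    unfolding y_def c_def using complex_add_cnj[of "cnj ?p * z ^ k"] by simp
  have cz: "c * z ^ k = ?p" using zk by (simp add: c_def mult.assoc)
  have II: "(?I ^^ k) ((?E ^^ k) u) = u" for u
    by (rule funpow_left_inverse) (rule cmv_cmv_inv(2)[OF ver])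
  have comm: "?E ((?I ^^ k) u) = (?I ^^ k) (?E u)" for u
    by (rule funpow_commute) (simp add: cmv_cmv_inv[OF ver])
  define Q where "Q = (\<lambda>u. cscale (cnj ?p) (S u) - cscale c ((?I ^^ k) (S u)))"
  define T where "T = (\<lambda>u n. (\<kappa> * (if odd n then ?p else cnj ?p)) * u (n + 2 * int k)
      + (\<kappa> * (if odd n then cnj ?p else ?p)) * u (n - 2 * int k) + - (2 * of_real (cmod d) + y) * u n)"
  have T: "cscale (cnj ?p) ((?E ^^ k) u - cscale (z ^ k) u) - cscale c ((?I ^^ k) ((?E ^^ k) u - cscale (z ^ k) u)) = T u" for u
  proof
    fix n
    obtain q where q: "int k dvd q - s" "q \<in> {n - int k..<n}" by (rule sieved_wall[OF sv])
    have "(cscale (cnj ?p) ((?E ^^ k) u - cscale (z ^ k) u) - cscale c ((?I ^^ k) ((?E ^^ k) u - cscale (z ^ k) u))) n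
        = cnj ?p * (?E ^^ k) u n + (c * z ^ k) * (?I ^^ k) u n - (cnj ?p * z ^ k + c) * u n"
      unfolding I'(3,4) II by (simp add: cscale_def algebra_simps)
    also have "\<dots> = T u n"
      unfolding cz cmv_magic_formula[OF sv q] sieved_rho_prod[OF q(1)] y[symmetric] T_def \<kappa>_def[symmetric]
      by (simp add: algebra_simps)
    finally show "(cscale (cnj ?p) ((?E ^^ k) u - cscale (z ^ k) u) - cscale c ((?I ^^ k) ((?E ^^ k) u - cscale (z ^ k) u))) n = T u n" .
  qed
  have p1: "cmod ?p = 1" by (rule phase(2)[OF sv])
  have bnd: "cmod (\<kappa> * (if odd n then ?p else cnj ?p)) \<le> cmod \<kappa>" "cmod (\<kappa> * (if odd n then cnj ?p else ?p)) \<le> cmod \<kappa>" for n :: int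
    using p1 by (simp_all add: norm_mult)
  have "2 * of_real (cmod d) + y = of_real (2 * Re (cnj ?p * z ^ k) + 2 * cmod d)" by (simp add: y_def)
  then have dom: "2 * cmod \<kappa> < cmod (- (2 * of_real (cmod d) + y))"
    using gap by (simp only: norm_minus_cancel norm_of_real \<kappa>_def)
  show ?thesis
  proof (rule resolvent_setI[OF E, where Q = Q and T = T])
    show "bounded_on_ell2 Q"
      unfolding Q_def by (intro bounded_on_ell2_diff bounded_on_ell2_cscale S(1) bounded_on_ell2_compose[OF I S(1)])
    show "?E (Q u) - cscale z (Q u) = T u" for u
    proof -
      have "?E (Q u) - cscale z (Q u) = cscale (cnj ?p) (?E (S u) - cscale z (S u)) - cscale c ((?I ^^ k) (?E (S u) - cscale z (S u)))"
        unfolding Q_def E'(3,4) comm I'(3,4) by (simp add: cscale_def fun_eq_iff algebra_simps)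
      then show ?thesis unfolding S(3) T .
    qed
    show "Q (?E u - cscale z u) = T u" for u unfolding Q_def S(2) T ..
    show "\<exists>u\<in>ell2. T u = v" if "v \<in> ell2" for v
      unfolding T_def by (rule dominant_diagonal_surj[OF bnd dom that])
    show "ell2_norm u \<le> 1 / (cmod (- (2 * of_real (cmod d) + y)) - 2 * cmod \<kappa>) * ell2_norm (T u)" if "u \<in> ell2" for u
      unfolding T_def by (rule dominant_diagonal_bound[OF bnd dom that])
    show "0 \<le> 1 / (cmod (- (2 * of_real (cmod d) + y)) - 2 * cmod \<kappa>)" using dom by simp
  qed
qed

lemma sieved_unimodular_pure_point:
  assumes "cmod (\<alpha> m) = 1"
  shows "pure_point_spectrum ell2 (cmv \<alpha>)"
proof (rule cmv_block_pure_point[OF ver])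
  have k: "0 < k" by (rule sieved_pos[OF sv])
  have "\<alpha> m \<noteq> 0" using assms by auto
  then have m: "int k dvd m - s" using sieved_zero[OF sv] by blast
  have dvd: "int k dvd m + 2 * int k * i - s" for i
  proof -
    have "m + 2 * int k * i - s = (m - s) + int k * (2 * i)" by simp
    then show ?thesis using dvd_add[OF m dvd_triv_left] by (simp only:)
  qed
  have wall: "cmod (\<alpha> (m + 2 * int k * i)) = 1" for i
  proof (induction i rule: int_induct[where k = 0])
    case (step1 i)
    then show ?case using sieved_norm_period[OF sv dvd[of i]] by (simp add: algebra_simps)
  next
    case (step2 i)
    then show ?case using sieved_norm_period[OF sv dvd[of "i - 1"]] by (simp add: algebra_simps)
  qed (simp add: assms)
  fix n
  \<comment> \<open>Dividing \<open>n - 1 - m\<close> instead of \<open>n - m\<close> puts the left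
    wall strictly below \<open>n\<close> and the right wall at or above it, as blocks begin just
    after a wall.\<close>
  define i where "i = (n - 1 - m) div (2 * int k)"
  define r where "r = (n - 1 - m) mod (2 * int k)"
  have r: "0 \<le> r" "r < 2 * int k" using k by (simp_all add: r_def)
  have "n - 1 - m = 2 * int k * i + r" by (simp add: i_def r_def)
  then have "m + 2 * int k * i < n" "n \<le> m + 2 * int k * (i + 1)"
    using r by (simp_all add: algebra_simps)
  then show "\<exists>p q. p < n \<and> n \<le> q \<and> cmod (\<alpha> p) = 1 \<and> cmod (\<alpha> q) = 1"
    using wall by blast
qed

end


section \<open>Schur functions with given parameters\<close>

text \<open>The Schur algorithm read backwards: \<open>f\<^sub>n\<close> is
  \<open>mob (\<gamma> n)\<close> applied to \<open>z\<close> times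
  \<open>f\<^sub>n\<^sub>+\<^sub>1\<close>.\<close>

definition mob :: "complex \<Rightarrow> complex \<Rightarrow> complex" where
  "mob c w = (c + w) / (1 + cnj c * w)"

lemma mob_denom:
  assumes "cmod c < 1" "cmod w \<le> 1"
  shows "1 + cnj c * w \<noteq> 0" "1 - cnj c * w \<noteq> 0"
proof -
  have "cmod (cnj c * w) < 1"
    using assms mult_mono[of "cmod c" "cmod c" "cmod w" 1] by (simp add: norm_mult)
  then have "cnj c * w \<noteq> - 1" "cnj c * w \<noteq> 1" by (metis norm_minus_cancel norm_one less_irrefl)+
  then show "1 + cnj c * w \<noteq> 0" "1 - cnj c * w \<noteq> 0" by (auto simp: add_eq_0_iff)
qed

section \<open>Pseudohyperbolic distance on the closed disc\<close>

lemma mob_identities: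
  assumes c: "cmod c < 1" and a: "cmod a \<le> 1" and b: "cmod b \<le> 1"
  shows "mob c a - mob c b = (1 - c * cnj c) * (a - b) / ((1 + cnj c * a) * (1 + cnj c * b))"
    "1 - cnj (mob c a) * mob c b = (1 - c * cnj c) * (1 - cnj a * b) / (cnj (1 + cnj c * a) * (1 + cnj c * b))"
proof -
  note d = mob_denom(1)[OF c a] mob_denom(1)[OF c b]
  have d': "1 + c * cnj a \<noteq> 0" using d(1) by (metis complex_cnj_cnj complex_cnj_mult complex_cnj_one complex_cnj_add complex_cnj_zero)
  show "mob c a - mob c b = (1 - c * cnj c) * (a - b) / ((1 + cnj c * a) * (1 + cnj c * b))"
    unfolding mob_def diff_frac_eq[OF d] by (rule arg_cong2[where f = "(/)"]) (simp_all add: algebra_simps)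
  have "1 - cnj (mob c a) * mob c b = 1 - ((cnj c + cnj a) * (c + b)) / ((1 + c * cnj a) * (1 + cnj c * b))"
    by (simp add: mob_def)
  also have "\<dots> = (((1 + c * cnj a) * (1 + cnj c * b)) - (cnj c + cnj a) * (c + b)) / ((1 + c * cnj a) * (1 + cnj c * b))"
    using d d' by (simp add: diff_divide_distrib)
  also have "(1 + c * cnj a) * (1 + cnj c * b) - (cnj c + cnj a) * (c + b) = (1 - c * cnj c) * (1 - cnj a * b)"
    by (simp add: algebra_simps)
  finally show "1 - cnj (mob c a) * mob c b = (1 - c * cnj c) * (1 - cnj a * b) / (cnj (1 + cnj c * a) * (1 + cnj c * b))"
    by simp
qed

lemma one_minus_cnj_mult_norm:
  "(cmod (1 - cnj a * b))\<^sup>2 - (cmod (a - b))\<^sup>2 = (1 - (cmod a)\<^sup>2) * (1 - (cmod b)\<^sup>2)"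
  unfolding cmod_power2 by (simp add: power2_eq_square algebra_simps)

lemma norm_diff_le_norm_one_minus:
  assumes "cmod a \<le> 1" "cmod b \<le> 1"
  shows "cmod (a - b) \<le> cmod (1 - cnj a * b)"
proof -
  have "0 \<le> (1 - (cmod a)\<^sup>2) * (1 - (cmod b)\<^sup>2)" using assms by (simp add: power_le_one)
  then have "(cmod (a - b))\<^sup>2 \<le> (cmod (1 - cnj a * b))\<^sup>2" using one_minus_cnj_mult_norm[of a b] by linarith
  then show ?thesis by (rule power2_le_imp_le) simp
qed

lemma norm_mob_le:
  assumes "cmod c < 1" "cmod w \<le> 1"
  shows "cmod (mob c w) \<le> 1"
proof -
  have "cmod (c + w) \<le> cmod (1 + cnj c * w)"
    using norm_diff_le_norm_one_minus[of c "- w"] assms by simp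
  then show ?thesis using mob_denom(1)[OF assms] by (simp add: mob_def norm_divide)
qed

text \<open>Disc automorphisms preserve the pseudohyperbolic distance, the quotient of
  \<open>cmod (a - b)\<close> by \<open>cmod (1 - cnj a * b)\<close>. A bound on it is stated
  multiplied out, which covers boundary points where the denominator vanishes.\<close>

lemma mob_preserves:
  assumes "cmod c < 1" "cmod a \<le> 1" "cmod b \<le> 1" and le: "cmod (a - b) \<le> e * cmod (1 - cnj a * b)"
  shows "cmod (mob c a - mob c b) \<le> e * cmod (1 - cnj (mob c a) * mob c b)"
proof -
  define D where "D = cmod (1 - c * cnj c) / (cmod (1 + cnj c * a) * cmod (1 + cnj c * b))"
  have "cmod (mob c a - mob c b) = D * cmod (a - b)"
    unfolding mob_identities(1)[OF assms(1-3)] D_def by (simp add: norm_mult norm_divide)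
  also have "\<dots> \<le> D * (e * cmod (1 - cnj a * b))" by (intro mult_left_mono le) (simp add: D_def)
  also have "\<dots> = e * cmod (1 - cnj (mob c a) * mob c b)"
    unfolding mob_identities(2)[OF assms(1-3)] D_def norm_mult norm_divide complex_mod_cnj by simp
  finally show ?thesis .
qed

text \<open>The pseudohyperbolic distance of \<open>r\<close> and \<open>- r\<close>. It is the best
  contraction factor for multiplication by a number of modulus \<open>r\<close>, the extremal case
  being opposite points of the unit circle.\<close>

definition contr :: "real \<Rightarrow> real" where "contr r = 2 * r / (1 + r\<^sup>2)"

lemma contr_bounds: "0 \<le> r \<Longrightarrow> 0 \<le> contr r" "0 \<le> r \<Longrightarrow> r < 1 \<Longrightarrow> contr r < 1"
proof -
  have "0 < (1 - r)\<^sup>2" if "r < 1" using that by simp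
  then have "2 * r < 1 + r\<^sup>2" if "r < 1" using that by (simp add: power2_eq_square algebra_simps)
  then show "0 \<le> r \<Longrightarrow> r < 1 \<Longrightarrow> contr r < 1" by (simp add: contr_def add_pos_nonneg)
qed (simp add: contr_def)

lemma contr_mono:
  assumes "0 \<le> r" "r \<le> t" "t \<le> 1"
  shows "contr r \<le> contr t"
proof -
  have "r * t \<le> 1" using assms mult_mono[of r 1 t 1] by simp
  then have "0 \<le> (t - r) * (1 - r * t)" using assms by simp
  also have "\<dots> = t * (1 + r\<^sup>2) - r * (1 + t\<^sup>2)" by (simp add: power2_eq_square algebra_simps)
  finally have "r * (1 + t\<^sup>2) \<le> t * (1 + r\<^sup>2)" by simp
  moreover have "0 < 1 + r\<^sup>2" "0 < 1 + t\<^sup>2" by (simp_all add: add_pos_nonneg)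
  ultimately show ?thesis by (simp add: contr_def divide_le_eq pos_le_divide_eq mult.commute)
qed

text \<open>
  The Schwarz-Pick contraction of multiplication by \<open>z\<close>: write
  \<open>2 (1 - r\<^sup>2 t) = (1 + r\<^sup>2) (1 - t) + (1 - r\<^sup>2) (1 + t)\<close>, where the two summands make an angle
  of at most a right angle if \<open>\<bar>t\<bar> \<le> 1\<close>.
\<close>

lemma scale_contracts:
  assumes z: "cmod z < 1" and a: "cmod a \<le> 1" and b: "cmod b \<le> 1" and e: "0 \<le> e"
    and le: "cmod (a - b) \<le> e * cmod (1 - cnj a * b)"
  shows "cmod (z * a - z * b) \<le> contr (cmod z) * e * cmod (1 - cnj (z * a) * (z * b))"
proof -
  define r t where "r = cmod z" and "t = cnj a * b"
  have r: "0 \<le> r" "r < 1" using z by (auto simp: r_def)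
  have t: "cmod t \<le> 1" using a b mult_mono[of "cmod a" 1 "cmod b" 1] by (simp add: t_def norm_mult)
  have "(1 + r\<^sup>2) * cmod (1 - t) \<le> 2 * cmod (1 - of_real (r\<^sup>2) * t)"
  proof (rule power2_le_imp_le)
    have t2: "(Re t)\<^sup>2 + (Im t)\<^sup>2 \<le> 1" using t power_le_one[of "cmod t" 2] by (simp add: cmod_power2)
    have r2: "0 \<le> 1 - r\<^sup>2" using r by (simp add: power_le_one)
    have id: "(2 * cmod (1 - of_real (r\<^sup>2) * t))\<^sup>2 - ((1 + r\<^sup>2) * cmod (1 - t))\<^sup>2
        = (1 - r\<^sup>2)\<^sup>2 * ((1 + Re t)\<^sup>2 + (Im t)\<^sup>2) + 2 * (1 + r\<^sup>2) * (1 - r\<^sup>2) * (1 - ((Re t)\<^sup>2 + (Im t)\<^sup>2))"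
      unfolding power_mult_distrib cmod_power2 by (simp add: power2_eq_square algebra_simps)
    have "0 \<le> (1 - r\<^sup>2)\<^sup>2 * ((1 + Re t)\<^sup>2 + (Im t)\<^sup>2) + 2 * (1 + r\<^sup>2) * (1 - r\<^sup>2) * (1 - ((Re t)\<^sup>2 + (Im t)\<^sup>2))"
      by (intro add_nonneg_nonneg mult_nonneg_nonneg) (use r2 t2 in auto)
    then show "((1 + r\<^sup>2) * cmod (1 - t))\<^sup>2 \<le> (2 * cmod (1 - of_real (r\<^sup>2) * t))\<^sup>2" using id by linarith
  qed simp
  moreover have pos: "0 < 1 + r\<^sup>2" by (simp add: add_pos_nonneg)
  ultimately have key: "r * cmod (1 - t) \<le> contr r * cmod (1 - of_real (r\<^sup>2) * t)"
    using mult_left_mono[of "(1 + r\<^sup>2) * cmod (1 - t)" "2 * cmod (1 - of_real (r\<^sup>2) * t)" r] r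
    by (simp add: contr_def pos_le_divide_eq mult_ac)
  have "cmod (z * a - z * b) = r * cmod (a - b)"
    by (simp add: r_def flip: right_diff_distrib norm_mult)
  also have "\<dots> \<le> r * (e * cmod (1 - t))" using le r by (intro mult_left_mono) (auto simp: t_def)
  also have "\<dots> = e * (r * cmod (1 - t))" by simp
  also have "\<dots> \<le> e * (contr r * cmod (1 - of_real (r\<^sup>2) * t))" by (intro mult_left_mono key e)
  also have "of_real (r\<^sup>2) * t = cnj (z * a) * (z * b)"
    unfolding r_def complex_norm_square t_def by (simp add: mult_ac)
  finally show ?thesis by (simp add: r_def mult_ac)
qed

text \<open>Undoing a Schur step is multiplication by \<open>z\<close>, a contraction by
  \<open>contr (cmod z)\<close>, followed by an isometry of the pseudohyperbolic distance; at depth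
  \<open>N\<close> the distance is at most one. This single estimate yields both uniqueness and
  convergence.\<close>

lemma schur_iterates_close:
  assumes "cmod z < 1"
    and "\<And>n. n < N \<Longrightarrow> cmod (\<gamma> n) < 1"
    and "\<And>n. n < N \<Longrightarrow> A n = mob (\<gamma> n) (z * A (Suc n))" "\<And>n. n < N \<Longrightarrow> B n = mob (\<gamma> n) (z * B (Suc n))"
    and "\<And>n. n \<le> N \<Longrightarrow> cmod (A n) \<le> 1" "\<And>n. n \<le> N \<Longrightarrow> cmod (B n) \<le> 1"
  shows "cmod (A 0 - B 0) \<le> contr (cmod z) ^ N * cmod (1 - cnj (A 0) * B 0)"
  using assms(2-)
proof (induction N arbitrary: \<gamma> A B)
  case 0
  then show ?case using norm_diff_le_norm_one_minus by simp
next
  case (Suc N)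
  let ?e = "contr (cmod z) ^ N"
  have a: "cmod (A 1) \<le> 1" and b: "cmod (B 1) \<le> 1" using Suc.prems by auto
  have "cmod (A (Suc 0) - B (Suc 0)) \<le> ?e * cmod (1 - cnj (A (Suc 0)) * B (Suc 0))"
    by (rule Suc.IH[where A = "\<lambda>n. A (Suc n)" and B = "\<lambda>n. B (Suc n)" and \<gamma> = "\<lambda>n. \<gamma> (Suc n)"]) (use Suc.prems in auto)
  then have "cmod (z * A 1 - z * B 1) \<le> contr (cmod z) * ?e * cmod (1 - cnj (z * A 1) * (z * B 1))"
    using contr_bounds(1)[of "cmod z"] by (intro scale_contracts assms(1) a b) auto
  moreover have "cmod (z * A 1) \<le> 1" "cmod (z * B 1) \<le> 1"
    using a b assms(1) mult_mono[of "cmod z" 1 _ 1] by (auto simp: norm_mult)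
  ultimately show ?case
    using mob_preserves[of "\<gamma> 0" "z * A 1" "z * B 1"] Suc.prems by simp
qed

lemma schur_iterates_close':
  assumes "cmod z < 1"
    and "\<And>n. n < N \<Longrightarrow> cmod (\<gamma> n) < 1"
    and "\<And>n. n < N \<Longrightarrow> A n = mob (\<gamma> n) (z * A (Suc n))" "\<And>n. n < N \<Longrightarrow> B n = mob (\<gamma> n) (z * B (Suc n))"
    and "\<And>n. n \<le> N \<Longrightarrow> cmod (A n) \<le> 1" "\<And>n. n \<le> N \<Longrightarrow> cmod (B n) \<le> 1"
  shows "cmod (A 0 - B 0) \<le> 2 * contr (cmod z) ^ N"
proof -
  have "cmod (1 - cnj (A 0) * B 0) \<le> 2"
    using norm_triangle_ineq4[of 1 "cnj (A 0) * B 0"] mult_mono[of "cmod (A 0)" 1 "cmod (B 0)" 1] assms(5,6)[of 0]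
    by (simp add: norm_mult)
  then have "contr (cmod z) ^ N * cmod (1 - cnj (A 0) * B 0) \<le> contr (cmod z) ^ N * 2"
    using contr_bounds(1)[of "cmod z"] by (intro mult_left_mono) auto
  then show ?thesis using schur_iterates_close[where N = N and \<gamma> = \<gamma> and A = A and B = B, OF assms] by linarith
qed

lemma schur_iterates_unique:
  assumes "cmod z < 1" "\<And>n. cmod (\<gamma> n) < 1"
    and "\<And>n. A n = mob (\<gamma> n) (z * A (Suc n))" "\<And>n. B n = mob (\<gamma> n) (z * B (Suc n))"
    and "\<And>n. cmod (A n) \<le> 1" "\<And>n. cmod (B n) \<le> 1"
  shows "A 0 = B 0"
proof -
  have bound: "cmod (A 0 - B 0) \<le> 2 * contr (cmod z) ^ N" for N
    by (rule schur_iterates_close'[where \<gamma> = \<gamma> and A = A and B = B]) (rule assms)+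
  have "(\<lambda>N. 2 * contr (cmod z) ^ N) \<longlonglongrightarrow> 2 * 0"
    using contr_bounds[of "cmod z"] assms(1) by (intro tendsto_mult_left LIMSEQ_realpow_zero) auto
  then have "cmod (A 0 - B 0) \<le> 2 * 0" by (rule LIMSEQ_le_const) (use bound in blast)
  then show ?thesis by simp
qed

section \<open>Existence, by approximants in which the \<open>N\<close>-th Schur iterate is replaced
  by zero\<close>

fun schur_approx :: "nat \<Rightarrow> (nat \<Rightarrow> complex) \<Rightarrow> complex \<Rightarrow> complex" where
  "schur_approx 0 \<gamma> z = 0"
| "schur_approx (Suc N) \<gamma> z = mob (\<gamma> 0) (z * schur_approx N (\<lambda>n. \<gamma> (Suc n)) z)"

lemma norm_mult_le_1: "cmod z < 1 \<Longrightarrow> cmod w \<le> 1 \<Longrightarrow> cmod (z * w) \<le> 1"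
  using mult_mono[of "cmod z" 1 "cmod w" 1] by (simp add: norm_mult)

lemma norm_schur_approx_le:
  "(\<And>n. cmod (\<gamma> n) < 1) \<Longrightarrow> cmod z < 1 \<Longrightarrow> cmod (schur_approx N \<gamma> z) \<le> 1"
  by (induction N arbitrary: \<gamma>) (simp_all add: norm_mob_le norm_mult_le_1)

lemma schur_approx_close:
  assumes "\<And>n. cmod (\<gamma> n) < 1" "cmod z < 1" "N \<le> M"
  shows "cmod (schur_approx N \<gamma> z - schur_approx M \<gamma> z) \<le> 2 * contr (cmod z) ^ N"
proof -
  have "cmod (schur_approx (N - 0) (\<lambda>i. \<gamma> (i + 0)) z - schur_approx (M - 0) (\<lambda>i. \<gamma> (i + 0)) z) \<le> 2 * contr (cmod z) ^ N"
  proof (rule schur_iterates_close'[where \<gamma> = \<gamma> and A = "\<lambda>n. schur_approx (N - n) (\<lambda>i. \<gamma> (i + n)) z" and B = "\<lambda>n. schur_approx (M - n) (\<lambda>i. \<gamma> (i + n)) z"])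
    fix n assume "n < N"
    then have "N - n = Suc (N - Suc n)" "M - n = Suc (M - Suc n)" using assms(3) by auto
    then show "schur_approx (N - n) (\<lambda>i. \<gamma> (i + n)) z = mob (\<gamma> n) (z * schur_approx (N - Suc n) (\<lambda>i. \<gamma> (i + Suc n)) z)"
      "schur_approx (M - n) (\<lambda>i. \<gamma> (i + n)) z = mob (\<gamma> n) (z * schur_approx (M - Suc n) (\<lambda>i. \<gamma> (i + Suc n)) z)"
      by simp_all
  qed (use assms in \<open>auto intro: norm_schur_approx_le\<close>)
  then show ?thesis by simp
qed

lemma schur_approx_holomorphic:
  "(\<And>n. cmod (\<gamma> n) < 1) \<Longrightarrow> schur_approx N \<gamma> holomorphic_on ball 0 1"
proof (induction N arbitrary: \<gamma>)
  case 0
  have "schur_approx 0 \<gamma> = (\<lambda>_. 0)" by (simp add: fun_eq_iff)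
  then show ?case by simp
next
  case (Suc N)
  have eq: "schur_approx (Suc N) \<gamma> = (\<lambda>z. mob (\<gamma> 0) (z * schur_approx N (\<lambda>n. \<gamma> (Suc n)) z))"
    by (simp add: fun_eq_iff)
  have "1 + cnj (\<gamma> 0) * (z * schur_approx N (\<lambda>n. \<gamma> (Suc n)) z) \<noteq> 0" if "z \<in> ball 0 1" for z
    using that Suc.prems by (intro mob_denom norm_mult_le_1 norm_schur_approx_le) auto
  then show ?case unfolding eq mob_def
    by (intro holomorphic_intros Suc) (use Suc.prems in auto)
qed

definition schur_lim :: "(nat \<Rightarrow> complex) \<Rightarrow> complex \<Rightarrow> complex" where
  "schur_lim \<gamma> z = lim (\<lambda>N. schur_approx N \<gamma> z)"

context
  fixes \<gamma> :: "nat \<Rightarrow> complex"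
  assumes \<gamma>: "\<And>n. cmod (\<gamma> n) < 1"
begin

lemma schur_approx_tendsto:
  assumes z: "cmod z < 1"
  shows "(\<lambda>N. schur_approx N \<gamma> z) \<longlonglongrightarrow> schur_lim \<gamma> z"
proof -
  have lim0: "(\<lambda>N. 2 * contr (cmod z) ^ N) \<longlonglongrightarrow> 2 * 0"
    using contr_bounds[of "cmod z"] z by (intro tendsto_mult_left LIMSEQ_realpow_zero) auto
  have "Cauchy (\<lambda>N. schur_approx N \<gamma> z)"
  proof (rule CauchyI')
    fix e :: real assume "0 < e"
    then have "\<forall>\<^sub>F N in sequentially. 2 * contr (cmod z) ^ N < e"
      using order_tendstoD(2)[OF lim0] by simp
    then obtain N0 where N0: "\<And>N. N0 \<le> N \<Longrightarrow> 2 * contr (cmod z) ^ N < e" by (auto simp: eventually_sequentially)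
    show "\<exists>M. \<forall>m\<ge>M. \<forall>n>m. dist (schur_approx m \<gamma> z) (schur_approx n \<gamma> z) < e"
    proof (intro exI[of _ N0] allI impI)
      fix m n assume "N0 \<le> m" "m < n"
      then show "dist (schur_approx m \<gamma> z) (schur_approx n \<gamma> z) < e"
        using schur_approx_close[where \<gamma> = \<gamma>, OF \<gamma> z, of m n] N0[of m] by (simp add: dist_norm)
    qed
  qed
  then show ?thesis unfolding schur_lim_def by (simp add: Cauchy_convergent_iff convergent_LIMSEQ_iff)
qed

lemma norm_schur_lim_le: "cmod z < 1 \<Longrightarrow> cmod (schur_lim \<gamma> z) \<le> 1"
  by (rule tendsto_upperbound[OF tendsto_norm[OF schur_approx_tendsto]]) (auto simp: norm_schur_approx_le \<gamma>)

lemma schur_lim_holomorphic: "schur_lim \<gamma> holomorphic_on ball 0 1"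
proof (rule holomorphic_uniform_sequence[OF open_ball])
  show "schur_approx N \<gamma> holomorphic_on ball 0 1" for N by (rule schur_approx_holomorphic[OF \<gamma>])
  fix x :: complex assume "x \<in> ball 0 1"
  then obtain d where d: "0 < d" "cball x d \<subseteq> ball 0 1" by (meson open_ball open_contains_cball)
  define r where "r = cmod x + d"
  have "r < 1"
  proof (cases "x = 0")
    case True
    have "of_real d \<in> cball x d" using d(1) True by simp
    then have "complex_of_real d \<in> ball 0 1" using d(2) by blast
    then show ?thesis using True d(1) by (simp add: r_def)
  next
    case False
    \<comment> \<open>The point of the closed ball farthest from the origin; its modulus is
      \<open>r\<close>, so \<open>r < 1\<close> and the contraction is uniform on the ball.\<close>
    define y where "y = x + of_real (d / cmod x) * x"
    have "y \<in> cball x d" using d(1) False by (simp add: y_def dist_norm norm_mult norm_divide)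
    then have "cmod y < 1" using d(2) by auto
    moreover have "y = of_real (1 + d / cmod x) * x" by (simp add: y_def algebra_simps)
    then have "cmod y = (1 + d / cmod x) * cmod x" using d(1) by (simp only: norm_mult norm_of_real) simp
    then have "cmod y = r" using False by (simp add: r_def distrib_right)
    ultimately show ?thesis by simp
  qed
  moreover have "0 \<le> r" using d by (simp add: r_def)
  ultimately have lim0: "(\<lambda>N. 2 * contr r ^ N) \<longlonglongrightarrow> 2 * 0"
    using contr_bounds[of r] by (intro tendsto_mult_left LIMSEQ_realpow_zero) auto
  have bound: "cmod (schur_approx N \<gamma> z - schur_lim \<gamma> z) \<le> 2 * contr r ^ N" if "z \<in> cball x d" for N z
  proof -
    have z: "cmod z < 1" using that d by auto
    have zr: "cmod z \<le> r" using that norm_triangle_sub[of z x] by (simp add: r_def dist_norm norm_minus_commute)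
    have "(\<lambda>M. cmod (schur_approx N \<gamma> z - schur_approx M \<gamma> z)) \<longlonglongrightarrow> cmod (schur_approx N \<gamma> z - schur_lim \<gamma> z)"
      by (intro tendsto_intros schur_approx_tendsto z)
    moreover have "\<forall>\<^sub>F M in sequentially. cmod (schur_approx N \<gamma> z - schur_approx M \<gamma> z) \<le> 2 * contr (cmod z) ^ N"
      using eventually_ge_at_top[of N] by eventually_elim (rule schur_approx_close[where \<gamma> = \<gamma>, OF \<gamma> z])
    ultimately have "cmod (schur_approx N \<gamma> z - schur_lim \<gamma> z) \<le> 2 * contr (cmod z) ^ N"
      by (rule tendsto_upperbound) simp
    also have "\<dots> \<le> 2 * contr r ^ N"
      using contr_mono[OF _ zr] contr_bounds(1)[of "cmod z"] \<open>r < 1\<close> by (intro mult_left_mono power_mono) auto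
    finally show ?thesis .
  qed
  have "uniform_limit (cball x d) (\<lambda>N. schur_approx N \<gamma>) (schur_lim \<gamma>) sequentially"
    unfolding uniform_limit_iff
  proof (intro allI impI)
    fix e :: real assume "0 < e"
    then have "\<forall>\<^sub>F N in sequentially. 2 * contr r ^ N < e" using order_tendstoD(2)[OF lim0] by simp
    then show "\<forall>\<^sub>F N in sequentially. \<forall>z\<in>cball x d. dist (schur_approx N \<gamma> z) (schur_lim \<gamma> z) < e"
    proof eventually_elim
      case (elim N)
      show ?case
      proof
        fix z assume "z \<in> cball x d"
        then show "dist (schur_approx N \<gamma> z) (schur_lim \<gamma> z) < e"
          using bound[of z N] elim by (simp add: dist_norm)
      qed
    qed
  qed
  then show "\<exists>d>0. cball x d \<subseteq> ball 0 1 \<and> uniform_limit (cball x d) (\<lambda>N. schur_approx N \<gamma>) (schur_lim \<gamma>) sequentially"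
    using d by blast
qed

end

section \<open>Recursion and uniqueness for the limit, and its agreement with the chosen Schur
  function\<close>

lemma schur_lim_step:
  assumes \<gamma>: "\<And>n. cmod (\<gamma> n) < 1" and z: "cmod z < 1"
  shows "schur_lim \<gamma> z = mob (\<gamma> 0) (z * schur_lim (\<lambda>n. \<gamma> (Suc n)) z)"
proof -
  let ?g = "\<lambda>n. \<gamma> (Suc n)"
  have 1: "(\<lambda>N. schur_approx N ?g z) \<longlonglongrightarrow> schur_lim ?g z" using schur_approx_tendsto[of ?g z] \<gamma> z by blast
  have "1 + cnj (\<gamma> 0) * (z * schur_lim ?g z) \<noteq> 0"
    by (intro mob_denom norm_mult_le_1 norm_schur_lim_le \<gamma> z)
  then have "(\<lambda>N. mob (\<gamma> 0) (z * schur_approx N ?g z)) \<longlonglongrightarrow> mob (\<gamma> 0) (z * schur_lim ?g z)"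
    unfolding mob_def by (intro tendsto_intros 1)
  moreover have "(\<lambda>N. mob (\<gamma> 0) (z * schur_approx N ?g z)) \<longlonglongrightarrow> schur_lim \<gamma> z"
    using LIMSEQ_Suc[OF schur_approx_tendsto[of \<gamma> z]] \<gamma> z by simp
  ultimately show ?thesis by (rule LIMSEQ_unique[symmetric])
qed

lemma schur_lim_unique:
  assumes \<gamma>: "\<And>n. cmod (\<gamma> n) < 1" and z: "cmod z < 1"
    and A: "\<And>n. A n = mob (\<gamma> n) (z * A (Suc n))" "\<And>n. cmod (A n) \<le> 1"
  shows "A 0 = schur_lim \<gamma> z"
proof -
  have "A 0 = schur_lim (\<lambda>i. \<gamma> (i + 0)) z"
  proof (rule schur_iterates_unique[where z = z and \<gamma> = \<gamma> and A = A and B = "\<lambda>n. schur_lim (\<lambda>i. \<gamma> (i + n)) z", OF z \<gamma> A(1) _ A(2)])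
    show "schur_lim (\<lambda>i. \<gamma> (i + n)) z = mob (\<gamma> n) (z * schur_lim (\<lambda>i. \<gamma> (i + Suc n)) z)" for n
      using schur_lim_step[of "\<lambda>i. \<gamma> (i + n)" z] \<gamma> z by simp
    show "cmod (schur_lim (\<lambda>i. \<gamma> (i + n)) z) \<le> 1" for n by (rule norm_schur_lim_le) (rule \<gamma> z)+
  qed
  then show ?thesis by simp
qed

lemma mob_inverse:
  assumes c: "cmod c < 1" and w: "cmod w \<le> 1"
  shows "(mob c w - c) / (1 - cnj c * mob c w) = w"
proof -
  have d: "1 + cnj c * w \<noteq> 0" by (rule mob_denom[OF assms])
  have "(cmod c)\<^sup>2 < 1" using c by (simp add: power_less_one_iff)
  then have nz: "1 - c * cnj c \<noteq> 0" unfolding complex_norm_square[symmetric] by (metis eq_iff_diff_eq_0 less_irrefl of_real_1 of_real_eq_iff)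
  have "mob c w - c = (1 - c * cnj c) * w / (1 + cnj c * w)"
    using d by (simp add: mob_def field_simps)
  moreover have "1 - cnj c * mob c w = (1 - c * cnj c) / (1 + cnj c * w)"
    using d by (simp add: mob_def field_simps)
  ultimately show ?thesis using d nz by simp
qed

lemma schur_lim_parameters:
  assumes \<gamma>: "\<And>n. cmod (\<gamma> n) < 1"
  shows "schur_parameters (schur_lim \<gamma>) \<gamma>"
  unfolding schur_parameters_def
proof (intro exI[of _ "\<lambda>n. schur_lim (\<lambda>i. \<gamma> (i + n))"] conjI allI impI)
  fix n
  show "schur_function (schur_lim (\<lambda>i. \<gamma> (i + n)))"
    unfolding schur_function_def using schur_lim_holomorphic[of "\<lambda>i. \<gamma> (i + n)"] norm_schur_lim_le[of "\<lambda>i. \<gamma> (i + n)"] \<gamma> by auto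
  have step: "schur_lim (\<lambda>i. \<gamma> (i + n)) z = mob (\<gamma> n) (z * schur_lim (\<lambda>i. \<gamma> (i + Suc n)) z)" if "cmod z < 1" for z
    using schur_lim_step[of "\<lambda>i. \<gamma> (i + n)" z] \<gamma> that by simp
  show "schur_lim (\<lambda>i. \<gamma> (i + n)) 0 = \<gamma> n" using step[of 0] by (simp add: mob_def)
  have "z * schur_lim (\<lambda>i. \<gamma> (i + Suc n)) z
      = (schur_lim (\<lambda>i. \<gamma> (i + n)) z - \<gamma> n) / (1 - cnj (\<gamma> n) * schur_lim (\<lambda>i. \<gamma> (i + n)) z)" if "z \<in> ball 0 1" for z
  proof -
    have z: "cmod z < 1" using that by simp
    show ?thesis unfolding step[OF z]
      by (rule mob_inverse[symmetric]) (intro \<gamma> norm_mult_le_1 z norm_schur_lim_le)+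
  qed
  then show "if cmod (\<gamma> n) = 1 then \<forall>z\<in>ball 0 1. schur_lim (\<lambda>i. \<gamma> (i + n)) z = \<gamma> n
      else \<forall>z\<in>ball 0 1. z * schur_lim (\<lambda>i. \<gamma> (i + Suc n)) z
        = (schur_lim (\<lambda>i. \<gamma> (i + n)) z - \<gamma> n) / (1 - cnj (\<gamma> n) * schur_lim (\<lambda>i. \<gamma> (i + n)) z)"
    using \<gamma>[of n] by auto
qed simp

text \<open>The choice in \<open>schur_fun\<close> is legitimate because \<open>schur_lim\<close> is
  a solution. Any chosen solution has iterates obeying the backward recursion with values in the
  closed disc, so uniqueness identifies it.\<close>

lemma schur_fun_eq:
  assumes \<gamma>: "\<And>n. cmod (\<gamma> n) < 1" and z: "cmod z < 1"
  shows "schur_fun \<gamma> z = schur_lim \<gamma> z"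
proof -
  have "schur_parameters (schur_fun \<gamma>) \<gamma>"
    unfolding schur_fun_def by (rule someI[where P = "\<lambda>f. schur_parameters f \<gamma>"]) (rule schur_lim_parameters[OF \<gamma>])
  then obtain F where F: "F 0 = schur_fun \<gamma>"
    "\<And>n. (\<forall>k<n. cmod (\<gamma> k) < 1) \<longrightarrow>
           schur_function (F n) \<and> F n 0 = \<gamma> n \<and>
           (if cmod (\<gamma> n) = 1 then \<forall>z\<in>ball 0 1. F n z = \<gamma> n
            else \<forall>z\<in>ball 0 1. z * F (Suc n) z = (F n z - \<gamma> n) / (1 - cnj (\<gamma> n) * F n z))"
    unfolding schur_parameters_def by blast
  have le: "cmod (F n z) \<le> 1" and rec: "z * F (Suc n) z = (F n z - \<gamma> n) / (1 - cnj (\<gamma> n) * F n z)" for n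
    using F(2)[of n] \<gamma> z by (auto simp: schur_function_def less_le split: if_splits)
  have step: "F n z = mob (\<gamma> n) (z * F (Suc n) z)" for n
  proof -
    have c: "cmod (- \<gamma> n) < 1" using \<gamma> by simp
    have "z * F (Suc n) z = mob (- \<gamma> n) (F n z)" unfolding rec by (simp add: mob_def)
    then have "mob (\<gamma> n) (z * F (Suc n) z) = (mob (- \<gamma> n) (F n z) - (- \<gamma> n)) / (1 - cnj (- \<gamma> n) * mob (- \<gamma> n) (F n z))"
      by (simp add: mob_def[of "\<gamma> n"] add.commute)
    then show ?thesis using mob_inverse[OF c le] by simp
  qed
  have "F 0 z = schur_lim \<gamma> z"
    by (rule schur_lim_unique[where \<gamma> = \<gamma> and A = "\<lambda>n. F n z"]) (rule \<gamma> z step le)+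
  then show ?thesis unfolding F(1) .
qed

text \<open>Rotation commutes with the backward Schur step:
  \<open>mob (c * a) (c * w) = c * mob a w\<close>. This turns periodicity up to a phase of the
  coefficients into the same property of the Schur functions.\<close>

lemma schur_lim_phase:
  assumes \<gamma>: "\<And>n. cmod (\<gamma> n) < 1" and z: "cmod z < 1" and c: "cmod c = 1"
  shows "schur_lim (\<lambda>n. c * \<gamma> n) z = c * schur_lim \<gamma> z"
proof -
  have cc: "cnj c * c = 1" using c by (simp add: complex_norm_square[symmetric] mult.commute[of "cnj c"])
  have mob: "mob (c * a) (c * w) = c * mob a w" for a w
  proof -
    have "cnj (c * a) * (c * w) = (cnj c * c) * (cnj a * w)" by simp
    then show ?thesis unfolding mob_def cc by (simp add: distrib_left)
  qed
  have "c * schur_lim (\<lambda>i. \<gamma> (i + 0)) z = schur_lim (\<lambda>n. c * \<gamma> n) z"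
  proof (rule schur_lim_unique[where A = "\<lambda>n. c * schur_lim (\<lambda>i. \<gamma> (i + n)) z"])
    show "c * schur_lim (\<lambda>i. \<gamma> (i + n)) z = mob (c * \<gamma> n) (z * (c * schur_lim (\<lambda>i. \<gamma> (i + Suc n)) z))" for n
    proof -
      have "z * (c * schur_lim (\<lambda>i. \<gamma> (i + Suc n)) z) = c * (z * schur_lim (\<lambda>i. \<gamma> (i + Suc n)) z)" by simp
      then show ?thesis using schur_lim_step[of "\<lambda>i. \<gamma> (i + n)" z] \<gamma> z by (simp only: mob) simp
    qed
  qed (use \<gamma> z c norm_schur_lim_le[of "\<lambda>i. \<gamma> (i + _)" z] in \<open>auto simp: norm_mult\<close>)
  then show ?thesis by simp
qed


section \<open>Reflectionless CMV matrices\<close>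

lemma schur_plus_step:
  assumes "\<And>n. cmod (\<alpha> n) < 1" "cmod z < 1"
  shows "schur_plus \<alpha> n z = mob (\<alpha> n) (z * schur_plus \<alpha> (n + 1) z)"
proof -
  have "schur_plus \<alpha> n z = schur_lim (\<lambda>i. \<alpha> (n + int i)) z"
    "schur_plus \<alpha> (n + 1) z = schur_lim (\<lambda>i. \<alpha> (n + int (Suc i))) z"
    unfolding schur_plus_def using schur_fun_eq[of "\<lambda>i. \<alpha> (n + int i)" z] schur_fun_eq[of "\<lambda>i. \<alpha> (n + 1 + int i)" z] assms
    by (simp_all add: add.assoc)
  then show ?thesis using schur_lim_step[of "\<lambda>i. \<alpha> (n + int i)" z] assms by simp
qed

lemma schur_minus_step:
  assumes "\<And>n. cmod (\<alpha> n) < 1" "cmod z < 1"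
  shows "schur_minus \<alpha> (n + 1) z = mob (- cnj (\<alpha> n)) (z * schur_minus \<alpha> n z)"
proof -
  have "schur_minus \<alpha> (n + 1) z = schur_lim (\<lambda>i. - cnj (\<alpha> (n - int i))) z"
    unfolding schur_minus_def using schur_fun_eq[of "\<lambda>i. - cnj (\<alpha> (n - int i))" z] assms by simp
  moreover have "n - 1 - int i = n - int (Suc i)" for i by simp
  then have "schur_minus \<alpha> n z = schur_lim (\<lambda>i. - cnj (\<alpha> (n - int (Suc i)))) z"
    unfolding schur_minus_def using schur_fun_eq[of "\<lambda>i. - cnj (\<alpha> (n - 1 - int i))" z] assms by (simp only:) simp
  ultimately show ?thesis using schur_lim_step[of "\<lambda>i. - cnj (\<alpha> (n - int i))" z] assms by simp
qed

lemma norm_schur_plus_minus_le: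
  assumes "\<And>n. cmod (\<alpha> n) < 1" "cmod z < 1"
  shows "cmod (schur_plus \<alpha> n z) \<le> 1" "cmod (schur_minus \<alpha> n z) \<le> 1"
  unfolding schur_plus_def schur_minus_def
  using schur_fun_eq[of "\<lambda>i. \<alpha> (n + int i)" z] norm_schur_lim_le[of "\<lambda>i. \<alpha> (n + int i)" z]
    schur_fun_eq[of "\<lambda>i. - cnj (\<alpha> (n - 1 - int i))" z] norm_schur_lim_le[of "\<lambda>i. - cnj (\<alpha> (n - 1 - int i))" z] assms
  by simp_all

lemma schur_plus_phase:
  assumes "\<And>n. cmod (\<alpha> n) < 1" "cmod z < 1" "cmod c = 1" "\<And>n. \<alpha> (n + m) = c * \<alpha> n"
  shows "schur_plus \<alpha> (n + m) z = c * schur_plus \<alpha> n z"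
proof -
  have "(\<lambda>i. \<alpha> (n + m + int i)) = (\<lambda>i. c * \<alpha> (n + int i))"
    using assms(4)[of "n + int _"] by (simp add: add_ac)
  then show ?thesis unfolding schur_plus_def
    using schur_lim_phase[of "\<lambda>i. \<alpha> (n + int i)" z c] schur_fun_eq[of "\<lambda>i. \<alpha> (n + int i)" z]
      schur_fun_eq[of "\<lambda>i. c * \<alpha> (n + int i)" z] assms(1-3) by (simp add: norm_mult)
qed

text \<open>The parameters to the left enter conjugated, hence so does the phase.\<close>

lemma schur_minus_phase:
  assumes "\<And>n. cmod (\<alpha> n) < 1" "cmod z < 1" "cmod c = 1" "\<And>n. \<alpha> (n + m) = c * \<alpha> n"
  shows "schur_minus \<alpha> (n + m) z = cnj c * schur_minus \<alpha> n z"
proof -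
  have "- cnj (\<alpha> (n + m - 1 - int i)) = cnj c * - cnj (\<alpha> (n - 1 - int i))" for i
  proof -
    have "n + m - 1 - int i = (n - 1 - int i) + m" by simp
    then show ?thesis by (simp only: assms(4)) simp
  qed
  then show ?thesis unfolding schur_minus_def
    using schur_lim_phase[of "\<lambda>i. - cnj (\<alpha> (n - 1 - int i))" z "cnj c"] schur_fun_eq[of "\<lambda>i. - cnj (\<alpha> (n - 1 - int i))" z]
      schur_fun_eq[of "\<lambda>i. cnj c * - cnj (\<alpha> (n - 1 - int i))" z] assms(1-3) by (simp add: norm_mult)
qed

lemma mob_0 [simp]: "mob 0 w = w"
  by (simp add: mob_def)

lemma schur_plus_gap:
  assumes "\<And>n. cmod (\<alpha> n) < 1" "cmod z < 1" "\<And>i. i < j \<Longrightarrow> \<alpha> (n + int i) = 0"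
  shows "schur_plus \<alpha> n z = z ^ j * schur_plus \<alpha> (n + int j) z"
  using assms(3)
proof (induction j)
  case (Suc j)
  then have "schur_plus \<alpha> n z = z ^ j * schur_plus \<alpha> (n + int j) z" by simp
  also have "schur_plus \<alpha> (n + int j) z = z * schur_plus \<alpha> (n + int j + 1) z"
    using schur_plus_step[of \<alpha> z "n + int j"] Suc.prems[of j] assms(1,2) by simp
  finally show ?case by (simp add: add_ac mult_ac)
qed simp

lemma schur_minus_gap:
  assumes "\<And>n. cmod (\<alpha> n) < 1" "cmod z < 1" "\<And>i. i < j \<Longrightarrow> \<alpha> (n + int i) = 0"
  shows "schur_minus \<alpha> (n + int j) z = z ^ j * schur_minus \<alpha> n z"
  using assms(3)
proof (induction j)
  case (Suc j)
  have "schur_minus \<alpha> (n + int (Suc j)) z = schur_minus \<alpha> (n + int j + 1) z" by (simp add: add_ac)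
  also have "\<dots> = z * schur_minus \<alpha> (n + int j) z"
    using schur_minus_step[of \<alpha> z "n + int j"] Suc.prems[of j] assms(1,2) by simp
  finally show ?case using Suc by (simp add: mult_ac)
qed simp

text \<open>
  \<open>f\<^sub>+\<close> and \<open>1 / (z f\<^sub>-)\<close> are the two fixed points of the same
  Moebius transformation, the transfer map over one period.
\<close>

lemma schur_plus_quadratic:
  fixes b b' w \<zeta> x y :: complex
  assumes ww: "w * cnj w = 1" and dd: "cnj w * (b * cnj b') = w * (cnj b * b')"
    and b: "cmod b < 1" "cmod b' < 1" and \<zeta>: "cmod \<zeta> \<le> 1" and x: "cmod x \<le> 1" and y: "cmod y \<le> 1"
    and eqs: "x = mob b (\<zeta> * y)" "y = mob b' (\<zeta> * ((cnj w)\<^sup>2 * x))"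
  shows "cnj w * (cnj b * \<zeta>\<^sup>2 + cnj b' * \<zeta>) * x\<^sup>2 + (w - cnj w * \<zeta>\<^sup>2) * x - w * (\<zeta> * b' + b) = 0"
proof -
  define p where "p = (cnj w)\<^sup>2 * x"
  have "cmod w = 1" using ww by (metis complex_norm_square norm_ge_zero of_real_eq_1_iff power2_eq_1_iff abs_of_nonneg norm_one real_sqrt_abs real_sqrt_one)
  then have p: "cmod p \<le> 1" using x by (simp add: p_def norm_mult norm_power)
  have "cmod (\<zeta> * y) \<le> 1" "cmod (\<zeta> * p) \<le> 1"
    using mult_mono[of "cmod \<zeta>" 1 "cmod y" 1] mult_mono[of "cmod \<zeta>" 1 "cmod p" 1] \<zeta> y p by (auto simp: norm_mult)
  then have d: "1 + cnj b * (\<zeta> * y) \<noteq> 0" "1 + cnj b' * (\<zeta> * p) \<noteq> 0" using mob_denom b by auto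
  define D where "D = 1 + cnj b' * (\<zeta> * p)"
  have 1: "x * (1 + cnj b * (\<zeta> * y)) = b + \<zeta> * y" using d(1) eqs(1) by (simp add: mob_def)
  have 2: "y * D = b' + \<zeta> * p" using d(2) eqs(2) by (simp add: mob_def p_def D_def)
  have "x * (D + cnj b * \<zeta> * (b' + \<zeta> * p)) = b * D + \<zeta> * (b' + \<zeta> * p)"
    using arg_cong[OF 1, of "\<lambda>t. t * D"] unfolding 2[symmetric] by (simp add: algebra_simps)
  then have 3: "w * (x * (D + cnj b * \<zeta> * (b' + \<zeta> * p)) - (b * D + \<zeta> * (b' + \<zeta> * p))) = 0" by simp
  have wp: "w * p = cnj w * x" using ww by (simp add: p_def power2_eq_square flip: mult.assoc)
  have "w * (x * (D + cnj b * \<zeta> * (b' + \<zeta> * p)) - (b * D + \<zeta> * (b' + \<zeta> * p)))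
      = x * w + x * (cnj b' * \<zeta> * (w * p)) + x * \<zeta> * (w * (cnj b * b')) + x * (cnj b * \<zeta>\<^sup>2 * (w * p))
        - w * b - b * cnj b' * \<zeta> * (w * p) - \<zeta> * w * b' - \<zeta>\<^sup>2 * (w * p)"
    by (simp add: D_def algebra_simps power2_eq_square)
  also have "\<dots> = cnj w * (cnj b * \<zeta>\<^sup>2 + cnj b' * \<zeta>) * x\<^sup>2 + (w - cnj w * \<zeta>\<^sup>2) * x - w * (\<zeta> * b' + b)"
    unfolding wp dd[symmetric] by (simp add: algebra_simps power2_eq_square)
  finally show ?thesis using 3 by simp
qed

text \<open>\<open>v\<close> and \<open>u\<close> stand for \<open>z f\<^sub>-\<close> at two
  consecutive nonzero coefficients. The resulting coefficients are those of
  \<open>schur_plus_quadratic\<close> in reverse order, which makes a nonzero \<open>v\<close> the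
  reciprocal of a root there.\<close>

lemma schur_minus_quadratic:
  fixes b b' w \<zeta> v u :: complex
  assumes ww: "w * cnj w = 1" and dd: "cnj w * (b * cnj b') = w * (cnj b * b')"
    and b: "cmod b < 1" "cmod b' < 1" and v: "cmod v \<le> 1" and u: "cmod u \<le> 1"
    and eqs: "u = \<zeta> * mob (- cnj b) v" "w\<^sup>2 * v = \<zeta> * mob (- cnj b') u"
  shows "- w * (\<zeta> * b' + b) * v\<^sup>2 + (w - cnj w * \<zeta>\<^sup>2) * v + cnj w * (cnj b * \<zeta>\<^sup>2 + cnj b' * \<zeta>) = 0"
proof -
  have d: "1 - b * v \<noteq> 0" "1 - b' * u \<noteq> 0" using mob_denom(2)[of "cnj b" v] mob_denom(2)[of "cnj b'" u] b u v by auto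
  define D where "D = 1 - b * v"
  have 1: "u * D = \<zeta> * (v - cnj b)" using d(1) eqs(1) by (simp add: mob_def D_def)
  have 2: "w\<^sup>2 * v * (1 - b' * u) = \<zeta> * (u - cnj b')" using d(2) eqs(2) by (simp add: mob_def)
  have "w\<^sup>2 * v * (D - b' * (u * D)) = \<zeta> * (u * D - cnj b' * D)"
    using arg_cong[OF 2, of "\<lambda>t. t * D"] by (simp add: algebra_simps)
  then have 3: "cnj w * (w\<^sup>2 * v * (D - b' * (\<zeta> * (v - cnj b))) - \<zeta> * (\<zeta> * (v - cnj b) - cnj b' * D)) = 0"
    unfolding 1 by simp
  have "cnj w * (w\<^sup>2 * v * (D - b' * (\<zeta> * (v - cnj b))) - \<zeta> * (\<zeta> * (v - cnj b) - cnj b' * D))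
      = (w * cnj w) * w * v * (1 - b * v - b' * \<zeta> * v) + (w * cnj w) * \<zeta> * v * (w * (cnj b * b'))
        - cnj w * \<zeta> * (\<zeta> * v - \<zeta> * cnj b - cnj b') - \<zeta> * v * (cnj w * (b * cnj b'))"
    by (simp add: D_def algebra_simps power2_eq_square)
  also have "\<dots> = - w * (\<zeta> * b' + b) * v\<^sup>2 + (w - cnj w * \<zeta>\<^sup>2) * v + cnj w * (cnj b * \<zeta>\<^sup>2 + cnj b' * \<zeta>)"
    unfolding ww dd by (simp add: algebra_simps power2_eq_square)
  finally show ?thesis using 3 by simp
qed

text \<open>In the generic case \<open>P\<close> and \<open>1 / v\<close> are the two distinct roots
  of \<open>A * t\<^sup>2 + B * t + C\<close>. The conclusions are Vieta's formulas and the squared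
  quotient of the sum and the difference of the roots, cleared of divisions by \<open>A\<close> and
  \<open>v\<close>.\<close>

lemma reciprocal_roots:
  fixes A B C P v :: complex
  assumes P: "A * P\<^sup>2 + B * P + C = 0" and v: "C * v\<^sup>2 + B * v + A = 0" and ne: "P * v \<noteq> 1"
  shows "B * P = - C * (1 + P * v)" "B * v = - A * (1 + P * v)"
    "((1 + P * v) / (1 - P * v))\<^sup>2 * (B\<^sup>2 - 4 * A * C) = B\<^sup>2"
proof -
  have "(A * P - C * v) * (P * v - 1) = v * (A * P\<^sup>2 + B * P + C) - P * (C * v\<^sup>2 + B * v + A)"
    by (simp add: algebra_simps power2_eq_square)
  also have "\<dots> = 0" unfolding P v by simp
  finally have e: "A * P = C * v" using ne by simp
  have "A * P\<^sup>2 = C * v * P" unfolding e[symmetric] by (simp add: power2_eq_square)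
  then show 1: "B * P = - C * (1 + P * v)" using P by (simp add: algebra_simps add_eq_0_iff)
  have "C * v\<^sup>2 = A * P * v" unfolding e by (simp add: power2_eq_square)
  then show 2: "B * v = - A * (1 + P * v)" using v by (simp add: algebra_simps add_eq_0_iff)
  define g where "g = P * v"
  have 3: "B\<^sup>2 * g = A * C * (1 + g)\<^sup>2"
  proof -
    have "B\<^sup>2 * g = (B * P) * (B * v)" by (simp add: g_def power2_eq_square)
    then show ?thesis unfolding 1 2 g_def by (simp add: power2_eq_square)
  qed
  have "(1 + g)\<^sup>2 * (B\<^sup>2 - 4 * A * C) = B\<^sup>2 * (1 - g)\<^sup>2 + 4 * (B\<^sup>2 * g - A * C * (1 + g)\<^sup>2)"
    by (simp add: algebra_simps power2_eq_square)
  then have "(1 + g)\<^sup>2 * (B\<^sup>2 - 4 * A * C) = B\<^sup>2 * (1 - g)\<^sup>2" unfolding 3 by simp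
  moreover have "1 - g \<noteq> 0" using ne by (simp add: g_def)
  ultimately show "((1 + P * v) / (1 - P * v))\<^sup>2 * (B\<^sup>2 - 4 * A * C) = B\<^sup>2"
    unfolding g_def[symmetric] by (simp add: power_divide)
qed

lemma Re_cayley_pos:
  assumes "cmod g < 1"
  shows "0 < Re ((1 + g) / (1 - g))"
proof -
  have ne: "1 - g \<noteq> 0" using assms by auto
  have "(1 + g) / (1 - g) = (1 + g) * cnj (1 - g) / of_real ((cmod (1 - g))\<^sup>2)"
    unfolding complex_norm_square using ne by simp
  then have "Re ((1 + g) / (1 - g)) = Re ((1 + g) * cnj (1 - g)) / (cmod (1 - g))\<^sup>2"
    by (simp only: Re_divide_of_real)
  also have "Re ((1 + g) * cnj (1 - g)) = 1 - (cmod g)\<^sup>2"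
    unfolding cmod_power2 by (simp add: algebra_simps power2_eq_square)
  finally have eq: "Re ((1 + g) / (1 - g)) = (1 - (cmod g)\<^sup>2) / (cmod (1 - g))\<^sup>2" .
  have "(cmod g)\<^sup>2 < 1" using assms by (simp add: power_less_one_iff)
  then show ?thesis unfolding eq using ne by simp
qed

text \<open>
  On a band the squared Caratheodory function \<open>((1 + P v) / (1 - P v))\<^sup>2\<close> has a positive limit.
  Since the function itself has positive real part, its limit is determined, and with it those of
  \<open>P\<close> and \<open>v\<close>.
\<close>

lemma band_limit:
  fixes A B C P v :: "real \<Rightarrow> complex"
  assumes lim: "(A \<longlongrightarrow> A0) F" "(B \<longlongrightarrow> B0) F" "(C \<longlongrightarrow> C0) F"
    and ev: "\<forall>\<^sub>F r in F. A r * (P r)\<^sup>2 + B r * P r + C r = 0 \<and> C r * (v r)\<^sup>2 + B r * v r + A r = 0 \<and> cmod (P r * v r) < 1"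
    and A0: "A0 = - \<zeta>\<^sup>2 * cnj C0" and B0: "B0 = - \<zeta>\<^sup>2 * cnj B0" and \<zeta>: "\<zeta> \<noteq> 0"
    and band: "4 * (cmod C0)\<^sup>2 < (cmod B0)\<^sup>2"
  obtains p where "(P \<longlongrightarrow> p) F" "(v \<longlongrightarrow> cnj p) F"
proof -
  \<comment> \<open>The value of \<open>B\<^sup>2 / (B\<^sup>2 - 4 * A * C)\<close> at the band
    point: by the symmetries \<open>A0\<close> and \<open>B0\<close>, numerator and denominator
    share the factor \<open>- \<zeta>\<^sup>2\<close>, which leaves a positive quotient.\<close>
  define S where "S = (cmod B0)\<^sup>2 / ((cmod B0)\<^sup>2 - 4 * (cmod C0)\<^sup>2)"
  have B0nz: "B0 \<noteq> 0" using band by auto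
  have S: "0 < S" unfolding S_def using band B0nz by simp
  have disc: "B0\<^sup>2 - 4 * A0 * C0 = - \<zeta>\<^sup>2 * of_real ((cmod B0)\<^sup>2 - 4 * (cmod C0)\<^sup>2)"
  proof -
    have "B0\<^sup>2 - 4 * A0 * C0 = (- \<zeta>\<^sup>2 * cnj B0) * B0 - 4 * (- \<zeta>\<^sup>2 * cnj C0) * C0"
      using A0 B0 by (simp add: power2_eq_square)
    also have "\<dots> = - \<zeta>\<^sup>2 * (B0 * cnj B0 - 4 * (C0 * cnj C0))" by (simp add: algebra_simps)
    finally show ?thesis by (simp add: complex_norm_square[symmetric])
  qed
  have "complex_of_real ((cmod B0)\<^sup>2 - 4 * (cmod C0)\<^sup>2) \<noteq> 0" unfolding of_real_eq_0_iff using band by linarith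
  then have disc0: "B0\<^sup>2 - 4 * A0 * C0 \<noteq> 0" unfolding disc using \<zeta> by (simp only: mult_eq_0_iff neg_equal_0_iff_equal power_eq_0_iff) simp
  have "B0\<^sup>2 = (- \<zeta>\<^sup>2 * cnj B0) * B0" unfolding power2_eq_square[of B0] by (rule arg_cong[OF B0, of "\<lambda>x. x * B0"])
  also have "\<dots> = - \<zeta>\<^sup>2 * (B0 * cnj B0)" by simp
  also have "B0 * cnj B0 = of_real ((cmod B0)\<^sup>2)" by (rule complex_norm_square[symmetric])
  finally have B0sq: "B0\<^sup>2 = - \<zeta>\<^sup>2 * of_real ((cmod B0)\<^sup>2)" .
  have quot: "B0\<^sup>2 / (B0\<^sup>2 - 4 * A0 * C0) = of_real S"
    unfolding disc unfolding B0sq S_def of_real_divide by (rule mult_divide_mult_cancel_left) (use \<zeta> in simp)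
  define g where "g = (\<lambda>r. P r * v r)"
  define Q where "Q = (\<lambda>r. (1 + g r) / (1 - g r))"
  have limD: "((\<lambda>r. (B r)\<^sup>2 - 4 * A r * C r) \<longlongrightarrow> B0\<^sup>2 - 4 * A0 * C0) F" by (intro tendsto_intros lim)
  have evD: "\<forall>\<^sub>F r in F. (B r)\<^sup>2 - 4 * A r * C r \<noteq> 0" by (rule tendsto_imp_eventually_ne[OF limD disc0])
  have evB: "\<forall>\<^sub>F r in F. B r \<noteq> 0" by (rule tendsto_imp_eventually_ne[OF lim(2) B0nz])
  have "((\<lambda>r. (B r)\<^sup>2 / ((B r)\<^sup>2 - 4 * A r * C r)) \<longlongrightarrow> of_real S) F"
    unfolding quot[symmetric] by (intro tendsto_intros lim disc0)
  moreover have "isCont csqrt (of_real S)" by (rule continuous_at_csqrt) (use S in auto)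
  ultimately have "((\<lambda>r. csqrt ((B r)\<^sup>2 / ((B r)\<^sup>2 - 4 * A r * C r))) \<longlongrightarrow> csqrt (of_real S)) F"
    by (rule isCont_tendsto_compose[rotated])
  moreover have "\<forall>\<^sub>F r in F. csqrt ((B r)\<^sup>2 / ((B r)\<^sup>2 - 4 * A r * C r)) = Q r"
    using ev evD
  proof eventually_elim
    case (elim r)
    then have "P r * v r \<noteq> 1" by auto
    then have "(Q r)\<^sup>2 * ((B r)\<^sup>2 - 4 * A r * C r) = (B r)\<^sup>2"
      using reciprocal_roots(3)[of "A r" "P r" "B r" "C r" "v r"] elim by (simp add: Q_def g_def)
    then have "(B r)\<^sup>2 / ((B r)\<^sup>2 - 4 * A r * C r) = (Q r)\<^sup>2" using elim by (simp add: field_simps)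
    moreover have "0 < Re (Q r)" unfolding Q_def by (rule Re_cayley_pos) (use elim in \<open>simp add: g_def\<close>)
    ultimately show ?case by (simp add: csqrt_square)
  qed
  ultimately have Q: "(Q \<longlongrightarrow> csqrt (of_real S)) F" by (rule Lim_transform_eventually)
  define q where "q = sqrt S"
  have q: "0 < q" "csqrt (of_real S) = of_real q" using S by (simp_all add: q_def csqrt_of_real_nonneg)
  \<comment> \<open>The inverse Cayley transform of \<open>q\<close>, that is, the limit of
    \<open>P * v\<close>.\<close>
  define g0 where "g0 = (q - 1) / (q + 1)"
  have q1: "complex_of_real q + 1 \<noteq> 0" using q(1) by (metis add_pos_pos less_irrefl of_real_1 of_real_add of_real_eq_0_iff zero_less_one)
  have "((\<lambda>r. (Q r - 1) / (Q r + 1)) \<longlongrightarrow> (of_real q - 1) / (of_real q + 1)) F"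
    using Q unfolding q(2) by (intro tendsto_intros q1)
  moreover have "\<forall>\<^sub>F r in F. (Q r - 1) / (Q r + 1) = g r"
    using ev
  proof eventually_elim
    case (elim r)
    then have "1 - g r \<noteq> 0" by (auto simp: g_def)
    then have "Q r - 1 = 2 * g r / (1 - g r)" "Q r + 1 = 2 / (1 - g r)" by (simp_all add: Q_def field_simps)
    then show ?case using \<open>1 - g r \<noteq> 0\<close> by simp
  qed
  ultimately have "(g \<longlongrightarrow> (of_real q - 1) / (of_real q + 1)) F" by (rule Lim_transform_eventually)
  then have g: "(g \<longlongrightarrow> of_real g0) F" by (simp add: g0_def)
  have limP: "((\<lambda>r. - C r * (1 + g r) / B r) \<longlongrightarrow> - C0 * (1 + of_real g0) / B0) F"
    by (intro tendsto_intros lim g B0nz)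
  have limv: "((\<lambda>r. - A r * (1 + g r) / B r) \<longlongrightarrow> - A0 * (1 + of_real g0) / B0) F"
    by (intro tendsto_intros lim g B0nz)
  have PC: "\<forall>\<^sub>F r in F. - C r * (1 + g r) / B r = P r" and vA: "\<forall>\<^sub>F r in F. - A r * (1 + g r) / B r = v r"
    using ev evB
  proof (eventually_elim)
    case (elim r)
    then have "P r * v r \<noteq> 1" by auto
    then show "- C r * (1 + g r) / B r = P r"
      using reciprocal_roots(1)[of "A r" "P r" "B r" "C r" "v r"] elim by (simp add: g_def field_simps)
  next
    show "\<forall>\<^sub>F r in F. - A r * (1 + g r) / B r = v r"
      using ev evB
    proof eventually_elim
      case (elim r)
      then have "P r * v r \<noteq> 1" by auto
      then show ?case
        using reciprocal_roots(2)[of "A r" "P r" "B r" "C r" "v r"] elim by (simp add: g_def field_simps)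
    qed
  qed
  define p where "p = - C0 * (1 + of_real g0) / B0"
  \<comment> \<open>The same symmetries turn the limit of \<open>v\<close> into the conjugate of the
    limit of \<open>P\<close>; this is the reflectionless identity at the point.\<close>
  have "- A0 * (1 + of_real g0) / B0 = (\<zeta>\<^sup>2 * cnj C0 * (1 + of_real g0)) / (- \<zeta>\<^sup>2 * cnj B0)"
    using A0 B0 by simp
  also have "\<dots> = cnj p" using \<zeta> by (simp add: p_def)
  finally have "(v \<longlongrightarrow> cnj p) F" using Lim_transform_eventually[OF limv vA] by simp
  moreover have "(P \<longlongrightarrow> p) F" using Lim_transform_eventually[OF limP PC] by (simp add: p_def)
  ultimately show ?thesis using that by blast
qed

text \<open>Links the two sides of the argument: the left is the quantity in
  \<open>band_limit\<close>, the right, with \<open>\<delta> = cmod d\<close>, the difference of the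
  squares compared in \<open>sieved_resolvent\<close>. The band hypothesis thus holds where the gap
  inequality is strictly reversed.\<close>

lemma band_discriminant:
  fixes b b' w \<zeta> :: complex
  assumes w: "cmod w = 1" and \<zeta>: "cmod \<zeta> = 1" and d: "cnj w * (b * cnj b') = of_real \<delta>"
  shows "(cmod (w - cnj w * \<zeta>\<^sup>2))\<^sup>2 - 4 * (cmod (- w * (\<zeta> * b' + b)))\<^sup>2
    = 4 * ((1 - (cmod b)\<^sup>2) * (1 - (cmod b')\<^sup>2)) - (2 * Re (cnj w * \<zeta>) + 2 * \<delta>)\<^sup>2"
proof -
  define c where "c = cnj w * \<zeta>"
  have zz: "\<zeta> * cnj \<zeta> = 1" and ww: "w * cnj w = 1"
    using w \<zeta> by (simp_all add: complex_norm_square[symmetric])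
  have "\<zeta> * (cnj c - c) = (\<zeta> * cnj \<zeta>) * w - cnj w * \<zeta>\<^sup>2"
    by (simp add: c_def algebra_simps power2_eq_square)
  then have "w - cnj w * \<zeta>\<^sup>2 = \<zeta> * (cnj c - c)" unfolding zz by simp
  then have "(cmod (w - cnj w * \<zeta>\<^sup>2))\<^sup>2 = (cmod (cnj c - c))\<^sup>2" using \<zeta> by (simp add: norm_mult)
  also have "\<dots> = 4 * (Im c)\<^sup>2" unfolding cmod_power2 by (simp add: power2_eq_square)
  also have "\<dots> = 4 - 4 * (Re c)\<^sup>2"
  proof -
    have "cmod c = 1" using w \<zeta> by (simp add: c_def norm_mult)
    then have "(Re c)\<^sup>2 + (Im c)\<^sup>2 = 1" using cmod_power2[of c] by simp
    then show ?thesis by simp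
  qed
  finally have 1: "(cmod (w - cnj w * \<zeta>\<^sup>2))\<^sup>2 = 4 - 4 * (Re c)\<^sup>2" .
  have "cnj (cnj w * (b * cnj b')) = of_real \<delta>" unfolding d by simp
  then have wb: "w * (cnj b * b') = of_real \<delta>" by simp
  have "cnj b * b' = (w * cnj w) * (cnj b * b')" unfolding ww by simp
  also have "\<dots> = cnj w * (w * (cnj b * b'))" by (simp only: mult_ac)
  finally have bb: "cnj b * b' = cnj w * of_real \<delta>" unfolding wb .
  have "(cmod (- w * (\<zeta> * b' + b)))\<^sup>2 = (cmod (\<zeta> * b' + b))\<^sup>2" using w by (simp add: norm_mult)
  also have "\<dots> = (cmod (\<zeta> * b'))\<^sup>2 + (cmod b)\<^sup>2 + 2 * Re (\<zeta> * b' * cnj b)"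
    unfolding cmod_power2 by (simp add: algebra_simps power2_eq_square)
  also have "\<zeta> * b' * cnj b = c * of_real \<delta>" using bb by (simp add: c_def mult_ac)
  finally have 2: "(cmod (- w * (\<zeta> * b' + b)))\<^sup>2 = (cmod b')\<^sup>2 + (cmod b)\<^sup>2 + 2 * Re c * \<delta>"
    using \<zeta> by (simp add: norm_mult)
  have "cmod (cnj w * (b * cnj b')) = \<bar>\<delta>\<bar>" unfolding d by simp
  then have "cmod b * cmod b' = \<bar>\<delta>\<bar>" using w by (simp add: norm_mult)
  then have "(cmod b)\<^sup>2 * (cmod b')\<^sup>2 = \<delta>\<^sup>2" by (metis power_mult_distrib power2_abs)
  then show ?thesis unfolding 1 2 c_def[symmetric] by (simp add: algebra_simps power2_eq_square)
qed

section \<open>Boundary values on the bands of a sieved matrix\<close>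

context
  fixes k :: nat and s :: int and d :: complex and \<alpha> :: "int \<Rightarrow> complex"
  assumes sv: "sieved k s d \<alpha>" and lt1: "\<And>n. cmod (\<alpha> n) < 1"
begin

lemma sieved_shift_all: "\<alpha> (n + 2 * int k) = (cnj (phase d))\<^sup>2 * \<alpha> n"
proof (cases "int k dvd n - s")
  case True
  have "\<alpha> (n + 2 * int k) = (phase d * cnj (phase d)) * \<alpha> (n + 2 * int k)" unfolding phase(1)[OF sv] by simp
  also have "\<dots> = cnj (phase d) * (phase d * \<alpha> (n + 2 * int k))" by (simp add: mult_ac)
  finally show ?thesis unfolding sieved_period[OF sv True] by (simp add: power2_eq_square mult_ac)
next
  case False
  have "\<not> int k dvd n + 2 * int k - s"
  proof
    assume "int k dvd n + 2 * int k - s"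
    from sieved_dvd_shift(2)[OF sv sieved_dvd_shift(2)[OF sv this]] have "int k dvd n - s" by (simp add: algebra_simps)
    then show False using False by blast
  qed
  then show ?thesis using sieved_zero[OF sv] False by simp
qed

lemma sieved_gap_zero:
  assumes "int k dvd q - s" "0 < i" "i < k"
  shows "\<alpha> (q + int i) = 0"
proof (rule spacedD[OF sieved_spaced[OF sv] sieved_nonzero[OF sv assms(1)]])
  show "q \<noteq> q + int i" "\<bar>q - (q + int i)\<bar> < int k" using assms by auto
qed

text \<open>One period contains two scatterers, at \<open>q\<close> and \<open>q + k\<close>, and
  from each to the next a factor \<open>z ^ k\<close> accrues. Translation by the period multiplies
  the Schur functions by unimodular constants, which closes the two steps into an equation for one
  unknown.\<close>

lemma sieved_schur_equations:
  assumes z: "cmod z < 1" and q: "int k dvd q - s"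
  defines "P \<equiv> schur_plus \<alpha> q z" and "v \<equiv> z * schur_minus \<alpha> q z" and "w \<equiv> phase d"
  shows "cnj w * (cnj (\<alpha> q) * (z ^ k)\<^sup>2 + cnj (\<alpha> (q + int k)) * z ^ k) * P\<^sup>2 + (w - cnj w * (z ^ k)\<^sup>2) * P
      + - w * (z ^ k * \<alpha> (q + int k) + \<alpha> q) = 0" (is ?P)
    "- w * (z ^ k * \<alpha> (q + int k) + \<alpha> q) * v\<^sup>2 + (w - cnj w * (z ^ k)\<^sup>2) * v
      + cnj w * (cnj (\<alpha> q) * (z ^ k)\<^sup>2 + cnj (\<alpha> (q + int k)) * z ^ k) = 0" (is ?v)
    "cmod (P * v) < 1"
proof -
  have k: "k = Suc (k - 1)" using sieved_pos[OF sv] by simp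
  have ks: "z * z ^ (k - 1) = z ^ k" using k by (metis power_Suc)
  note le = norm_schur_plus_minus_le[where \<alpha> = \<alpha>, OF lt1 z]
  have w1: "cmod w = 1" "w * cnj w = 1" using phase(1,2)[OF sv] by (simp_all add: w_def)
  have corr: "\<alpha> q * cnj (\<alpha> (q + int k)) = d" by (rule sieved_corr[OF sv q])
  have "cnj (\<alpha> q) * \<alpha> (q + int k) = cnj d" using arg_cong[OF corr, of cnj] by simp
  then have dd: "cnj w * (\<alpha> q * cnj (\<alpha> (q + int k))) = w * (cnj (\<alpha> q) * \<alpha> (q + int k))"
    unfolding corr w_def using phase(3,4)[OF sv] by simp
  have zk: "cmod (z ^ k) \<le> 1" using z by (simp add: norm_power power_le_one)
  have plus: "schur_plus \<alpha> p z = mob (\<alpha> p) (z ^ k * schur_plus \<alpha> (p + int k) z)" if "int k dvd p - s" for p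
  proof -
    have "schur_plus \<alpha> (p + 1) z = z ^ (k - 1) * schur_plus \<alpha> (p + 1 + int (k - 1)) z"
      by (rule schur_plus_gap[where \<alpha> = \<alpha>, OF lt1 z]) (use sieved_gap_zero[OF that, of "Suc _"] in \<open>simp add: algebra_simps\<close>)
    moreover have "p + 1 + int (k - 1) = p + int k" using sieved_pos[OF sv] by simp
    ultimately have "z * schur_plus \<alpha> (p + 1) z = z ^ k * schur_plus \<alpha> (p + int k) z" unfolding ks[symmetric] by simp
    then show ?thesis using schur_plus_step[where \<alpha> = \<alpha>, OF lt1 z, of p] by simp
  qed
  have minus: "z * schur_minus \<alpha> (p + int k) z = z ^ k * mob (- cnj (\<alpha> p)) (z * schur_minus \<alpha> p z)" if "int k dvd p - s" for p
  proof -
    have "schur_minus \<alpha> (p + 1 + int (k - 1)) z = z ^ (k - 1) * schur_minus \<alpha> (p + 1) z"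
      by (rule schur_minus_gap[where \<alpha> = \<alpha>, OF lt1 z]) (use sieved_gap_zero[OF that, of "Suc _"] in \<open>simp add: algebra_simps\<close>)
    moreover have "p + 1 + int (k - 1) = p + int k" using sieved_pos[OF sv] by simp
    ultimately show ?thesis using schur_minus_step[where \<alpha> = \<alpha>, OF lt1 z, of p] unfolding ks[symmetric] by simp
  qed
  note q' = sieved_dvd_shift(1)[OF sv q]
  have kk: "q + int k + int k = q + 2 * int k" by simp
  have c: "cmod ((cnj w)\<^sup>2) = 1" using w1 by (simp add: norm_power)
  have per: "schur_plus \<alpha> (q + 2 * int k) z = (cnj w)\<^sup>2 * P" "schur_minus \<alpha> (q + 2 * int k) z = w\<^sup>2 * schur_minus \<alpha> q z"
    using schur_plus_phase[where \<alpha> = \<alpha>, OF lt1 z c, of "2 * int k" q] schur_minus_phase[where \<alpha> = \<alpha>, OF lt1 z c, of "2 * int k" q] sieved_shift_all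
    by (simp_all add: w_def P_def)
  have "P = mob (\<alpha> q) (z ^ k * schur_plus \<alpha> (q + int k) z)"
    "schur_plus \<alpha> (q + int k) z = mob (\<alpha> (q + int k)) (z ^ k * ((cnj w)\<^sup>2 * P))"
    using plus[OF q] plus[OF q'] unfolding kk per by (simp_all add: P_def)
  from schur_plus_quadratic[OF w1(2) dd lt1 lt1 zk _ le(1) this]
  show ?P using le(1)[of q] by (simp add: P_def)
  have vle: "cmod (z * schur_minus \<alpha> p z) \<le> 1" for p by (rule norm_mult_le_1[OF z le(2)])
  have "z * schur_minus \<alpha> (q + int k) z = z ^ k * mob (- cnj (\<alpha> q)) v"
    "w\<^sup>2 * v = z ^ k * mob (- cnj (\<alpha> (q + int k))) (z * schur_minus \<alpha> (q + int k) z)"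
    using minus[OF q] minus[OF q'] unfolding kk per by (simp_all add: v_def mult_ac)
  from schur_minus_quadratic[OF w1(2) dd lt1 lt1 _ vle this]
  show ?v using vle[of q] by (simp add: v_def)
  have "cmod (schur_plus \<alpha> q z * schur_minus \<alpha> q z) \<le> 1"
    using mult_mono[OF le(1) le(2), of q q] by (simp add: norm_mult)
  then have "cmod z * cmod (schur_plus \<alpha> q z * schur_minus \<alpha> q z) \<le> cmod z * 1" by (rule mult_left_mono) simp
  moreover have "cmod (P * v) = cmod z * cmod (schur_plus \<alpha> q z * schur_minus \<alpha> q z)" by (simp add: P_def v_def norm_mult)
  ultimately show "cmod (P * v) < 1" using z by linarith
qed

text \<open>The limits are found at the first nonzero coefficient \<open>q\<close> at or to the
  right of \<open>n\<close> and then carried back. Between \<open>n\<close> and \<open>q\<close> the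
  two Schur functions change only by powers of \<open>z\<close>, and these match in the
  reflectionless identity since \<open>z\<close> is unimodular on the boundary.\<close>

lemma sieved_reflection_at_band_point:
  fixes t :: real
  assumes band: "\<bar>2 * Re (cnj (phase d) * cis t ^ k) + 2 * cmod d\<bar> < 2 * cmod (rho \<alpha> s * rho \<alpha> (s + int k))"
  shows "\<exists>p m. ((\<lambda>r. schur_plus \<alpha> n (of_real r * cis t)) \<longlongrightarrow> p) (at_left 1) \<and>
     ((\<lambda>r. schur_minus \<alpha> n (of_real r * cis t)) \<longlongrightarrow> m) (at_left 1) \<and> cis t * p = cnj m"
proof -
  have ver: "verblunsky \<alpha>" using lt1 by (simp add: verblunsky_def less_imp_le)
  obtain q where q: "int k dvd q - s" "q \<in> {n + int k - int k..<n + int k}" by (rule sieved_wall[OF sv, of "n + int k"])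
  define j where "j = nat (q - n)"
  have j: "q = n + int j" "j < k" using q(2) by (auto simp: j_def)
  have gap: "\<alpha> (n + int i) = 0" if "i < j" for i
    by (rule spacedD[OF sieved_spaced[OF sv] sieved_nonzero[OF sv q(1)]]) (use that j in auto)
  let ?w = "phase d" and ?z = "\<lambda>r. complex_of_real r * cis t"
  define \<zeta> where "\<zeta> = cis t ^ k"
  have z0: "((\<lambda>r. ?z r) \<longlongrightarrow> of_real 1 * cis t) (at_left 1)" by (intro tendsto_intros)
  then have z1: "((\<lambda>r. ?z r) \<longlongrightarrow> cis t) (at_left 1)" by simp
  then have zk: "((\<lambda>r. ?z r ^ k) \<longlongrightarrow> \<zeta>) (at_left 1)" unfolding \<zeta>_def by (rule tendsto_power)
  have ev: "\<forall>\<^sub>F r in at_left (1::real). 0 < r \<and> r < 1"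
    using eventually_at_left_real[of 0 1] by simp
  define a b where "a = \<alpha> q" and "b = \<alpha> (q + int k)"
  define A B C where "A = (\<lambda>\<zeta>. cnj ?w * (cnj a * \<zeta>\<^sup>2 + cnj b * \<zeta>))" and "B = (\<lambda>\<zeta>. ?w - cnj ?w * \<zeta>\<^sup>2)"
    and "C = (\<lambda>\<zeta>. - ?w * (\<zeta> * b + a))"
  have \<zeta>1: "cmod \<zeta> = 1" by (simp add: \<zeta>_def norm_power)
  have \<zeta>c: "\<zeta> * cnj \<zeta> = 1" using \<zeta>1 by (simp add: complex_norm_square[symmetric])
  have w1: "cmod ?w = 1" by (rule phase(2)[OF sv])
  have ab: "cnj ?w * (a * cnj b) = of_real (cmod d)"
    unfolding a_def b_def sieved_corr[OF sv q(1)] by (rule phase(3)[OF sv])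
  have ab1: "(cmod a)\<^sup>2 < 1" "(cmod b)\<^sup>2 < 1" using lt1 by (simp_all add: a_def b_def power_less_one_iff)
  have "rho \<alpha> s * rho \<alpha> (s + int k) = rho \<alpha> q * rho \<alpha> (q + int k)" by (rule sieved_rho_prod[OF sv ver q(1), symmetric])
  then have "(cmod (rho \<alpha> s * rho \<alpha> (s + int k)))\<^sup>2 = (1 - (cmod a)\<^sup>2) * (1 - (cmod b)\<^sup>2)"
    using ab1 by (simp add: rho_def norm_mult power_mult_distrib a_def b_def)
  moreover have "(2 * Re (cnj ?w * \<zeta>) + 2 * cmod d)\<^sup>2 < (2 * cmod (rho \<alpha> s * rho \<alpha> (s + int k)))\<^sup>2"
    using power_strict_mono[OF band, of 2] by (simp add: \<zeta>_def)
  ultimately have pos: "4 * (cmod (C \<zeta>))\<^sup>2 < (cmod (B \<zeta>))\<^sup>2"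
    using band_discriminant[OF w1 \<zeta>1 ab] by (simp add: B_def C_def power_mult_distrib)
  obtain p where p: "((\<lambda>r. schur_plus \<alpha> q (?z r)) \<longlongrightarrow> p) (at_left 1)"
    "((\<lambda>r. ?z r * schur_minus \<alpha> q (?z r)) \<longlongrightarrow> cnj p) (at_left 1)"
  proof (rule band_limit[where A = "\<lambda>r. A (?z r ^ k)" and B = "\<lambda>r. B (?z r ^ k)" and C = "\<lambda>r. C (?z r ^ k)"
        and P = "\<lambda>r. schur_plus \<alpha> q (?z r)" and v = "\<lambda>r. ?z r * schur_minus \<alpha> q (?z r)" and F = "at_left 1"])
    show "((\<lambda>r. A (?z r ^ k)) \<longlongrightarrow> A \<zeta>) (at_left 1)" "((\<lambda>r. B (?z r ^ k)) \<longlongrightarrow> B \<zeta>) (at_left 1)"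
      "((\<lambda>r. C (?z r ^ k)) \<longlongrightarrow> C \<zeta>) (at_left 1)"
      unfolding A_def B_def C_def by (intro tendsto_intros zk)+
    show "\<forall>\<^sub>F r in at_left 1. A (?z r ^ k) * (schur_plus \<alpha> q (?z r))\<^sup>2 + B (?z r ^ k) * schur_plus \<alpha> q (?z r) + C (?z r ^ k) = 0 \<and>
        C (?z r ^ k) * (?z r * schur_minus \<alpha> q (?z r))\<^sup>2 + B (?z r ^ k) * (?z r * schur_minus \<alpha> q (?z r)) + A (?z r ^ k) = 0 \<and>
        cmod (schur_plus \<alpha> q (?z r) * (?z r * schur_minus \<alpha> q (?z r))) < 1"
      using ev
    proof eventually_elim
      case (elim r)
      then have "cmod (?z r) < 1" by (simp add: norm_mult)
      from sieved_schur_equations[OF this q(1)] show ?case unfolding A_def B_def C_def a_def b_def by blast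
    qed
    show "A \<zeta> = - \<zeta>\<^sup>2 * cnj (C \<zeta>)"
    proof -
      have "- \<zeta>\<^sup>2 * cnj (C \<zeta>) = cnj ?w * (\<zeta> * (\<zeta> * cnj \<zeta>) * cnj b + \<zeta>\<^sup>2 * cnj a)"
        by (simp add: C_def algebra_simps power2_eq_square)
      then show ?thesis unfolding \<zeta>c by (simp add: A_def algebra_simps)
    qed
    show "B \<zeta> = - \<zeta>\<^sup>2 * cnj (B \<zeta>)"
    proof -
      have "- \<zeta>\<^sup>2 * cnj (B \<zeta>) = ?w * ((\<zeta> * cnj \<zeta>) * (\<zeta> * cnj \<zeta>)) - cnj ?w * \<zeta>\<^sup>2"
        by (simp add: B_def algebra_simps power2_eq_square)
      then show ?thesis unfolding \<zeta>c by (simp add: B_def)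
    qed
    show "\<zeta> \<noteq> 0" using \<zeta>1 by auto
    show "4 * (cmod (C \<zeta>))\<^sup>2 < (cmod (B \<zeta>))\<^sup>2" by (rule pos)
  qed
  have plus: "((\<lambda>r. schur_plus \<alpha> n (?z r)) \<longlongrightarrow> cis t ^ j * p) (at_left 1)"
  proof (rule Lim_transform_eventually)
    show "((\<lambda>r. ?z r ^ j * schur_plus \<alpha> q (?z r)) \<longlongrightarrow> cis t ^ j * p) (at_left 1)" by (intro tendsto_intros z1 p)
    show "\<forall>\<^sub>F r in at_left 1. ?z r ^ j * schur_plus \<alpha> q (?z r) = schur_plus \<alpha> n (?z r)"
      using ev
    proof eventually_elim
      case (elim r)
      then have "cmod (?z r) < 1" by (simp add: norm_mult)
      from schur_plus_gap[where \<alpha> = \<alpha>, OF lt1 this gap] show ?case unfolding j(1) by simp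
    qed
  qed
  \<comment> \<open>At \<open>q\<close> the product \<open>z f\<^sub>-\<close> is
    \<open>z ^ Suc j\<close> times \<open>f\<^sub>-\<close> at \<open>n\<close>, so the limit at
    \<open>n\<close> is obtained by division.\<close>
  have minus: "((\<lambda>r. schur_minus \<alpha> n (?z r)) \<longlongrightarrow> cnj p / cis t ^ Suc j) (at_left 1)"
  proof (rule Lim_transform_eventually)
    show "((\<lambda>r. ?z r * schur_minus \<alpha> q (?z r) / ?z r ^ Suc j) \<longlongrightarrow> cnj p / cis t ^ Suc j) (at_left 1)"
      by (intro tendsto_intros z1 p) simp
    show "\<forall>\<^sub>F r in at_left 1. ?z r * schur_minus \<alpha> q (?z r) / ?z r ^ Suc j = schur_minus \<alpha> n (?z r)"
      using ev
    proof eventually_elim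
      case (elim r)
      then have "cmod (?z r) < 1" by (simp add: norm_mult)
      from schur_minus_gap[where \<alpha> = \<alpha>, OF lt1 this gap] have "schur_minus \<alpha> q (?z r) = ?z r ^ j * schur_minus \<alpha> n (?z r)" unfolding j(1) by simp
      moreover have "?z r \<noteq> 0" using elim by simp
      ultimately show ?case by simp
    qed
  qed
  have "cnj (cis t ^ Suc j) * cis t ^ Suc j = 1"
    using complex_norm_square[of "cis t ^ Suc j"] by (simp add: norm_mult norm_power mult.commute)
  moreover have "cis t ^ Suc j \<noteq> 0" by simp
  ultimately have "cis t * (cis t ^ j * p) = cnj (cnj p / cis t ^ Suc j)"
    by (simp add: field_simps)
  with plus minus show ?thesis by blast
qed

text \<open>The angles of the band edges solve equations of this kind, so they form a null
  set.\<close>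

lemma countable_cos_eq: "countable {x. cos x = (c::real)}"
proof (cases "\<exists>y. cos y = c")
  case True
  then obtain y where y: "cos y = c" by blast
  have "{x. cos x = c} \<subseteq> (\<lambda>n. y + 2 * n * pi) ` \<int> \<union> (\<lambda>n. - y + 2 * n * pi) ` \<int>"
    using y cos_eq[of _ y] by auto
  moreover have "countable ((\<lambda>n. y + 2 * n * pi) ` \<int> \<union> (\<lambda>n. - y + 2 * n * pi) ` (\<int> :: real set))"
    by (intro countable_Un countable_image countable_int)
  ultimately show ?thesis by (rule countable_subset)
qed simp

lemma sieved_reflectionless: "cmv_reflectionless \<alpha> (spectrum ell2 (cmv \<alpha>))"
  unfolding cmv_reflectionless_def
proof
  fix n
  have ver: "verblunsky \<alpha>" using lt1 by (simp add: verblunsky_def less_imp_le)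
  have k: "0 < k" by (rule sieved_pos[OF sv])
  define \<kappa> where "\<kappa> = cmod (rho \<alpha> s * rho \<alpha> (s + int k))"
  define y where "y = (\<lambda>t. 2 * Re (cnj (phase d) * cis t ^ k) + 2 * cmod d)"
  \<comment> \<open>The angles of the band edges; elsewhere a point of the spectrum satisfies the
    strict band inequality.\<close>
  define N where "N = {t. \<bar>y t\<bar> = 2 * \<kappa>}"
  obtain \<phi> where \<phi>: "phase d = cis \<phi>" using phase(2)[OF sv] by (metis complex_norm_eq_1_exp cis_conv_exp)
  have Re: "Re (cnj (cis \<phi>) * cis x) = cos (x - \<phi>)" for x by (simp add: cos_diff)
  have yt: "y t = 2 * cos (of_nat k * t - \<phi>) + 2 * cmod d" for t
    unfolding y_def \<phi> Complex.DeMoivre Re ..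
  have "N \<subseteq> (\<lambda>x. (x + \<phi>) / of_nat k) ` ({x. cos x = \<kappa> - cmod d} \<union> {x. cos x = - \<kappa> - cmod d})"
  proof
    fix t assume "t \<in> N"
    then have "cos (of_nat k * t - \<phi>) = \<kappa> - cmod d \<or> cos (of_nat k * t - \<phi>) = - \<kappa> - cmod d"
      unfolding N_def yt by (simp add: abs_if split: if_splits)
    moreover have "t = (of_nat k * t - \<phi> + \<phi>) / of_nat k" using k by simp
    ultimately show "t \<in> (\<lambda>x. (x + \<phi>) / of_nat k) ` ({x. cos x = \<kappa> - cmod d} \<union> {x. cos x = - \<kappa> - cmod d})" by blast
  qed
  then have "countable N"
    by (rule countable_subset) (intro countable_image countable_Un countable_cos_eq)
  then have "AE t in lborel. t \<notin> N" by (intro AE_not_in countable_imp_null_set_lborel)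
  then show "AE t in lborel. cis t \<in> spectrum ell2 (cmv \<alpha>) \<longrightarrow>
        (\<exists>p m. ((\<lambda>r. schur_plus \<alpha> n (of_real r * cis t)) \<longlongrightarrow> p) (at_left 1) \<and>
               ((\<lambda>r. schur_minus \<alpha> n (of_real r * cis t)) \<longlongrightarrow> m) (at_left 1) \<and> cis t * p = cnj m)"
  proof (rule eventually_mono, intro impI)
    fix t assume t: "t \<notin> N" "cis t \<in> spectrum ell2 (cmv \<alpha>)"
    then have "\<not> 2 * \<kappa> < \<bar>y t\<bar>"
      using sieved_resolvent[OF sv ver, of "cis t"] by (auto simp: spectrum_def \<kappa>_def y_def)
    then have "\<bar>y t\<bar> < 2 * \<kappa>" using t(1) by (simp add: N_def)
    then show "\<exists>p m. ((\<lambda>r. schur_plus \<alpha> n (of_real r * cis t)) \<longlongrightarrow> p) (at_left 1) \<and>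
               ((\<lambda>r. schur_minus \<alpha> n (of_real r * cis t)) \<longlongrightarrow> m) (at_left 1) \<and> cis t * p = cnj m"
      unfolding \<kappa>_def y_def by (rule sieved_reflection_at_band_point)
  qed
qed

end

text \<open>Both Schur functions vanish in the disc, so the identity holds with both boundary values
  zero.\<close>

lemma free_reflectionless:
  assumes "\<And>n. \<alpha> n = 0"
  shows "cmv_reflectionless \<alpha> S"
proof -
  have zero: "schur_lim (\<lambda>_. 0) z = 0" if "cmod z < 1" for z
    by (rule schur_lim_unique[where A = "\<lambda>_. 0", symmetric]) (use that in auto)
  have "schur_plus \<alpha> n z = 0" "schur_minus \<alpha> n z = 0" if "cmod z < 1" for n z
    unfolding schur_plus_def schur_minus_def assms complex_cnj_zero minus_zero
    using schur_fun_eq[of "\<lambda>_. 0" z] zero[OF that] that by auto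
  then have "((\<lambda>r. schur_plus \<alpha> n (of_real r * cis t)) \<longlongrightarrow> 0) (at_left 1)"
    "((\<lambda>r. schur_minus \<alpha> n (of_real r * cis t)) \<longlongrightarrow> 0) (at_left 1)" for n t
    using eventually_at_left_real[of 0 1]
    by (auto intro!: tendsto_eventually elim!: eventually_mono simp: norm_mult)
  then show ?thesis unfolding cmv_reflectionless_def
    by (intro allI always_eventually impI exI[of _ 0]) simp
qed

lemma khrushchev_class_dichotomy:
  assumes ver: "verblunsky \<alpha>" and kh: "khrushchev_class \<alpha>"
    and "\<not> single_coefficient_class \<alpha>" "\<not> unimodular_single_coefficient \<alpha>"
  shows "cmv_reflectionless \<alpha> (spectrum ell2 (cmv \<alpha>)) \<or> pure_point_spectrum ell2 (cmv \<alpha>)"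
proof (cases "\<exists>p q. \<alpha> p \<noteq> 0 \<and> \<alpha> q \<noteq> 0 \<and> p \<noteq> q")
  case True
  then obtain k s d where sv: "sieved k s d \<alpha>" using khrushchev_sieved[OF kh] by metis
  show ?thesis
  proof (cases "\<exists>m. cmod (\<alpha> m) = 1")
    case True
    then show ?thesis using sieved_unimodular_pure_point[OF sv ver] by blast
  next
    case False
    then have "cmod (\<alpha> n) < 1" for n using ver by (simp add: verblunsky_def less_le)
    then show ?thesis using sieved_reflectionless[OF sv] by blast
  qed
next
  case False
  have "\<alpha> n = 0" for n
  proof (rule ccontr)
    assume n: "\<alpha> n \<noteq> 0"
    then have "\<forall>m. m \<noteq> n \<longrightarrow> \<alpha> m = 0" using False by blast
    moreover have "cmod (\<alpha> n) \<le> 1" "0 < cmod (\<alpha> n)" using ver n by (simp_all add: verblunsky_def)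
    \<comment> \<open>A lone nonzero coefficient has modulus below one or equal to one; these are
      the two excluded classes.\<close>
    ultimately have "single_coefficient_class \<alpha> \<or> unimodular_single_coefficient \<alpha>"
      unfolding single_coefficient_class_def unimodular_single_coefficient_def
      by (cases "cmod (\<alpha> n) = 1") auto
    then show False using assms by blast
  qed
  then show ?thesis using free_reflectionless by blast
qed

theorem proposition1p13:
  shows "(\<forall>a b. whole_line_jacobi a b \<and> simon_class a b \<longrightarrow>
            (jacobi_periodic a b \<and> jacobi_reflectionless a b (jacobi_spectrum a b)) \<or>
            (jacobi_direct_sum_2x2 a b \<and>
             pure_point_spectrum (jacobi_dom a b) (jacobi a b) \<and>
             eigenvalues_infinite_multiplicity (jacobi_dom a b) (jacobi a b))) \<and>
         (\<forall>\<alpha>. verblunsky \<alpha> \<and> khrushchev_class \<alpha> \<and>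
            \<not> single_coefficient_class \<alpha> \<and> \<not> unimodular_single_coefficient \<alpha> \<longrightarrow>
            cmv_reflectionless \<alpha> (spectrum ell2 (cmv \<alpha>)) \<or>
            pure_point_spectrum ell2 (cmv \<alpha>))"
  using simon_class_dichotomy khrushchev_class_dichotomy by blast

end
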